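(* For every $X\in\mathcal H_{\rm sp}$ and every $M\in\mathbb R^P$, $$\langle A_MX,X\rangle=-\frac12\int_{\mathbb R^3}\big|\mathbf B^{\rm vect}(x,X)\big|^2\,dx,$$ where the norm in the integrand is that of $\mathcal H_{\rm sp}^3$.
   Context: Fix an integer $P\ge1$ and points $x^{[1]},\dots,x^{[P]}\in\mathbb R^3$. Let $\phi\in\mathcal S(\mathbb R)$ and for $k\in\mathbb R^3$ write $\phi(|k|)$. Let $\mathfrak H=\{V\in L^2(\mathbb R^3,\mathbb C^3):\ k\cdot V(k)=0\text{ a.e.}\}$, $\mathcal H_{\rm ph}$ the symmetric Fock space over $\mathfrak H$ with vacuum $\Psi_0$, Segal fields $\Phi_S(V)=\frac1{\sqrt2}(a^*(V)+a(V))$, and $H_{\rm ph}=d\Gamma(M_\omega)$ with $M_\omega$ multiplication by $|k|$. Let $\mathcal H_{\rm sp}=(\mathbb C^2)^{\otimes P}$, $\mathcal H_{\rm tot}=\mathcal H_{\rm ph}\otimes\mathcal H_{\rm sp}$, $\sigma_1,\sigma_2,\sigma_3$ the Pauli matrices, and $\sigma_m^{[\lambda]}$ the operator acting as $\sigma_m$ on the $\lambda$-th tensor factor and as identity elsewhere. For $m\in\{1,2,3\}$, $x\in\mathbb R^3$, $B_{m,x}(k)=\frac{i\phi(|k|)|k|^{1/2}}{(2\pi)^{3/2}}e^{-ik\cdot x}\frac{k\times e_m}{|k|}$ ($e_m$ canonical basis). For $M=(M^{[1]},\dots,M^{[P]})\in\mathbb R^P$, $H_{\rm int}(M)=\sum_{\lambda=1}^P\sum_{m=1}^3M^{[\lambda]}\Phi_S(B_{m,x^{[\lambda]}})\otimes\sigma_m^{[\lambda]}$.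 Let $EX=\Psi_0\otimes X$ and define the operator $A_M$ on $\mathcal H_{\rm sp}$ by $A_MX=-E^*H_{\rm int}(M)(H_{\rm ph}^{-1}\otimes I)H_{\rm int}(M)EX$, where $H_{\rm int}(M)EX$ lies in the one-photon sector, on which $H_{\rm ph}^{-1}$ is multiplication by $1/|k|$. Let $\rho(x)=(2\pi)^{-3}\int_{\mathbb R^3}\phi(|k|)e^{ik\cdot x}dk$. For $a\in\mathbb R^3$ and $Y=(Y_1,Y_2,Y_3)\in\mathcal H_{\rm sp}^3$, $a\times Y\in\mathcal H_{\rm sp}^3$ is defined by the usual cross product formula, and $\sigma^{[\lambda]}X=(\sigma_1^{[\lambda]}X,\sigma_2^{[\lambda]}X,\sigma_3^{[\lambda]}X)$. Define $\mathbf j^{\rm vect}(x,X)=\sum_{\lambda=1}^PM^{[\lambda]}\nabla\rho(x-x^{[\lambda]})\times\sigma^{[\lambda]}X\in\mathcal H_{\rm sp}^3$, and let $x\mapsto\mathbf B^{\rm vect}(x,X)$ be the square-integrable $\mathcal H_{\rm sp}^3$-valued field solving $\nabla\cdot\mathbf B^{\rm vect}=0$, $\nabla\times\mathbf B^{\rm vect}=\mathbf j^{\rm vect}(\cdot,X)$. *)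

theory Defs
  imports "HOL-Analysis.Analysis"
begin

definition schwartz_real :: "(real \<Rightarrow> real) \<Rightarrow> bool" where
  "schwartz_real f \<longleftrightarrow>
     (\<forall>n x. ((deriv ^^ n) f) differentiable (at x)) \<and>
     (\<forall>a b. bounded (range (\<lambda>x. x ^ a * (deriv ^^ b) f x)))"

definition schwartz :: "(real \<Rightarrow> complex) \<Rightarrow> bool" where
  "schwartz f \<longleftrightarrow> schwartz_real (\<lambda>x. Re (f x)) \<and> schwartz_real (\<lambda>x. Im (f x))"

text \<open>A vector of (C^2)^{\<otimes>P} is a function on spin configurations, i.e. boolean
  lists of length P (False = first basis vector, True = second). Factor number
  l (0-based, l < P) is the l-th list entry. Values off configurations are irrelevant.\<close>

definition cfg :: "nat \<Rightarrow> bool list set" where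
  "cfg P = {s. length s = P}"

definition spin_inner :: "nat \<Rightarrow> (bool list \<Rightarrow> complex) \<Rightarrow> (bool list \<Rightarrow> complex) \<Rightarrow> complex" where
  "spin_inner P X Y = (\<Sum>s\<in>cfg P. X s * cnj (Y s))"

text \<open>Pauli matrices sigma_1, sigma_2, sigma_3 (index m :: 3), entries (row a, column b),
  False ~ index 0, True ~ index 1.\<close>
definition pauli :: "3 \<Rightarrow> bool \<Rightarrow> bool \<Rightarrow> complex" where
  "pauli m a b =
     (if m = 1 then (if a \<noteq> b then 1 else 0)
      else if m = 2 then (if \<not> a \<and> b then - \<i> else if a \<and> \<not> b then \<i> else 0)
      else (if a = b then (if a then -1 else 1) else 0))"

definition pauli_on :: "3 \<Rightarrow> nat \<Rightarrow> (bool list \<Rightarrow> complex) \<Rightarrow> (bool list \<Rightarrow> complex)" where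
  "pauli_on m l X s = (\<Sum>b\<in>UNIV. pauli m (s ! l) b * X (s[l := b]))"

definition pauli_vec :: "nat \<Rightarrow> (bool list \<Rightarrow> complex) \<Rightarrow> bool list \<Rightarrow> complex^3" where
  "pauli_vec l X s = (\<chi> m. pauli_on m l X s)"

definition Bcoup :: "(real \<Rightarrow> complex) \<Rightarrow> 3 \<Rightarrow> real^3 \<Rightarrow> real^3 \<Rightarrow> complex^3" where
  "Bcoup \<phi> m y k =
     (\<i> * \<phi> (norm k) * complex_of_real (sqrt (norm k) / ((2 * pi) powr (3/2)))
        * cis (- (k \<bullet> y)))
     *s (\<chi> j. complex_of_real ((cross3 k (axis m 1)) $ j / norm k))"

text \<open>One-photon states with spin: functions k \<mapsto> (s \<mapsto> C^3).
  H_int(M) E X is the one-photon state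
  k \<mapsto> sum_{l,m} M_l (1/sqrt 2) B_{m,x_l}(k) \<otimes> sigma_m^{[l]} X,
  since Phi_S(V) Psi_0 = (1/sqrt 2) a^*(V) Psi_0 = (1/sqrt 2) V.\<close>
definition HintE ::
  "(real \<Rightarrow> complex) \<Rightarrow> (nat \<Rightarrow> real^3) \<Rightarrow> (nat \<Rightarrow> real) \<Rightarrow> nat \<Rightarrow> (bool list \<Rightarrow> complex)
    \<Rightarrow> real^3 \<Rightarrow> bool list \<Rightarrow> complex^3" where
  "HintE \<phi> xs M P X k s =
     (\<Sum>l<P. \<Sum>m\<in>UNIV. (complex_of_real (M l / sqrt 2) * pauli_on m l X s) *s Bcoup \<phi> m (xs l) k)"

text \<open>H_ph^{-1} on the one-photon sector: multiplication by 1/|k|.\<close>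
definition Hph_inv1 :: "(real^3 \<Rightarrow> bool list \<Rightarrow> complex^3) \<Rightarrow> real^3 \<Rightarrow> bool list \<Rightarrow> complex^3" where
  "Hph_inv1 \<psi> k s = complex_of_real (1 / norm k) *s \<psi> k s"

text \<open>E^* H_int(M) applied to a one-photon state psi: only the annihilation part
  contributes to the vacuum component, Phi_S(V) psi has vacuum component
  (1/sqrt 2) <V, psi> = (1/sqrt 2) int conj(V(k)) . psi(k) dk.\<close>
definition EstarHint ::
  "(real \<Rightarrow> complex) \<Rightarrow> (nat \<Rightarrow> real^3) \<Rightarrow> (nat \<Rightarrow> real) \<Rightarrow> nat
    \<Rightarrow> (real^3 \<Rightarrow> bool list \<Rightarrow> complex^3) \<Rightarrow> bool list \<Rightarrow> complex" where
  "EstarHint \<phi> xs M P \<psi> s =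
     (\<Sum>l<P. \<Sum>m\<in>UNIV. complex_of_real (M l / sqrt 2) *
        pauli_on m l (\<lambda>s'. LINT k|lborel. (\<Sum>j\<in>UNIV. cnj (Bcoup \<phi> m (xs l) k $ j) * \<psi> k s' $ j)) s)"

definition A_op ::
  "(real \<Rightarrow> complex) \<Rightarrow> (nat \<Rightarrow> real^3) \<Rightarrow> (nat \<Rightarrow> real) \<Rightarrow> nat
    \<Rightarrow> (bool list \<Rightarrow> complex) \<Rightarrow> bool list \<Rightarrow> complex" where
  "A_op \<phi> xs M P X s = - EstarHint \<phi> xs M P (Hph_inv1 (HintE \<phi> xs M P X)) s"

definition rho :: "(real \<Rightarrow> complex) \<Rightarrow> real^3 \<Rightarrow> complex" where
  "rho \<phi> x = complex_of_real ((2 * pi) powr (-3)) * (LINT k|lborel. \<phi> (norm k) * cis (k \<bullet> x))"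

definition pd :: "(real^3 \<Rightarrow> 'b::real_normed_vector) \<Rightarrow> real^3 \<Rightarrow> 3 \<Rightarrow> 'b" where
  "pd f x i = frechet_derivative f (at x) (axis i 1)"

definition grad_c :: "(real^3 \<Rightarrow> complex) \<Rightarrow> real^3 \<Rightarrow> complex^3" where
  "grad_c f x = (\<chi> i. pd f x i)"

definition ccross :: "complex^3 \<Rightarrow> complex^3 \<Rightarrow> complex^3" where
  "ccross a b = (\<chi> i. if i = 1 then a$2 * b$3 - a$3 * b$2
                      else if i = 2 then a$3 * b$1 - a$1 * b$3
                      else a$1 * b$2 - a$2 * b$1)"

definition divergence :: "(real^3 \<Rightarrow> complex^3) \<Rightarrow> real^3 \<Rightarrow> complex" where
  "divergence f x = (\<Sum>i\<in>UNIV. pd f x i $ i)"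

definition curl :: "(real^3 \<Rightarrow> complex^3) \<Rightarrow> real^3 \<Rightarrow> complex^3" where
  "curl f x = (\<chi> i. if i = 1 then pd f x 2 $ 3 - pd f x 3 $ 2
                    else if i = 2 then pd f x 3 $ 1 - pd f x 1 $ 3
                    else pd f x 1 $ 2 - pd f x 2 $ 1)"

definition jvect ::
  "(real \<Rightarrow> complex) \<Rightarrow> (nat \<Rightarrow> real^3) \<Rightarrow> (nat \<Rightarrow> real) \<Rightarrow> nat
    \<Rightarrow> (bool list \<Rightarrow> complex) \<Rightarrow> real^3 \<Rightarrow> bool list \<Rightarrow> complex^3" where
  "jvect \<phi> xs M P X x s =
     (\<Sum>l<P. complex_of_real (M l) *s ccross (grad_c (rho \<phi>) (x - xs l)) (pauli_vec l X s))"

end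

theory Submission
  imports Defs "HOL-Probability.Characteristic_Functions" "HOL-Real_Asymp.Real_Asymp"
begin

text \<open>Since the Pauli matrices are Hermitian, \<open>\<langle>A\<^sub>M X, X\<rangle>\<close> is minus the sum over spin
  configurations of \<open>\<integral> |H\<^sub>i\<^sub>n\<^sub>t(M) E X|\<^sup>2 / |k| dk\<close>, i.e. up to a constant the integral of
  \<open>|\<phi>(|k|)|\<^sup>2 |k \<times> S(k)|\<^sup>2 / |k|\<^sup>2\<close> with \<open>S(k) = \<Sum> M\<^sub>\<lambda> e\<^bsup>-ik\<cdot>x\<^sub>\<lambda>\<^esup> \<sigma>\<^bsup>[\<lambda>]\<^esup> X\<close>. On the
  other side, the inverse Fourier transform of \<open>\<phi>(|k|) (S - k (k\<cdot>S) / |k|\<^sup>2)\<close> is a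
  square-integrable solution of the div-curl system, and Plancherel gives its energy.

  It remains to see that this is the given field \<open>B\<close>, which is only assumed differentiable, so that
  its partial derivatives need be neither continuous nor integrable. The difference \<open>D\<close> of the two
  fields is square integrable with vanishing divergence and curl. For the gradient \<open>p\<close> of
  \<open>(|x-a|\<^sup>2 + \<epsilon>\<^sup>2)\<^bsup>-1/2\<^esup>\<close> the vector field \<open>D\<^sub>i p + p\<^sub>i D - (D\<cdot>p) e\<^sub>i\<close> is integrable and has
  divergence \<open>D\<^sub>i div p = -3 \<epsilon>\<^sup>2 (|x-a|\<^sup>2 + \<epsilon>\<^sup>2)\<^bsup>-5/2\<^esup> D\<^sub>i\<close>, in which no derivative of \<open>D\<close>
  is left. Its integral vanishes by a Goursat-type divergence theorem, and letting \<open>\<epsilon> \<rightarrow> 0\<close> yields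
  \<open>D\<^sub>i(a) = 0\<close>.\<close>

section \<open>Integrals over Euclidean space\<close>

text \<open>What the divergence theorem gets in place of continuous derivatives is a continuous
  total divergence. The field to which it is applied is a column of the polarised Maxwell stress
  tensor of \<open>D\<close> and \<open>p\<close>: for two curl-free fields its divergence is
  \<open>D_i div p + p_i div D\<close>, and the second term vanishes. The softened Newton potential
  suits three dimensions: its gradient decays like |x|^(-2), hence is square integrable, so its
  products with \<open>D\<close> are integrable by Cauchy-Schwarz; and 3 \<epsilon>^2 (|x-a|^2 +
  \<epsilon>^2)^(-5/2) is an approximate identity whose mass 4 pi does not depend on \<epsilon>. On
  the Fourier side the projected amplitude in general has no limit at k = 0, because the limit
  depends on the direction, and its transform need not be integrable. Plancherel is therefore proved
  by Gaussian regularisation for bounded integrable amplitudes that are continuous almost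
  everywhere. For fixed X the div-curl system does not couple spin configurations, so the field is
  identified for each configuration separately.\<close>

lemma lborel_vec_prod:
  fixes f :: "'n::finite \<Rightarrow> real \<Rightarrow> 'b::{real_normed_field,banach,second_countable_topology}"
  assumes f: "\<And>i. integrable lborel (f i)"
  shows integrable_vec_prod: "integrable lborel (\<lambda>x::real^'n. \<Prod>i\<in>UNIV. f i (x $ i))"
    and integral_vec_prod: "(LINT x|lborel. (\<Prod>i\<in>UNIV. f i ((x::real^'n) $ i))) = (\<Prod>i\<in>UNIV. LINT t|lborel. f i t)"
proof -
  interpret product_sigma_finite "\<lambda>_::real^'n. lborel :: real measure" ..
  \<comment> \<open>\<open>lborel\<close> is the image of a product measure indexed by
    \<open>Basis\<close>, whereas the factors \<open>f i\<close> are indexed by coordinates;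
    \<open>ix\<close> translates basis vectors back into coordinates.\<close>
  define ix :: "real^'n \<Rightarrow> 'n" where "ix = the_inv_into UNIV (\<lambda>i. axis i 1)"
  have inj: "inj (\<lambda>i. axis i 1 :: real^'n)" by (auto simp: inj_def axis_eq_axis)
  have ix: "ix (axis i 1) = i" for i unfolding ix_def by (rule the_inv_into_f_f[OF inj]) simp
  have B: "(Basis :: (real^'n) set) = range (\<lambda>i. axis i 1)" by (auto simp: Basis_vec_def)
  define g where "g b = f (ix b)" for b
  have g: "integrable lborel (g b)" for b using f by (simp add: g_def)
  have [measurable]: "g b \<in> borel_measurable borel" for b using borel_measurable_integrable[OF g[of b]] by simp
  have eq: "(\<Prod>i\<in>UNIV. f i (x $ i)) = (\<Prod>b\<in>Basis. g b (x \<bullet> b))" for x :: "real^'n"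
    unfolding B by (subst prod.reindex[OF inj]) (auto simp: g_def ix inner_axis)
  have comp: "(\<Prod>b\<in>Basis. g b ((\<Sum>a\<in>Basis. y a *\<^sub>R a) \<bullet> b)) = (\<Prod>b\<in>Basis. g b (y b))" for y :: "real^'n \<Rightarrow> real"
    by (intro prod.cong) (auto simp: inner_sum_left_Basis)
  have meas: "(\<lambda>x::real^'n. \<Prod>b\<in>Basis. g b (x \<bullet> b)) \<in> borel_measurable borel" by measurable
  have meas2: "(\<lambda>f. \<Sum>b\<in>Basis. f b *\<^sub>R b) \<in> (\<Pi>\<^sub>M b\<in>(Basis::(real^'n) set). (lborel::real measure)) \<rightarrow>\<^sub>M borel" by measurable
  show "integrable lborel (\<lambda>x::real^'n. \<Prod>i\<in>UNIV. f i (x $ i))"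
    unfolding eq
    by (subst lborel_eq, subst integrable_distr_eq[OF meas2 meas], unfold comp, rule product_integrable_prod) (auto simp: g)
  show "(LINT x|lborel. (\<Prod>i\<in>UNIV. f i ((x::real^'n) $ i))) = (\<Prod>i\<in>UNIV. LINT t|lborel. f i t)"
    unfolding eq
    apply (subst lborel_eq, subst integral_distr[OF meas2 meas], unfold comp, subst product_integral_prod)
    apply (auto simp: g)
    unfolding B by (subst prod.reindex[OF inj]) (auto simp: g_def ix)
qed

lemma integral_lborel_affine:
  fixes f :: "'a::euclidean_space \<Rightarrow> 'b::{banach, second_countable_topology}"
  assumes "c > 0" and [measurable]: "f \<in> borel_measurable borel"
  shows integral_affine_euclidean: "(LINT x|lborel. f x) = c ^ DIM('a) *\<^sub>R (LINT x|lborel. f (t + c *\<^sub>R x))"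
    and integrable_affine_euclidean: "integrable lborel f \<longleftrightarrow> integrable lborel (\<lambda>x. f (t + c *\<^sub>R x))"
proof -
  have L: "lborel = density (distr lborel borel (\<lambda>x::'a. t + c *\<^sub>R x)) (\<lambda>_. ennreal (c ^ DIM('a)))"
    using lborel_affine[of c t] assms by simp
  show "(LINT x|lborel. f x) = c ^ DIM('a) *\<^sub>R (LINT x|lborel. f (t + c *\<^sub>R x))"
    apply (subst L) using assms by (simp add: integral_density integral_distr)
  show "integrable lborel f \<longleftrightarrow> integrable lborel (\<lambda>x. f (t + c *\<^sub>R x))"
  proof (subst L, subst integrable_density, goal_cases)
    case 4
    have "integrable lborel (\<lambda>x. c ^ DIM('a) *\<^sub>R f (t + c *\<^sub>R x)) \<longleftrightarrow> integrable lborel (\<lambda>x. f (t + c *\<^sub>R x))"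
      using integrable_scaleR_right[of "inverse (c ^ DIM('a))" lborel "\<lambda>x. c ^ DIM('a) *\<^sub>R f (t + c *\<^sub>R x)"] \<open>c > 0\<close>
      by auto
    then show ?case by (simp add: integrable_distr_eq)
  qed (use assms in auto)
qed

text \<open>The exponent -2/3 is one third of -2, as three such factors must dominate (1 +
  |x|^2)^(-2); since 2 * 2/3 > 1 the factor is still integrable. It is compared with (1 +
  |t|)^(-4/3), which has the primitive -3 (1 + t)^(-1/3) on the half line.\<close>

lemma integrable_japanese_real:
  "integrable lborel (\<lambda>t::real. (1 + t\<^sup>2) powr (-2/3))"
proof -
  let ?g = "\<lambda>t::real. (1 + \<bar>t\<bar>) powr (-4/3)"
  let ?h = "\<lambda>t::real. ?g t * indicator {0..} t"
  have "(\<integral>\<^sup>+x. ennreal ((1 + x) powr (-4/3)) * indicator {0 ..} x \<partial>lborel) = 0 - (- 3 * (1 + 0::real) powr (-1/3))"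
  proof (rule nn_integral_FTC_atLeast)
    fix x :: real assume "0 \<le> x"
    then show "((\<lambda>x. - 3 * (1 + x) powr (-1/3)) has_real_derivative (1 + x) powr (-4/3)) (at x)"
      by (auto intro!: derivative_eq_intros simp: divide_powr_uminus powr_diff)
  next
    show "((\<lambda>x::real. - 3 * (1 + x) powr (-1/3)) \<longlongrightarrow> 0) at_top" by real_asymp
  qed auto
  then have "(\<integral>\<^sup>+x. ennreal (?h x) \<partial>lborel) < \<infinity>"
    by (subst nn_integral_cong[where v="\<lambda>x. ennreal ((1 + x) powr (-4/3)) * indicator {0 ..} x"])
       (auto split: split_indicator)
  then have h: "integrable lborel ?h"
    by (intro integrableI_nonneg) auto
  then have "integrable lborel (\<lambda>t. ?h (0 + (-1) * t))"
    by (subst (asm) lborel_integrable_real_affine_iff[symmetric, of "-1" _ 0]) auto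
  then have "integrable lborel (\<lambda>t. 2 * (?h t + ?h (- t)))" using h by auto
  then show ?thesis
  proof (rule Bochner_Integration.integrable_bound, goal_cases)
    case 2
    have "(1 + t\<^sup>2) powr (-2/3) \<le> 2 * (1 + \<bar>t\<bar>) powr (-4/3)" for t :: real
    proof -
      have "(1 + \<bar>t\<bar>)\<^sup>2 / 2 \<le> 1 + t\<^sup>2"
        using zero_le_power2[of "1 - \<bar>t\<bar>"] by (simp add: power2_eq_square algebra_simps)
      then have "(1 + t\<^sup>2) powr (-2/3) \<le> ((1 + \<bar>t\<bar>)\<^sup>2 / 2) powr (-2/3)"
        by (intro powr_mono2') (auto intro!: add_pos_nonneg)
      also have "\<dots> = (1 + \<bar>t\<bar>) powr (-4/3) * 2 powr (2/3)"
        by (simp add: powr_divide powr_powr powr_minus field_simps flip: powr_numeral)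
      also have "\<dots> \<le> (1 + \<bar>t\<bar>) powr (-4/3) * 2 powr 1"
        by (intro mult_left_mono powr_mono) auto
      finally show ?thesis by (simp add: mult.commute)
    qed
    moreover have "(1 + \<bar>t\<bar>) powr (-4/3) \<le> ?h t + ?h (- t)" for t
      by (auto split: split_indicator)
    ultimately have "(1 + t\<^sup>2) powr (-2/3) \<le> 2 * (?h t + ?h (- t))" for t
      by (meson mult_left_mono order_trans zero_le_numeral)
    then show ?case by (intro AE_I2) (simp add: order_trans[OF _ abs_ge_self])
  qed auto
qed

text \<open>Since 1 + x_i^2 \<le> 1 + |x|^2 and the exponent is negative, a product of
  one-dimensional factors dominates the integrand. This gives integrability on three-space without
  polar coordinates.\<close>

lemma integrable_japanese:
  "integrable lborel (\<lambda>x::real^3. 1 / (1 + (norm x)\<^sup>2)\<^sup>2)"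
proof -
  have "integrable lborel (\<lambda>x::real^3. \<Prod>i\<in>UNIV. (1 + (x$i)\<^sup>2) powr (-2/3))"
    by (rule integrable_vec_prod) (rule integrable_japanese_real)
  then show ?thesis
  proof (rule Bochner_Integration.integrable_bound, goal_cases)
    case 2
    have "1 / (1 + (norm x)\<^sup>2)\<^sup>2 \<le> (\<Prod>i\<in>UNIV. (1 + (x$i)\<^sup>2) powr (-2/3))" for x :: "real^3"
    proof -
      let ?q = "1 + (norm x)\<^sup>2"
      have q: "?q > 0" by (simp add: add_pos_nonneg)
      have "1 / ?q\<^sup>2 = ?q powr (-2)" using q by (simp add: powr_minus field_simps powr_numeral)
      also have "\<dots> = (\<Prod>i\<in>(UNIV::3 set). ?q powr (-2/3))"
        using powr_add[of ?q "-2/3" "-2/3"] powr_add[of ?q "-4/3" "-2/3"] by (simp add: power3_eq_cube)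
      also have "\<dots> \<le> (\<Prod>i\<in>UNIV. (1 + (x$i)\<^sup>2) powr (-2/3))"
      proof (intro prod_mono conjI powr_mono2')
        fix i show "1 + (x $ i)\<^sup>2 \<le> ?q"
          using power_mono[OF component_le_norm_cart[of x i], of 2] by simp
      qed (auto intro!: add_pos_nonneg)
      finally show ?thesis .
    qed
    then show ?case by (auto intro!: AE_I2 simp: prod_nonneg)
  qed auto
qed

section \<open>The divergence theorem for everywhere differentiable fields\<close>

text \<open>A product of hat functions is a positive combination of such products of half the width. This
  replaces the subdivision of cubes in Goursat's argument and avoids surface integrals.\<close>

definition hat :: "real \<Rightarrow> real" where
  "hat t = max 0 (1 - \<bar>t\<bar>)"

text \<open>With half-open intervals the refinement identity below holds at every point, not only almost
  everywhere.\<close>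

definition dhat :: "real \<Rightarrow> real" where
  "dhat t = (if -1 \<le> t \<and> t < 0 then 1 else if 0 \<le> t \<and> t < 1 then -1 else 0)"

lemma hat_refine: "hat u = 1/2 * hat (2*u+1) + 1 * hat (2*u) + 1/2 * hat (2*u-1)"
  by (auto simp: hat_def max_def abs_if)

text \<open>Differentiating the relation for \<open>hat\<close>: the inner factor 2 turns the
  weights 1/2, 1, 1/2 into 1, 2, 1.\<close>

lemma dhat_refine: "dhat u = 1 * dhat (2*u+1) + 2 * dhat (2*u) + 1 * dhat (2*u-1)"
  by (auto simp: dhat_def)

lemma abs_hat: "\<bar>hat t\<bar> \<le> indicator {-1..1} t" and abs_dhat: "\<bar>dhat t\<bar> \<le> indicator {-1..1} t"
  by (auto simp: hat_def dhat_def split: split_indicator)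

lemma hat_eq: "hat t = indicator {-1..1} t + t ^ 1 * indicator {-1..0} t - t ^ 1 * indicator {0..1} t"
  by (auto simp: hat_def split: split_indicator)

text \<open>At t = 1 the closed interval contributes -1 although \<open>dhat 1 = 0\<close>; the
  singleton indicator repairs this and does not affect the integral.\<close>

lemma mult_dhat_eq: "t * dhat t = t ^ 1 * indicator {-1..0} t - t ^ 1 * indicator {0..1} t + indicator {1} t"
  by (auto simp: dhat_def split: split_indicator)

lemma dhat_eq: "dhat t = indicator {-1..<0} t - indicator {0..<1} t"
  by (auto simp: dhat_def split: split_indicator)

lemma measurable_hat [measurable]: "hat \<in> borel_measurable borel"
  unfolding hat_def[abs_def] by measurable

lemma measurable_dhat [measurable]: "dhat \<in> borel_measurable borel"
  unfolding dhat_eq[abs_def] by measurable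

lemma integrable_mult_Icc: "integrable lborel (\<lambda>t::real. t ^ 1 * indicator {a..b} t)"
  using borel_integrable_compact[of "{a..b}" "\<lambda>t::real. t"] by (simp add: mult.commute)

lemma integrable_hat: "integrable lborel hat"
  unfolding hat_eq[abs_def] using integrable_mult_Icc by (auto intro!: Bochner_Integration.integrable_add Bochner_Integration.integrable_diff integrable_real_indicator)

lemma integral_hat: "(LINT t|lborel. hat t) = 1"
  unfolding hat_eq using integrable_mult_Icc integral_power[of "-1" 0 1] integral_power[of 0 1 1]
  by (simp add: Bochner_Integration.integral_add Bochner_Integration.integral_diff integrable_real_indicator)

lemma integrable_dhat: "integrable lborel dhat"
  unfolding dhat_eq[abs_def] by (auto intro!: Bochner_Integration.integrable_diff integrable_real_indicator)

lemma integral_dhat: "(LINT t|lborel. dhat t) = 0"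
  unfolding dhat_eq by (simp add: Bochner_Integration.integral_diff integrable_real_indicator)

lemma integrable_mult_dhat: "integrable lborel (\<lambda>t. t * dhat t)"
  unfolding mult_dhat_eq using integrable_mult_Icc by (auto intro!: Bochner_Integration.integrable_add Bochner_Integration.integrable_diff integrable_real_indicator)

lemma integral_mult_dhat: "(LINT t|lborel. t * dhat t) = -1"
  unfolding mult_dhat_eq using integrable_mult_Icc integral_power[of "-1" 0 1] integral_power[of 0 1 1]
  by (simp add: Bochner_Integration.integral_add Bochner_Integration.integral_diff integrable_real_indicator)

section \<open>Tensor products of one-dimensional profiles\<close>

definition kern :: "('n::finite \<Rightarrow> real \<Rightarrow> real) \<Rightarrow> real^'n \<Rightarrow> ('n \<Rightarrow> real) \<Rightarrow> real^'n \<Rightarrow> real" where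
  "kern p c w y = (\<Prod>i\<in>UNIV. p i ((y $ i - c $ i) / w i))"

definition tent :: "real^'n::finite \<Rightarrow> ('n \<Rightarrow> real) \<Rightarrow> real^'n \<Rightarrow> real" where
  "tent = kern (\<lambda>_. hat)"

text \<open>Off the kinks this is the partial derivative of \<open>tent\<close> in direction j; the
  divisor \<open>w j\<close> is the chain-rule factor.\<close>

definition dtent :: "'n \<Rightarrow> real^'n::finite \<Rightarrow> ('n \<Rightarrow> real) \<Rightarrow> real^'n \<Rightarrow> real" where
  "dtent j c w y = kern ((\<lambda>_. hat)(j := dhat)) c w y / w j"

text \<open>Only the factor of coordinate k sees the change: the centres \<open>c - v\<close>,
  \<open>c\<close>, \<open>c + v\<close> and the widths \<open>w'\<close>, \<open>w\<close> agree in
  all other coordinates. Shifting the centre by half the old width, which is the new width, turns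
  the argument 2u into 2u+1 or 2u-1.\<close>

lemma kern_refine:
  fixes c :: "real^'n::finite"
  assumes w: "w k \<noteq> 0" and p: "\<And>u. p k u = \<alpha> * p k (2*u+1) + \<beta> * p k (2*u) + \<gamma> * p k (2*u-1)"
  defines "w' \<equiv> w(k := w k / 2)" and "v \<equiv> axis k (w k / 2)"
  shows "kern p c w y = \<alpha> * kern p (c - v) w' y + \<beta> * kern p c w' y + \<gamma> * kern p (c + v) w' y"
proof -
  define R where "R = (\<Prod>i\<in>UNIV-{k}. p i ((y $ i - c $ i) / w i))"
  have split: "kern p d u y = p k ((y $ k - d $ k) / u k) * (\<Prod>i\<in>UNIV-{k}. p i ((y $ i - d $ i) / u i))" for d :: "real^'n" and u
    unfolding kern_def by (rule prod.remove) auto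
  have R': "(\<Prod>i\<in>UNIV-{k}. p i ((y $ i - d $ i) / w' i)) = R" if "\<And>i. i \<noteq> k \<Longrightarrow> d $ i = c $ i" for d :: "real^'n"
    unfolding R_def using that by (intro prod.cong) (auto simp: w'_def)
  define u where "u = (y $ k - c $ k) / w k"
  have "(y $ k - (c - v) $ k) / w' k = 2 * u + 1" "(y $ k - c $ k) / w' k = 2 * u" "(y $ k - (c + v) $ k) / w' k = 2 * u - 1"
    using w by (auto simp: u_def w'_def v_def field_simps)
  then have "kern p (c - v) w' y = p k (2*u+1) * R" "kern p c w' y = p k (2*u) * R" "kern p (c + v) w' y = p k (2*u-1) * R"
    by (simp_all add: split R' v_def axis_def)
  moreover have "kern p c w y = p k u * R" by (simp add: split R_def u_def)
  ultimately show ?thesis by (simp add: p[of u] algebra_simps)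
qed

lemma tent_refine:
  fixes c :: "real^'n::finite"
  assumes w: "w k \<noteq> 0"
  defines "w' \<equiv> w(k := w k / 2)" and "v \<equiv> axis k (w k / 2)"
  shows "tent c w y = 1/2 * tent (c - v) w' y + tent c w' y + 1/2 * tent (c + v) w' y"
  unfolding tent_def w'_def v_def by (subst kern_refine[where w=w and k=k and \<alpha>="1/2" and \<beta>=1 and \<gamma>="1/2"]) (rule w, rule hat_refine, simp)

text \<open>The weights agree with those of \<open>tent_refine\<close> whatever j is. For j = k the
  doubled weights of \<open>dhat\<close> are compensated by the halved divisor \<open>w' j\<close>;
  for j \<noteq> k only a \<open>hat\<close> factor is refined.\<close>

lemma dtent_refine:
  fixes c :: "real^'n::finite"
  assumes w: "w k \<noteq> 0"
  defines "w' \<equiv> w(k := w k / 2)" and "v \<equiv> axis k (w k / 2)"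
  shows "dtent j c w y = 1/2 * dtent j (c - v) w' y + dtent j c w' y + 1/2 * dtent j (c + v) w' y"
proof -
  define p where "p = (\<lambda>_. hat)(j := dhat)"
  show ?thesis
  proof (cases "j = k")
    case True
    have "kern p c w y = 1 * kern p (c - v) w' y + 2 * kern p c w' y + 1 * kern p (c + v) w' y"
      unfolding w'_def v_def by (rule kern_refine[where p=p and w=w and k=k, OF w]) (simp only: p_def True fun_upd_same, rule dhat_refine)
    then show ?thesis
      using w unfolding dtent_def p_def[symmetric] by (simp add: w'_def True field_simps)
  next
    case False
    then have "p k = hat" by (simp add: p_def)
    then have "kern p c w y = 1/2 * kern p (c - v) w' y + 1 * kern p c w' y + 1/2 * kern p (c + v) w' y"
      unfolding w'_def v_def by (intro kern_refine[where p=p and w=w and k=k, OF w]) (simp only:, rule hat_refine)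
    then show ?thesis
      using w False unfolding dtent_def p_def[symmetric] by (simp add: w'_def add_divide_distrib)
  qed
qed

lemma abs_kern:
  fixes c :: "real^'n::finite"
  assumes "\<And>i. w i > 0" and p: "\<And>i t. \<bar>p i t\<bar> \<le> indicator {-1..1} t"
  shows "\<bar>kern p c w y\<bar> \<le> indicator (cbox (c - vec_lambda w) (c + vec_lambda w)) y"
proof -
  have "\<bar>kern p c w y\<bar> \<le> (\<Prod>i\<in>UNIV. indicator {-1..1} ((y $ i - c $ i) / w i))"
    unfolding kern_def abs_prod by (intro prod_mono) (auto intro: p)
  also have "\<dots> = indicator (cbox (c - vec_lambda w) (c + vec_lambda w)) y"
  proof (cases "y \<in> cbox (c - vec_lambda w) (c + vec_lambda w)")
    case True
    then have "(y $ i - c $ i) / w i \<in> {-1..1}" for i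
      using assms(1)[of i] by (auto simp: mem_box_cart field_simps dest!: spec[of _ i])
    then show ?thesis using True by simp
  next
    case False
    then obtain i where "\<not> ((c - vec_lambda w) $ i \<le> y $ i \<and> y $ i \<le> (c + vec_lambda w) $ i)"
      by (auto simp: mem_box_cart)
    then have "(y $ i - c $ i) / w i \<notin> {-1..1}"
      using assms(1)[of i] by (auto simp: field_simps)
    then show ?thesis using False by (auto intro!: prod_zero exI[of _ i] simp: indicator_def)
  qed
  finally show ?thesis .
qed

lemma abs_tent: "(\<And>i. w i > 0) \<Longrightarrow> \<bar>tent c w y\<bar> \<le> indicator (cbox (c - vec_lambda w) (c + vec_lambda w)) y"
  unfolding tent_def by (rule abs_kern) (auto simp: abs_hat)

lemma abs_dtent: "(\<And>i. w i > 0) \<Longrightarrow> \<bar>dtent j c w y\<bar> \<le> indicator (cbox (c - vec_lambda w) (c + vec_lambda w)) y / w j"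
  unfolding dtent_def abs_divide using abs_kern[of w "(\<lambda>_. hat)(j := dhat)" c y]
  by (auto simp: abs_hat abs_dhat divide_right_mono less_imp_le)

lemma measurable_kern:
  assumes [measurable]: "\<And>i. p i \<in> borel_measurable borel"
  shows "kern p c w \<in> borel_measurable borel"
  unfolding kern_def[abs_def] by measurable

lemma measurable_tent [measurable]: "tent c w \<in> borel_measurable borel"
  unfolding tent_def by (rule measurable_kern) measurable

lemma measurable_dtent [measurable]: "dtent j c w \<in> borel_measurable borel"
proof -
  have "kern ((\<lambda>_. hat)(j := dhat)) c w \<in> borel_measurable borel"
    by (rule measurable_kern) auto
  then show ?thesis unfolding dtent_def[abs_def] by measurable
qed

lemma integrable_kern_scaleR:
  fixes F :: "real^'n::finite \<Rightarrow> 'b::{banach,second_countable_topology}"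
  assumes F: "continuous_on UNIV F" and [measurable]: "q \<in> borel_measurable borel"
    and q: "\<And>y. \<bar>q y\<bar> \<le> indicator (cbox a b) y * C"
  shows "integrable lborel (\<lambda>y. q y *\<^sub>R F y)"
proof -
  have [measurable]: "F \<in> borel_measurable borel" using F by (rule borel_measurable_continuous_onI)
  have "integrable lborel (\<lambda>y. C *\<^sub>R (indicator (cbox a b) y *\<^sub>R F y))"
    by (intro integrable_scaleR_right borel_integrable_compact) (auto intro: continuous_on_subset[OF F])
  then show ?thesis
  proof (rule Bochner_Integration.integrable_bound)
    have "\<bar>q y\<bar> * norm (F y) \<le> indicator (cbox a b) y * \<bar>C\<bar> * norm (F y)" for y
      by (intro mult_right_mono order_trans[OF q]) (auto intro: mult_left_mono)
    then show "AE y in lborel. norm (q y *\<^sub>R F y) \<le> norm (C *\<^sub>R (indicator (cbox a b) y *\<^sub>R F y))"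
      by (auto intro!: AE_I2 simp: mult_ac abs_mult)
  qed auto
qed

lemma integrable_tent:
  fixes F :: "real^'n::finite \<Rightarrow> 'b::{banach,second_countable_topology}"
  assumes "continuous_on UNIV F" and w: "\<And>i. w i > 0"
  shows "integrable lborel (\<lambda>y. tent c w y *\<^sub>R F y)"
  by (rule integrable_kern_scaleR[where C=1]) (use assms abs_tent[OF w] in auto)

lemma integrable_dtent:
  fixes F :: "real^'n::finite \<Rightarrow> 'b::{banach,second_countable_topology}"
  assumes "continuous_on UNIV F" and w: "\<And>i. w i > 0"
  shows "integrable lborel (\<lambda>y. dtent j c w y *\<^sub>R F y)"
  by (rule integrable_kern_scaleR[where C="1 / w j"]) (use assms abs_dtent[OF w] in auto)

lemma integral_kern:
  fixes c :: "real^'n::finite"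
  assumes h: "(h::real) > 0" and p: "\<And>i. integrable lborel (p i)"
  shows "(LINT y|lborel. kern p c (\<lambda>_. h) y) = h ^ CARD('n) * (\<Prod>i\<in>UNIV. LINT t|lborel. p i t)"
proof -
  have [measurable]: "p i \<in> borel_measurable borel" for i using borel_measurable_integrable[OF p[of i]] by simp
  have "(LINT y|lborel. kern p c (\<lambda>_. h) y) = h ^ CARD('n) *\<^sub>R (LINT x|lborel. kern p c (\<lambda>_. h) (c + h *\<^sub>R x))"
    using measurable_kern[of p c "\<lambda>_. h"] h by (subst integral_affine_euclidean[of h _ c]) auto
  also have "(\<lambda>x. kern p c (\<lambda>_. h) (c + h *\<^sub>R x)) = (\<lambda>x. \<Prod>i\<in>UNIV. p i (x $ i))"
    using h by (auto simp: kern_def)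
  finally show ?thesis by (simp add: integral_vec_prod[OF p])
qed

lemma integral_tent: "h > 0 \<Longrightarrow> (LINT y|lborel. tent (c::real^'n::finite) (\<lambda>_. h) y) = h ^ CARD('n)"
  unfolding tent_def by (subst integral_kern) (auto simp: integrable_hat integral_hat)

lemma integral_dtent: "h > 0 \<Longrightarrow> (LINT y|lborel. dtent j (c::real^'n::finite) (\<lambda>_. h) y) = 0"
  unfolding dtent_def integral_divide_zero
  by (subst integral_kern) (auto simp: integrable_hat integrable_dhat integral_dhat intro!: prod_zero bexI[of _ j])

text \<open>Formal integration by parts moves the derivative onto y_k - c_k and leaves minus the
  mass h^n of the tent. The factor \<open>y $ k - c $ k\<close> is h times the rescaled coordinate;
  this h cancels the divisor of \<open>dtent\<close>, so the integrand is again a product kernel,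
  with profile \<open>t * p k t\<close> in coordinate k.\<close>

lemma integral_dtent_mult:
  fixes c :: "real^'n::finite"
  assumes h: "(h::real) > 0"
  shows "(LINT y|lborel. (y $ k - c $ k) * dtent j c (\<lambda>_. h) y) = (if j = k then - (h ^ CARD('n)) else 0)"
proof -
  define p where "p = ((\<lambda>_. hat)(j := dhat))"
  define q where "q = p(k := (\<lambda>t. t * p k t))"
  have hm: "integrable lborel (\<lambda>t. t * hat t)"
  proof (rule Bochner_Integration.integrable_bound[OF integrable_hat])
    show "AE t in lborel. norm (t * hat t) \<le> norm (hat t)"
      by (intro AE_I2) (auto simp: hat_def abs_mult max_def mult_left_le_one_le)
  qed measurable
  have q: "integrable lborel (q i)" for i
    by (auto simp: q_def p_def integrable_hat integrable_dhat integrable_mult_dhat hm)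
  have "(y $ k - c $ k) * dtent j c (\<lambda>_. h) y = kern q c (\<lambda>_. h) y" for y
  proof -
    have "kern p c (\<lambda>_. h) y = p k ((y $ k - c $ k) / h) * (\<Prod>i\<in>UNIV-{k}. p i ((y $ i - c $ i) / h))"
      unfolding kern_def by (rule prod.remove) auto
    moreover have "kern q c (\<lambda>_. h) y = q k ((y $ k - c $ k) / h) * (\<Prod>i\<in>UNIV-{k}. q i ((y $ i - c $ i) / h))"
      unfolding kern_def by (rule prod.remove) auto
    moreover have "(\<Prod>i\<in>UNIV-{k}. q i ((y $ i - c $ i) / h)) = (\<Prod>i\<in>UNIV-{k}. p i ((y $ i - c $ i) / h))"
      by (intro prod.cong) (auto simp: q_def)
    ultimately show ?thesis using h by (auto simp: dtent_def q_def p_def[symmetric])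
  qed
  then have "(LINT y|lborel. (y $ k - c $ k) * dtent j c (\<lambda>_. h) y) = h ^ CARD('n) * (\<Prod>i\<in>UNIV. LINT t|lborel. q i t)"
    by (simp add: integral_kern[OF h q])
  moreover have "(\<Prod>i\<in>UNIV. LINT t|lborel. q i t) = (if j = k then -1 else 0)"
  proof (cases "j = k")
    case True
    have "(\<Prod>i\<in>UNIV. LINT t|lborel. q i t) = (LINT t|lborel. q k t) * (\<Prod>i\<in>UNIV-{k}. LINT t|lborel. q i t)"
      by (rule prod.remove) auto
    also have "(\<Prod>i\<in>UNIV-{k}. LINT t|lborel. q i t) = 1"
      by (intro prod.neutral) (auto simp: q_def p_def True integral_hat)
    finally show ?thesis using True by (simp add: q_def p_def integral_mult_dhat)
  next
    case False
    then show ?thesis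
      by (auto intro!: prod_zero bexI[of _ j] simp: q_def p_def integral_dhat)
  qed
  ultimately show ?thesis by simp
qed

text \<open>Pairing of \<open>g - div F\<close> with a tent, after a formal integration by parts.\<close>

definition wdiv :: "('n \<Rightarrow> real^'n::finite \<Rightarrow> 'b) \<Rightarrow> (real^'n \<Rightarrow> 'b) \<Rightarrow> real^'n \<Rightarrow> ('n \<Rightarrow> real) \<Rightarrow> 'b::{banach,second_countable_topology}" where
  "wdiv F g c w = (LINT y|lborel. (\<Sum>j\<in>UNIV. dtent j c w y *\<^sub>R F j y) + tent c w y *\<^sub>R g y)"

lemma integrable_wdiv:
  fixes F :: "'n \<Rightarrow> real^'n::finite \<Rightarrow> 'b::{banach,second_countable_topology}"
  assumes "\<And>j. continuous_on UNIV (F j)" "continuous_on UNIV g" "\<And>i. w i > 0"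
  shows "integrable lborel (\<lambda>y. (\<Sum>j\<in>UNIV. dtent j c w y *\<^sub>R F j y) + tent c w y *\<^sub>R g y)"
  using assms by (intro Bochner_Integration.integrable_add Bochner_Integration.integrable_sum integrable_tent integrable_dtent)

section \<open>Goursat's bisection argument\<close>

lemma wdiv_refine:
  fixes F :: "'n \<Rightarrow> real^'n::finite \<Rightarrow> 'b::{banach,second_countable_topology}" and k :: 'n
  assumes F: "\<And>j. continuous_on UNIV (F j)" and g: "continuous_on UNIV g" and w: "\<And>i. w i > 0"
  defines "w' \<equiv> w(k := w k / 2)" and "v \<equiv> axis k (w k / 2)"
  shows "wdiv F g c w = (1/2) *\<^sub>R wdiv F g (c - v) w' + wdiv F g c w' + (1/2) *\<^sub>R wdiv F g (c + v) w'"
proof -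
  have w0: "w k \<noteq> 0" using w[of k] by simp
  have w': "w' i > 0" for i using w by (simp add: w'_def)
  note I = integrable_wdiv[OF F g w']
  have "wdiv F g c w = (LINT y|lborel. (1/2) *\<^sub>R ((\<Sum>j\<in>UNIV. dtent j (c - v) w' y *\<^sub>R F j y) + tent (c - v) w' y *\<^sub>R g y)
      + ((\<Sum>j\<in>UNIV. dtent j c w' y *\<^sub>R F j y) + tent c w' y *\<^sub>R g y)
      + (1/2) *\<^sub>R ((\<Sum>j\<in>UNIV. dtent j (c + v) w' y *\<^sub>R F j y) + tent (c + v) w' y *\<^sub>R g y))"
    unfolding wdiv_def
    by (intro Bochner_Integration.integral_cong refl, subst tent_refine[of w k], rule w0, subst dtent_refine[of w k], rule w0)
       (simp add: w'_def[symmetric] v_def[symmetric] scaleR_add_left scaleR_add_right sum.distrib scaleR_sum_right)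
  also have "\<dots> = (1/2) *\<^sub>R wdiv F g (c - v) w' + wdiv F g c w' + (1/2) *\<^sub>R wdiv F g (c + v) w'"
    unfolding wdiv_def using I by (simp add: Bochner_Integration.integral_add)
  finally show ?thesis .
qed

text \<open>Halving one width writes \<open>wdiv\<close> as a combination with weights 1/2, 1, 1/2,
  of sum 2, so one of the three pieces has at least half the norm. Induction over the set T of
  coordinates already halved costs a factor 2 per coordinate and moves each coordinate of the centre
  at most once, by at most half its width.\<close>

lemma wdiv_child_on:
  fixes F :: "'n \<Rightarrow> real^'n::finite \<Rightarrow> 'b::{banach,second_countable_topology}"
  assumes F: "\<And>j. continuous_on UNIV (F j)" and g: "continuous_on UNIV g" and w: "\<And>i. w i > 0"
  shows "\<exists>c'. (\<forall>i. \<bar>c' $ i - c $ i\<bar> \<le> (if i \<in> T then w i / 2 else 0)) \<and>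
    norm (wdiv F g c w) \<le> 2 ^ card T * norm (wdiv F g c' (\<lambda>i. if i \<in> T then w i / 2 else w i))"
  using finite[of T]
proof (induction T)
  case empty
  then show ?case by (intro exI[of _ c]) auto
next
  case (insert k T)
  then obtain c' where c': "\<And>i. \<bar>c' $ i - c $ i\<bar> \<le> (if i \<in> T then w i / 2 else 0)"
    and le: "norm (wdiv F g c w) \<le> 2 ^ card T * norm (wdiv F g c' (\<lambda>i. if i \<in> T then w i / 2 else w i))" by blast
  define u where "u = (\<lambda>i. if i \<in> T then w i / 2 else w i)"
  have u: "u i > 0" for i using w by (simp add: u_def)
  define v where "v = (axis k (w k / 2) :: real^'n)"
  have u': "u(k := u k / 2) = (\<lambda>i. if i \<in> insert k T then w i / 2 else w i)"
    using insert by (auto simp: u_def)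
  define W where "W d = norm (wdiv F g d (u(k := u k / 2)))" for d
  have uk: "u k = w k" using insert by (simp add: u_def)
  have "wdiv F g c' u = (1/2) *\<^sub>R wdiv F g (c' - v) (u(k := u k / 2)) + wdiv F g c' (u(k := u k / 2)) + (1/2) *\<^sub>R wdiv F g (c' + v) (u(k := u k / 2))"
    using wdiv_refine[OF F g u, where c=c' and k=k] by (simp add: uk v_def)
  then have "norm (wdiv F g c' u) \<le> 1/2 * W (c' - v) + W c' + 1/2 * W (c' + v)"
    unfolding W_def by (auto intro!: norm_triangle_le add_mono)
  also have "\<dots> \<le> 2 * Max {W (c' - v), W c', W (c' + v)}"
  proof -
    have "W d \<le> Max {W (c' - v), W c', W (c' + v)}" if "d \<in> {c' - v, c', c' + v}" for d
      using that by (intro Max_ge) auto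
    from this[of "c' - v"] this[of c'] this[of "c' + v"] show ?thesis by simp
  qed
  finally have *: "norm (wdiv F g c' u) \<le> 2 * Max {W (c' - v), W c', W (c' + v)}" .
  have "Max {W (c' - v), W c', W (c' + v)} \<in> {W (c' - v), W c', W (c' + v)}" by (intro Max_in) auto
  then obtain d where d: "d \<in> {c' - v, c', c' + v}" and dW: "Max {W (c' - v), W c', W (c' + v)} = W d" by auto
  have "norm (wdiv F g c w) \<le> 2 ^ card T * (2 * W d)"
    unfolding dW[symmetric] by (rule order_trans[OF le[folded u_def] mult_left_mono[OF *]]) simp
  also have "\<dots> = 2 ^ card (insert k T) * W d" using insert by simp
  finally have "norm (wdiv F g c w) \<le> 2 ^ card (insert k T) * norm (wdiv F g d (\<lambda>i. if i \<in> insert k T then w i / 2 else w i))"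
    unfolding W_def u' .
  moreover have "\<bar>d $ i - c $ i\<bar> \<le> (if i \<in> insert k T then w i / 2 else 0)" for i
    using c'[of i] d insert.hyps w[of k] by (auto simp: v_def axis_def split: if_splits)
  ultimately show ?case by blast
qed

lemma wdiv_child:
  fixes F :: "'n \<Rightarrow> real^'n::finite \<Rightarrow> 'b::{banach,second_countable_topology}"
  assumes F: "\<And>j. continuous_on UNIV (F j)" and g: "continuous_on UNIV g" and h: "(h::real) > 0"
  shows "\<exists>c'. (\<forall>i. \<bar>c' $ i - c $ i\<bar> \<le> h / 2) \<and>
    norm (wdiv F g c (\<lambda>_. h)) \<le> 2 ^ CARD('n) * norm (wdiv F g c' (\<lambda>_. h / 2))"
  using wdiv_child_on[OF F g, of "\<lambda>_. h" c UNIV] h by auto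

text \<open>For affine fields the formal integration by parts is exact: \<open>dtent j\<close> kills
  constants and pairs with coordinate k to -h^n if j = k and to 0 otherwise, while the tent itself
  has mass h^n. The divergence therefore enters twice, with opposite signs.\<close>

lemma wdiv_affine:
  fixes A :: "'n \<Rightarrow> real^'n::finite \<Rightarrow> 'b::{banach,second_countable_topology}"
  assumes A: "\<And>j. bounded_linear (A j)" and h: "(h::real) > 0"
  shows "wdiv (\<lambda>j y. a j + A j (y - x)) (\<lambda>_. \<Sum>j\<in>UNIV. A j (axis j 1)) c (\<lambda>_. h) = 0"
proof -
  let ?d = "\<lambda>j y. dtent j c (\<lambda>_. h) y" and ?t = "tent c (\<lambda>_. h)"
  have id: "integrable lborel (\<lambda>y. ?d j y)" for j
    using integrable_dtent[of "\<lambda>_. 1::real" "\<lambda>_. h" j c] h by simp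
  have "continuous_on UNIV (\<lambda>y::real^'n. y $ k - c $ k)" for k by (intro continuous_intros)
  then have idm: "integrable lborel (\<lambda>y. ?d j y * (y $ k - c $ k))" for j k
    using integrable_dtent[of "\<lambda>y. y $ k - c $ k" "\<lambda>_. h" j c] h by simp
  have it: "integrable lborel ?t"
    using integrable_tent[of "\<lambda>_. 1::real" "\<lambda>_. h" c] h by simp
  have exp: "A j (y - x) = A j (c - x) + (\<Sum>k\<in>UNIV. (y $ k - c $ k) *\<^sub>R A j (axis k 1))" for j y
  proof -
    interpret bounded_linear "A j" by (rule A)
    have "y - x = (c - x) + (y - c)" by simp
    also have "y - c = (\<Sum>k\<in>UNIV. (y $ k - c $ k) *\<^sub>R axis k 1)"
      using basis_expansion[of "y - c"] by (simp add: scalar_mult_eq_scaleR)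
    finally have "A j (y - x) = A j ((c - x) + (\<Sum>k\<in>UNIV. (y $ k - c $ k) *\<^sub>R axis k 1))" by (rule arg_cong)
    then show ?thesis by (simp add: add sum scaleR)
  qed
  have "(\<Sum>j\<in>UNIV. ?d j y *\<^sub>R (a j + A j (y - x))) + ?t y *\<^sub>R (\<Sum>j\<in>UNIV. A j (axis j 1))
      = (\<Sum>j\<in>UNIV. ?d j y *\<^sub>R (a j + A j (c - x)) + (\<Sum>k\<in>UNIV. (?d j y * (y $ k - c $ k)) *\<^sub>R A j (axis k 1)) + ?t y *\<^sub>R A j (axis j 1))" for y
    by (subst exp) (simp add: scaleR_add_right sum.distrib scaleR_sum_right)
  then have "wdiv (\<lambda>j y. a j + A j (y - x)) (\<lambda>_. \<Sum>j\<in>UNIV. A j (axis j 1)) c (\<lambda>_. h)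
     = (\<Sum>j\<in>UNIV. (LINT y|lborel. ?d j y) *\<^sub>R (a j + A j (c - x)) + (\<Sum>k\<in>UNIV. (LINT y|lborel. ?d j y * (y $ k - c $ k)) *\<^sub>R A j (axis k 1)) + (LINT y|lborel. ?t y) *\<^sub>R A j (axis j 1))"
    unfolding wdiv_def using id idm it
    by (simp add: Bochner_Integration.integral_sum Bochner_Integration.integral_add)
  also have "\<dots> = (\<Sum>j\<in>UNIV. - (h ^ CARD('n) *\<^sub>R A j (axis j 1)) + h ^ CARD('n) *\<^sub>R A j (axis j 1))"
  proof (rule sum.cong[OF refl])
    fix j
    have m: "(LINT y|lborel. ?d j y * (y $ k - c $ k)) = (if j = k then - (h ^ CARD('n)) else 0)" for k
      using integral_dtent_mult[OF h, of k c j] by (simp add: mult.commute)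
    have "(\<Sum>k\<in>UNIV. (LINT y|lborel. ?d j y * (y $ k - c $ k)) *\<^sub>R A j (axis k 1))
        = (\<Sum>k\<in>UNIV. if k = j then - (h ^ CARD('n) *\<^sub>R A j (axis k 1)) else 0)"
      unfolding m by (intro sum.cong) auto
    then show "(LINT y|lborel. ?d j y) *\<^sub>R (a j + A j (c - x)) + (\<Sum>k\<in>UNIV. (LINT y|lborel. ?d j y * (y $ k - c $ k)) *\<^sub>R A j (axis k 1)) + (LINT y|lborel. ?t y) *\<^sub>R A j (axis j 1)
      = - (h ^ CARD('n) *\<^sub>R A j (axis j 1)) + h ^ CARD('n) *\<^sub>R A j (axis j 1)"
      by (simp add: integral_dtent[OF h] integral_tent[OF h])
  qed
  also have "\<dots> = 0" by simp
  finally show ?thesis .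
qed

text \<open>Subtracting the affine approximation at x changes nothing by \<open>wdiv_affine\<close>,
  so only Taylor remainders at the single point x are integrated. They are at most \<delta> * 2 h n,
  while |dtent| \<le> 1/h; this gives 2 n \<delta> for each of the n components, hence 2 n^2
  \<delta>. The extra 1 comes from g, and (2h)^n is the volume of the box outside which the tent
  vanishes.\<close>

lemma wdiv_small:
  fixes F :: "'n \<Rightarrow> real^'n::finite \<Rightarrow> 'b::{banach,second_countable_topology}"
  assumes F: "\<And>j. continuous_on UNIV (F j)" and g: "continuous_on UNIV g"
    and A: "\<And>j. bounded_linear (A j)" and gx: "g x = (\<Sum>j\<in>UNIV. A j (axis j 1))"
    and h: "(h::real) > 0" and xc: "\<And>i. \<bar>x $ i - c $ i\<bar> \<le> h" and \<delta>: "\<delta> \<ge> 0"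
    and hF: "\<And>j y. norm (y - x) \<le> 2 * h * CARD('n) \<Longrightarrow> norm (F j y - F j x - A j (y - x)) \<le> \<delta> * norm (y - x)"
    and hg: "\<And>y. norm (y - x) \<le> 2 * h * CARD('n) \<Longrightarrow> norm (g y - g x) \<le> \<delta>"
  shows "norm (wdiv F g c (\<lambda>_. h)) \<le> \<delta> * (2 * CARD('n)\<^sup>2 + 1) * (2 * h) ^ CARD('n)"
proof -
  let ?n = "real CARD('n)"
  let ?d = "\<lambda>j y. dtent j c (\<lambda>_. h) y" and ?t = "tent c (\<lambda>_. h)"
  let ?B = "cbox (c - (\<chi> i. h)) (c + (\<chi> i. h))"
  let ?R = "\<lambda>j y. F j y - F j x - A j (y - x)"
  have Ac: "continuous_on UNIV (\<lambda>y. F j x + A j (y - x))" for j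
    using A by (intro continuous_intros bounded_linear.continuous_on[OF A])
  have I1: "integrable lborel (\<lambda>y. (\<Sum>j\<in>UNIV. ?d j y *\<^sub>R F j y) + ?t y *\<^sub>R g y)"
    by (rule integrable_wdiv) (use F g h in auto)
  have I2: "integrable lborel (\<lambda>y. (\<Sum>j\<in>UNIV. ?d j y *\<^sub>R (F j x + A j (y - x))) + ?t y *\<^sub>R g x)"
    by (rule integrable_wdiv) (use Ac h in auto)
  have "wdiv F g c (\<lambda>_. h) = wdiv F g c (\<lambda>_. h) - wdiv (\<lambda>j y. F j x + A j (y - x)) (\<lambda>_. g x) c (\<lambda>_. h)"
    unfolding gx by (subst wdiv_affine[OF A h]) simp
  also have "\<dots> = (LINT y|lborel. (\<Sum>j\<in>UNIV. ?d j y *\<^sub>R ?R j y) + ?t y *\<^sub>R (g y - g x))"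
    unfolding wdiv_def Bochner_Integration.integral_diff[OF I1 I2, symmetric]
    by (rule Bochner_Integration.integral_cong) (simp_all add: scaleR_diff_right scaleR_add_right sum.distrib sum_subtractf)
  also have "norm \<dots> \<le> (LINT y|lborel. \<delta> * (2 * ?n\<^sup>2 + 1) * indicator ?B y)"
  proof (rule Bochner_Integration.integral_norm_bound_integral, goal_cases)
    case 1
    have "integrable lborel (\<lambda>y. (\<Sum>j\<in>UNIV. ?d j y *\<^sub>R ?R j y) + ?t y *\<^sub>R (g y - g x))"
      by (rule integrable_wdiv) (use F g h A in \<open>auto intro!: continuous_intros bounded_linear.continuous_on[OF A]\<close>)
    then show ?case .
  next
    case 2
    then show ?case by (auto intro!: integrable_real_indicator emeasure_bounded_finite)
  next
    case (3 y)
    show ?case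
    proof (cases "y \<in> ?B")
      case True
      \<comment> \<open>Both x and y lie within h of c in every coordinate, so they differ by at
        most 2h in each; the l1 norm then gives the factor n.\<close>
      have "norm (y - x) \<le> (\<Sum>i\<in>UNIV. \<bar>(y - x) $ i\<bar>)" by (rule norm_le_l1_cart)
      also have "\<dots> \<le> (\<Sum>i\<in>(UNIV::'n set). 2 * h)"
      proof (rule sum_mono)
        fix i show "\<bar>(y - x) $ i\<bar> \<le> 2 * h" using xc[of i] True by (auto simp: mem_box_cart dest!: spec[of _ i])
      qed
      finally have yx: "norm (y - x) \<le> 2 * h * ?n" by (simp add: mult_ac)
      have d: "\<bar>?d j y\<bar> \<le> 1 / h" for j using abs_dtent[of "\<lambda>_. h" j c y] h True by simp
      have t: "\<bar>?t y\<bar> \<le> 1" using abs_tent[of "\<lambda>_. h" c y] h True by simp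
      have "norm (\<Sum>j\<in>UNIV. ?d j y *\<^sub>R ?R j y) \<le> (\<Sum>j\<in>(UNIV::'n set). (1 / h) * (\<delta> * (2 * h * ?n)))"
      proof (rule sum_norm_le)
        fix j
        have "norm (?R j y) \<le> \<delta> * (2 * h * ?n)"
          using hF[OF yx, of j] mult_left_mono[OF yx \<delta>] by linarith
        then show "norm (?d j y *\<^sub>R ?R j y) \<le> (1 / h) * (\<delta> * (2 * h * ?n))"
          unfolding norm_scaleR using d[of j] h by (intro mult_mono) auto
      qed
      also have "\<dots> = \<delta> * (2 * ?n\<^sup>2)" using h by (simp add: power2_eq_square)
      finally have 1: "norm (\<Sum>j\<in>UNIV. ?d j y *\<^sub>R ?R j y) \<le> \<delta> * (2 * ?n\<^sup>2)" .
      have "norm (?t y *\<^sub>R (g y - g x)) \<le> 1 * \<delta>"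
        unfolding norm_scaleR using t hg[OF yx] by (intro mult_mono) auto
      with 1 have "norm ((\<Sum>j\<in>UNIV. ?d j y *\<^sub>R ?R j y) + ?t y *\<^sub>R (g y - g x)) \<le> \<delta> * (2 * ?n\<^sup>2) + \<delta>"
        by (intro norm_triangle_le add_mono) auto
      then show ?thesis using True by (simp only: indicator_simps distrib_left mult_1_right)
    next
      case False
      then have "?d j y = 0" "?t y = 0" for j
        using abs_dtent[of "\<lambda>_. h" j c y] abs_tent[of "\<lambda>_. h" c y] h by auto
      then show ?thesis using False by simp
    qed
  qed
  also have "\<dots> = \<delta> * (2 * ?n\<^sup>2 + 1) * (2 * h) ^ CARD('n)"
  proof -
    have "measure lborel ?B = (2 * h) ^ CARD('n)"
      using h by (simp add: content_cbox_if_cart interval_eq_empty_cart)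
    then show ?thesis by simp
  qed
  finally show ?thesis by (simp add: add.commute)
qed

text \<open>Passing repeatedly to a half-width tent that carries its share of the norm loses a
  factor 2^n per step. The supports shrink to a point x, and differentiability at x bounds the m-th
  value by \<delta> * K * 2^(-nm), where K depends on h and n only. The two powers cancel, leaving
  the bound \<delta> * K for every \<delta> > 0.\<close>

lemma wdiv_eq_0:
  fixes F :: "'n \<Rightarrow> real^'n::finite \<Rightarrow> 'b::{banach,second_countable_topology}"
  assumes F: "\<And>j x. (F j has_derivative F' j x) (at x)"
    and g: "continuous_on UNIV g" and gF: "\<And>x. g x = (\<Sum>j\<in>UNIV. F' j x (axis j 1))"
    and h: "(h::real) > 0"
  shows "wdiv F g c (\<lambda>_. h) = 0"
proof -
  have Fc: "continuous_on UNIV (F j)" for j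
    using F by (intro continuous_at_imp_continuous_on ballI) (rule has_derivative_continuous)
  have A: "bounded_linear (F' j x)" for j x using F by (rule has_derivative_bounded_linear)
  define hm where "hm m = h / 2 ^ m" for m :: nat
  have hm: "hm m > 0" and hm_Suc: "hm (Suc m) = hm m / 2" for m using h by (simp_all add: hm_def)
  \<comment> \<open>A choice function defined for every level and centre, so that the sequence of
    centres arises by plain recursion.\<close>
  define child where "child m d = (SOME d'. (\<forall>i. \<bar>d' $ i - d $ i\<bar> \<le> hm m / 2) \<and>
    norm (wdiv F g d (\<lambda>_. hm m)) \<le> 2 ^ CARD('n) * norm (wdiv F g d' (\<lambda>_. hm m / 2)))" for m d
  have child: "(\<forall>i. \<bar>child m d $ i - d $ i\<bar> \<le> hm m / 2) \<and>
    norm (wdiv F g d (\<lambda>_. hm m)) \<le> 2 ^ CARD('n) * norm (wdiv F g (child m d) (\<lambda>_. hm m / 2))" for m d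
    unfolding child_def by (rule someI_ex) (rule wdiv_child[OF Fc g hm])
  define cm where "cm = rec_nat c child"
  have cm0: "cm 0 = c" and cmS: "cm (Suc m) = child m (cm m)" for m by (simp_all add: cm_def)
  have step: "\<bar>cm (Suc m) $ i - cm m $ i\<bar> \<le> hm m / 2" for m i using child cmS by simp
  have "norm (wdiv F g c (\<lambda>_. h)) \<le> (2 ^ CARD('n)) ^ m * norm (wdiv F g (cm m) (\<lambda>_. hm m))" for m
  proof (induction m)
    case 0 then show ?case by (simp add: cm0 hm_def)
  next
    case (Suc m)
    have "norm (wdiv F g (cm m) (\<lambda>_. hm m)) \<le> 2 ^ CARD('n) * norm (wdiv F g (cm (Suc m)) (\<lambda>_. hm (Suc m)))"
      using conjunct2[OF child[of m "cm m"]] by (simp only: cmS hm_Suc)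
    then have "(2 ^ CARD('n)) ^ m * norm (wdiv F g (cm m) (\<lambda>_. hm m)) \<le> (2 ^ CARD('n)) ^ m * (2 ^ CARD('n) * norm (wdiv F g (cm (Suc m)) (\<lambda>_. hm (Suc m))))"
      by (intro mult_left_mono) auto
    from order_trans[OF Suc this] show ?case by (simp only: power_Suc mult_ac)
  qed
  note growth = this
  define Q where "Q m = cbox (cm m - (\<chi> i. hm m)) (cm m + (\<chi> i. hm m))" for m
  have "\<Inter> (range Q) \<noteq> {}"
  proof (rule compact_nest)
    show "compact (Q m)" for m by (simp add: Q_def compact_cbox)
    show "Q m \<noteq> {}" for m using hm[of m] by (auto simp: Q_def interval_eq_empty_cart not_less less_imp_le)
    \<comment> \<open>The centre moves by at most \<open>hm m / 2\<close> and the new half-side is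
      \<open>hm m / 2\<close>, so the smaller box stays inside the larger one.\<close>
    have "Q (Suc m) \<subseteq> Q m" for m
    proof
      fix y assume y: "y \<in> Q (Suc m)"
      have "cm m $ i - hm m \<le> y $ i \<and> y $ i \<le> cm m $ i + hm m" for i
      proof -
        have "cm (Suc m) $ i - hm m / 2 \<le> y $ i \<and> y $ i \<le> cm (Suc m) $ i + hm m / 2"
          using y hm_Suc[of m] by (auto simp: Q_def mem_box_cart dest!: spec[of _ i])
        then show ?thesis using step[of m i] by arith
      qed
      then show "y \<in> Q m" by (simp add: Q_def mem_box_cart)
    qed
    then show "m \<le> n \<Longrightarrow> Q n \<subseteq> Q m" for m n by (rule lift_Suc_antimono_le)
  qed
  then obtain x where x: "\<And>m. x \<in> Q m" by auto
  have xc: "\<bar>x $ i - cm m $ i\<bar> \<le> hm m" for m i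
    using x[of m] by (auto simp: Q_def mem_box_cart dest!: spec[of _ i])
  have small: "norm (wdiv F g c (\<lambda>_. h)) \<le> \<delta> * ((2 * CARD('n)\<^sup>2 + 1) * (2 * h) ^ CARD('n))" if "\<delta> > 0" for \<delta>
  proof -
    have "\<exists>r>0. \<forall>y. norm (y - x) < r \<longrightarrow> norm (F j y - F j x - F' j x (y - x)) \<le> \<delta> * norm (y - x)" for j
      using F[of j x] \<open>\<delta> > 0\<close> unfolding has_derivative_at_alt by blast
    then obtain r where r: "\<And>j. r j > 0" "\<And>j y. norm (y - x) < r j \<Longrightarrow> norm (F j y - F j x - F' j x (y - x)) \<le> \<delta> * norm (y - x)"
      by metis
    have "isCont g x" using g by (simp add: continuous_on_eq_continuous_at)
    then obtain s where s: "s > 0" "\<And>y. norm (y - x) < s \<Longrightarrow> norm (g y - g x) \<le> \<delta>"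
      using \<open>\<delta> > 0\<close> unfolding continuous_at_eps_delta dist_norm by (meson less_imp_le)
    define t where "t = Min (insert s (range r))"
    have t: "t > 0" "t \<le> s" "\<And>j. t \<le> r j" using s r unfolding t_def by (auto simp del: Min_insert intro!: Min_le simp: Min_gr_iff)
    have "(\<lambda>m. 2 * hm m * CARD('n)) \<longlonglongrightarrow> 0" unfolding hm_def by real_asymp
    then have "eventually (\<lambda>m. 2 * hm m * CARD('n) < t) sequentially" using t(1) by (rule order_tendstoD)
    then obtain m where m: "2 * hm m * CARD('n) < t" by (auto simp: eventually_sequentially)
    have "norm (wdiv F g (cm m) (\<lambda>_. hm m)) \<le> \<delta> * (2 * CARD('n)\<^sup>2 + 1) * (2 * hm m) ^ CARD('n)"
    proof (rule wdiv_small[OF Fc g A gF hm xc])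
      show "\<delta> \<ge> 0" using \<open>\<delta> > 0\<close> by simp
    next
      fix j y assume "norm (y - x) \<le> 2 * hm m * CARD('n)"
      then show "norm (F j y - F j x - F' j x (y - x)) \<le> \<delta> * norm (y - x)" using m t(3)[of j] by (intro r) simp
    next
      fix y assume "norm (y - x) \<le> 2 * hm m * CARD('n)"
      then show "norm (g y - g x) \<le> \<delta>" using m t(2) by (intro s) simp
    qed
    then have "(2 ^ CARD('n)) ^ m * norm (wdiv F g (cm m) (\<lambda>_. hm m)) \<le> (2 ^ CARD('n)) ^ m * (\<delta> * (2 * CARD('n)\<^sup>2 + 1) * (2 * hm m) ^ CARD('n))"
      by (intro mult_left_mono) auto
    also have "\<dots> = \<delta> * ((2 * CARD('n)\<^sup>2 + 1) * (2 * h) ^ CARD('n))"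
      by (simp add: hm_def power_divide power_mult_distrib mult_ac flip: power_mult)
    finally show ?thesis using growth[of m] by linarith
  qed
  have "norm (wdiv F g c (\<lambda>_. h)) \<le> 0"
  proof (rule ccontr)
    assume a: "\<not> ?thesis"
    define K where "K = (2 * CARD('n)\<^sup>2 + 1) * (2 * h) ^ CARD('n)"
    have K: "K > 0" using h by (auto simp: K_def intro!: mult_pos_pos add_nonneg_pos)
    have "norm (wdiv F g c (\<lambda>_. h)) \<le> (norm (wdiv F g c (\<lambda>_. h)) / (2 * K)) * K"
      using a K by (intro small[folded K_def]) simp
    then show False using a K by simp
  qed
  then show ?thesis by simp
qed

text \<open>Tents of growing width tend to 1 pointwise while their derivatives are at most 1 over
  the width, so dominated convergence passes from the vanishing \<open>wdiv\<close> to the integral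
  of g. Integrability of all \<open>F j\<close> acts as the boundary condition at infinity.
  Continuity is asked of the total divergence, not of the single partial derivatives.\<close>

theorem integral_divergence_eq_0:
  fixes F :: "'n \<Rightarrow> real^'n::finite \<Rightarrow> 'b::{banach,second_countable_topology}"
  assumes F: "\<And>j x. (F j has_derivative F' j x) (at x)"
    and g: "continuous_on UNIV g" and gF: "\<And>x. g x = (\<Sum>j\<in>UNIV. F' j x (axis j 1))"
    and iF: "\<And>j. integrable lborel (F j)" and ig: "integrable lborel g"
  shows "(LINT x|lborel. g x) = 0"
proof -
  let ?h = "\<lambda>m. \<lambda>_. real (Suc m)"
  let ?s = "\<lambda>m y. (\<Sum>j\<in>UNIV. dtent j 0 (?h m) y *\<^sub>R F j y) + tent 0 (?h m) y *\<^sub>R g y"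
  have [measurable]: "F j \<in> borel_measurable borel" "g \<in> borel_measurable borel" for j
    using borel_measurable_integrable[OF iF[of j]] borel_measurable_integrable[OF ig] by simp_all
  have d: "\<bar>dtent j 0 (?h m) y\<bar> \<le> 1 / Suc m" for j :: 'n and m y
    using abs_dtent[of "?h m" j 0 y] by (auto intro: order_trans simp: indicator_def split: if_splits)
  have t: "\<bar>tent 0 (?h m) y\<bar> \<le> 1" for m and y :: "real^'n"
    using abs_tent[of "?h m" 0 y] by (auto intro: order_trans simp: indicator_def split: if_splits)
  have "(\<lambda>m. integral\<^sup>L lborel (?s m)) \<longlonglongrightarrow> integral\<^sup>L lborel g"
  proof (rule integral_dominated_convergence[where w="\<lambda>y. (\<Sum>j\<in>UNIV. norm (F j y)) + norm (g y)"])
    show "integrable lborel (\<lambda>y. (\<Sum>j\<in>UNIV. norm (F j y)) + norm (g y))" using iF ig by auto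
    show "AE y in lborel. norm (?s m y) \<le> (\<Sum>j\<in>UNIV. norm (F j y)) + norm (g y)" for m
    proof (intro AE_I2 norm_triangle_le add_mono sum_norm_le)
      fix y :: "real^'n" and j :: 'n
      have "\<bar>dtent j 0 (?h m) y\<bar> \<le> 1" using d[of j m y] by (rule order_trans) simp
      then show "norm (dtent j 0 (?h m) y *\<^sub>R F j y) \<le> norm (F j y)" by (simp add: mult_left_le_one_le)
      show "norm (tent 0 (?h m) y *\<^sub>R g y) \<le> norm (g y)" using t[of m y] by (simp add: mult_left_le_one_le)
    qed
    show "AE y in lborel. (\<lambda>m. ?s m y) \<longlonglongrightarrow> g y"
    proof (rule AE_I2)
      fix y :: "real^'n"
      have "(\<lambda>m. dtent j 0 (?h m) y) \<longlonglongrightarrow> 0" for j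
        by (rule Lim_null_comparison[OF _ LIMSEQ_Suc[OF lim_1_over_n]]) (use d in \<open>auto simp: inverse_eq_divide\<close>)
      moreover have "(\<lambda>m. tent 0 (?h m) y) \<longlonglongrightarrow> (\<Prod>i\<in>(UNIV::'n set). 1)"
        unfolding tent_def kern_def
      proof (rule tendsto_prod)
        fix i
        have "(\<lambda>m. max 0 (1 - \<bar>y $ i * (1 / Suc m)\<bar>)) \<longlonglongrightarrow> max 0 (1 - \<bar>y $ i * 0\<bar>)"
          by (intro tendsto_intros LIMSEQ_Suc[OF lim_1_over_n])
        then show "(\<lambda>m. hat ((y $ i - 0 $ i) / real (Suc m))) \<longlonglongrightarrow> 1" by (simp add: hat_def)
      qed
      ultimately have "(\<lambda>m. ?s m y) \<longlonglongrightarrow> (\<Sum>j\<in>UNIV. 0 *\<^sub>R F j y) + (\<Prod>i\<in>(UNIV::'n set). 1) *\<^sub>R g y"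
        by (intro tendsto_intros)
      then show "(\<lambda>m. ?s m y) \<longlonglongrightarrow> g y" by simp
    qed
  qed auto
  moreover have "integral\<^sup>L lborel (?s m) = 0" for m
    using wdiv_eq_0[OF F g gF, of "real (Suc m)" 0] by (simp add: wdiv_def)
  ultimately show ?thesis by (simp add: LIMSEQ_unique)
qed

section \<open>Square-integrable fields without divergence and curl\<close>

text \<open>Besides \<open>q D_i\<close> and \<open>p_i div D\<close>, the divergence of the tensor
  column contains the sums over j of p_j d_j D_i and D_j d_j p_i. By symmetry of both Jacobians the
  derivative in direction i of the trace term cancels them. What remains is \<open>q\<close> times
  \<open>D i\<close>, which is continuous although continuity of \<open>D'\<close> is not
  assumed.\<close>

lemma harmonic_pairing_eq_0:
  fixes D :: "'n::finite \<Rightarrow> real^'n \<Rightarrow> 'b::{banach,second_countable_topology}" and p :: "'n \<Rightarrow> real^'n \<Rightarrow> real"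
  assumes D: "\<And>i x. (D i has_derivative D' i x) (at x)" and p: "\<And>i x. (p i has_derivative p' i x) (at x)"
    and symD: "\<And>i j x. D' i x (axis j 1) = D' j x (axis i 1)"
    and symp: "\<And>i j x. p' i x (axis j 1) = p' j x (axis i 1)"
    and divD: "\<And>x. (\<Sum>i\<in>UNIV. D' i x (axis i 1)) = 0"
    and q: "\<And>x. q x = (\<Sum>i\<in>UNIV. p' i x (axis i 1))" and qc: "continuous_on UNIV q"
    and ip: "\<And>i j. integrable lborel (\<lambda>x. p j x *\<^sub>R D i x)" and iq: "\<And>i. integrable lborel (\<lambda>x. q x *\<^sub>R D i x)"
  shows "(LINT x|lborel. q x *\<^sub>R D i x) = 0"
proof (rule integral_divergence_eq_0)
  let ?F = "\<lambda>j x. p j x *\<^sub>R D i x + p i x *\<^sub>R D j x - (if i = j then (\<Sum>k\<in>UNIV. p k x *\<^sub>R D k x) else 0)"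
  let ?F' = "\<lambda>j x h. (p j x *\<^sub>R D' i x h + p' j x h *\<^sub>R D i x) + (p i x *\<^sub>R D' j x h + p' i x h *\<^sub>R D j x)
     - (if i = j then (\<Sum>k\<in>UNIV. p k x *\<^sub>R D' k x h + p' k x h *\<^sub>R D k x) else 0)"
  show "(?F j has_derivative ?F' j x) (at x)" for j x
    by (cases "i = j") (auto intro!: derivative_eq_intros D p)
  have "continuous_on UNIV (D i)"
    using D by (intro continuous_at_imp_continuous_on ballI) (rule has_derivative_continuous)
  then show "continuous_on UNIV (\<lambda>x. q x *\<^sub>R D i x)" by (intro continuous_intros qc)
  show "integrable lborel (?F j)" for j
    by (cases "i = j") (auto intro!: Bochner_Integration.integrable_add Bochner_Integration.integrable_diff Bochner_Integration.integrable_sum ip)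
  show "integrable lborel (\<lambda>x. q x *\<^sub>R D i x)" by (rule iq)
  show "q x *\<^sub>R D i x = (\<Sum>j\<in>UNIV. ?F' j x (axis j 1))" for x
  proof -
    have "(\<Sum>j\<in>UNIV. ?F' j x (axis j 1)) = (\<Sum>j\<in>UNIV. p j x *\<^sub>R D' i x (axis j 1)) + q x *\<^sub>R D i x
       + p i x *\<^sub>R (\<Sum>j\<in>UNIV. D' j x (axis j 1)) + (\<Sum>j\<in>UNIV. p' i x (axis j 1) *\<^sub>R D j x)
       - (\<Sum>k\<in>UNIV. p k x *\<^sub>R D' k x (axis i 1) + p' k x (axis i 1) *\<^sub>R D k x)"
      by (simp add: sum.distrib sum_subtractf scaleR_sum_right scaleR_sum_left q)
    then show ?thesis by (simp add: divD sum.distrib symD[of i] symp[of i])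
  qed
qed

section \<open>The softened Newton potential\<close>

definition invr :: "real^3 \<Rightarrow> real \<Rightarrow> real^3 \<Rightarrow> real" where
  "invr a e x = 1 / sqrt ((norm (x - a))\<^sup>2 + e\<^sup>2)"

lemma invr_pos: "e > 0 \<Longrightarrow> invr a e x > 0"
  by (auto simp: invr_def intro!: add_nonneg_pos)

lemma invr_sq: "e > 0 \<Longrightarrow> (invr a e x)\<^sup>2 = 1 / ((norm (x - a))\<^sup>2 + e\<^sup>2)"
  by (simp add: invr_def power_divide add_nonneg_nonneg)

lemma continuous_invr: "e > 0 \<Longrightarrow> continuous_on UNIV (invr a e)"
  unfolding invr_def[abs_def]
  by (intro continuous_intros) (auto simp: add_nonneg_eq_0_iff)

lemma has_derivative_invr:
  assumes "e > 0"
  shows "(invr a e has_derivative (\<lambda>h. - ((x - a) \<bullet> h) * (invr a e x) ^ 3)) (at x)"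
proof -
  have q: "(x - a) \<bullet> (x - a) + e\<^sup>2 > 0" using assms by (auto intro!: add_nonneg_pos)
  have "((\<lambda>x. (x - a) \<bullet> (x - a) + e\<^sup>2) has_derivative (\<lambda>h. 2 * ((x - a) \<bullet> h))) (at x)"
    by (auto intro!: derivative_eq_intros simp: inner_commute)
  moreover have "((\<lambda>t. 1 / sqrt t) has_real_derivative - (1/2) * (1 / sqrt ((x - a) \<bullet> (x - a) + e\<^sup>2)) ^ 3) (at ((x - a) \<bullet> (x - a) + e\<^sup>2))"
    using q by (auto intro!: derivative_eq_intros simp: field_simps power3_eq_cube)
  ultimately have "((\<lambda>x. 1 / sqrt ((x - a) \<bullet> (x - a) + e\<^sup>2)) has_derivative
      (\<lambda>h. 2 * ((x - a) \<bullet> h) * (- (1/2) * (1 / sqrt ((x - a) \<bullet> (x - a) + e\<^sup>2)) ^ 3))) (at x)"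
    by (rule DERIV_compose_FDERIV[rotated])
  then show ?thesis unfolding invr_def[abs_def] power2_norm_eq_inner by (simp add: mult_ac)
qed

lemma component_invr:
  assumes "e > 0" shows "\<bar>x $ j - a $ j\<bar> * invr a e x \<le> 1"
proof -
  have "\<bar>x $ j - a $ j\<bar> \<le> norm (x - a)" using component_le_norm_cart[of "x - a" j] by simp
  also have "\<dots> \<le> sqrt ((norm (x - a))\<^sup>2 + e\<^sup>2)" by (rule real_le_rsqrt) simp
  finally have "\<bar>x $ j - a $ j\<bar> \<le> sqrt ((norm (x - a))\<^sup>2 + e\<^sup>2)" .
  moreover have "0 < sqrt ((norm (x - a))\<^sup>2 + e\<^sup>2)" using assms by (auto intro!: add_nonneg_pos)
  ultimately show ?thesis by (simp add: invr_def)
qed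

lemma invr_sq_le:
  assumes e: "e > 0"
  obtains K where "K \<ge> 0" "\<And>x. (invr a e x)\<^sup>2 \<le> K * (1 / (1 + (norm x)\<^sup>2))"
proof
  \<comment> \<open>The factor 2 (1 + |a|^2) accounts for recentring from a to the origin, max 1
    (1/e^2) for replacing e^2 by 1.\<close>
  let ?K = "2 * (1 + (norm a)\<^sup>2) * max 1 (1 / e\<^sup>2)"
  show "?K \<ge> 0" by simp
  fix x
  let ?q = "(norm (x - a))\<^sup>2 + e\<^sup>2"
  have q: "?q > 0" using e by (auto intro!: add_nonneg_pos)
  have "norm x \<le> norm (x - a) + norm a" using norm_triangle_ineq[of "x - a" a] by simp
  then have "(norm x)\<^sup>2 \<le> (norm (x - a) + norm a)\<^sup>2" by (intro power_mono) auto
  also have "\<dots> \<le> 2 * (norm (x - a))\<^sup>2 + 2 * (norm a)\<^sup>2"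
    using zero_le_power2[of "norm (x - a) - norm a"] by (simp add: power2_eq_square algebra_simps)
  finally have "1 + (norm x)\<^sup>2 \<le> 1 + 2 * (norm (x - a))\<^sup>2 + 2 * (norm a)\<^sup>2" by simp
  also have "\<dots> \<le> 2 * (1 + (norm a)\<^sup>2) * (1 + (norm (x - a))\<^sup>2)" by (simp add: algebra_simps)
  also have "1 + (norm (x - a))\<^sup>2 \<le> max 1 (1 / e\<^sup>2) * ?q"
  proof -
    have "1 * (norm (x - a))\<^sup>2 \<le> max 1 (1 / e\<^sup>2) * (norm (x - a))\<^sup>2" by (intro mult_right_mono) auto
    moreover have "(1 / e\<^sup>2) * e\<^sup>2 \<le> max 1 (1 / e\<^sup>2) * e\<^sup>2" by (intro mult_right_mono) auto
    ultimately show ?thesis using e by (simp add: distrib_left)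
  qed
  finally have "1 + (norm x)\<^sup>2 \<le> ?K * ?q" by (simp add: mult_left_mono mult.assoc)
  moreover have "1 + (norm x)\<^sup>2 > 0" by (auto intro!: add_pos_nonneg)
  ultimately show "(invr a e x)\<^sup>2 \<le> ?K * (1 / (1 + (norm x)\<^sup>2))"
    using q by (simp only: invr_sq[OF e]) (simp add: field_simps)
qed

text \<open>Cauchy-Schwarz in the form 2 u v \<le> u^2 + v^2: the fourth power of
  \<open>invr\<close> decays like |x|^(-4), which is integrable at infinity in three-space, and f is
  square integrable.\<close>

lemma integrable_invr_mult:
  fixes f :: "real^3 \<Rightarrow> 'b::{banach,second_countable_topology}"
  assumes e: "e > 0" and [measurable]: "f \<in> borel_measurable borel" and f: "integrable lborel (\<lambda>x. (norm (f x))\<^sup>2)"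
  shows "integrable lborel (\<lambda>x. (invr a e x)\<^sup>2 * norm (f x))"
proof -
  have [measurable]: "invr a e \<in> borel_measurable borel"
    using continuous_invr[OF e] by (rule borel_measurable_continuous_onI)
  obtain K where K: "K \<ge> 0" "\<And>x. (invr a e x)\<^sup>2 \<le> K * (1 / (1 + (norm x)\<^sup>2))"
    using invr_sq_le[OF e] by blast
  have "integrable lborel (\<lambda>x. K\<^sup>2 * (1 / (1 + (norm x)\<^sup>2)\<^sup>2) + (norm (f x))\<^sup>2)"
    using integrable_japanese f by (intro Bochner_Integration.integrable_add integrable_mult_right)
  then show ?thesis
  proof (rule Bochner_Integration.integrable_bound)
    have "(invr a e x)\<^sup>2 * norm (f x) \<le> K\<^sup>2 * (1 / (1 + (norm x)\<^sup>2)\<^sup>2) + (norm (f x))\<^sup>2" for x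
    proof -
      have "(invr a e x)\<^sup>2 * norm (f x) \<le> ((invr a e x)\<^sup>2)\<^sup>2 + (norm (f x))\<^sup>2"
      proof -
        have "2 * ((invr a e x)\<^sup>2 * norm (f x)) \<le> ((invr a e x)\<^sup>2)\<^sup>2 + (norm (f x))\<^sup>2"
          using sum_squares_bound[of "(invr a e x)\<^sup>2" "norm (f x)"] by (simp add: mult_ac)
        moreover have "0 \<le> (invr a e x)\<^sup>2 * norm (f x)" by simp
        ultimately show ?thesis by linarith
      qed
      also have "((invr a e x)\<^sup>2)\<^sup>2 \<le> (K * (1 / (1 + (norm x)\<^sup>2)))\<^sup>2"
        by (rule power_mono[OF K(2)]) simp
      finally show ?thesis by (simp add: power_mult_distrib power_divide)
    qed
    then show "AE x in lborel. norm ((invr a e x)\<^sup>2 * norm (f x)) \<le> norm (K\<^sup>2 * (1 / (1 + (norm x)\<^sup>2)\<^sup>2) + (norm (f x))\<^sup>2)"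
      by (intro AE_I2) (simp add: order_trans[OF _ abs_ge_self])
  qed measurable
qed

text \<open>Here \<open>harmonic_pairing_eq_0\<close> is applied to the gradient of
  \<open>invr a e\<close>. All integrability reduces to \<open>integrable_invr_mult\<close>: |p_j|
  \<le> \<open>invr\<close>^2 because |x_j - a_j| \<open>invr\<close> \<le> 1, and e^2
  \<open>invr\<close>^5 \<le> \<open>invr\<close>^2 / e because \<open>invr\<close> \<le>
  1/e.\<close>

lemma newton_pairing_eq_0:
  fixes D :: "3 \<Rightarrow> real^3 \<Rightarrow> 'b::{banach,second_countable_topology}"
  assumes D: "\<And>i x. (D i has_derivative D' i x) (at x)"
    and symD: "\<And>i j x. D' i x (axis j 1) = D' j x (axis i 1)"
    and divD: "\<And>x. (\<Sum>i\<in>UNIV. D' i x (axis i 1)) = 0"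
    and L2: "\<And>i. integrable lborel (\<lambda>x. (norm (D i x))\<^sup>2)" and e: "e > 0"
  shows "(LINT x|lborel. (e\<^sup>2 * (invr a e x) ^ 5) *\<^sub>R D i x) = 0"
    and "integrable lborel (\<lambda>x. (e\<^sup>2 * (invr a e x) ^ 5) *\<^sub>R D i x)"
proof -
  let ?r = "invr a e"
  let ?p = "\<lambda>j x. - (x $ j - a $ j) * (?r x) ^ 3"
  let ?p' = "\<lambda>j x h. - (h $ j) * (?r x) ^ 3 + 3 * (x $ j - a $ j) * ((x - a) \<bullet> h) * (?r x) ^ 5"
  let ?q = "\<lambda>x. - 3 * (e\<^sup>2 * (?r x) ^ 5)"
  have r: "?r x > 0" for x using invr_pos[OF e] .
  have [measurable]: "D i \<in> borel_measurable borel" for i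
    using D by (intro borel_measurable_continuous_onI continuous_at_imp_continuous_on ballI) (rule has_derivative_continuous)
  have [measurable]: "?r \<in> borel_measurable borel"
    using continuous_invr[OF e] by (rule borel_measurable_continuous_onI)
  note I = integrable_invr_mult[OF e _ L2, of _ a]
  have i5: "integrable lborel (\<lambda>x. (e\<^sup>2 * (?r x) ^ 5) *\<^sub>R D i x)" for i
  proof (rule Bochner_Integration.integrable_bound)
    show "integrable lborel (\<lambda>x. 1 / e * ((?r x)\<^sup>2 * norm (D i x)))" by (intro integrable_mult_right I) measurable
    have "e\<^sup>2 * (?r x) ^ 5 \<le> 1 / e * (?r x)\<^sup>2" for x
    proof -
      have "?r x \<le> 1 / e" using e unfolding invr_def by (intro divide_left_mono) (auto intro!: real_le_rsqrt mult_pos_pos add_nonneg_pos)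
      then have "(?r x) ^ 3 \<le> (1 / e) ^ 3" using r[of x] by (intro power_mono) auto
      then have "e\<^sup>2 * ((?r x) ^ 3 * (?r x)\<^sup>2) \<le> e\<^sup>2 * ((1 / e) ^ 3 * (?r x)\<^sup>2)" by (intro mult_left_mono mult_right_mono) auto
      then show ?thesis using e by (simp add: power_divide power2_eq_square power3_eq_cube eval_nat_numeral field_simps)
    qed
    then have "\<bar>e\<^sup>2 * (?r x) ^ 5\<bar> * norm (D i x) \<le> \<bar>1 / e * (?r x)\<^sup>2\<bar> * norm (D i x)" for x
      using r[of x] e by (intro mult_right_mono) auto
    then show "AE x in lborel. norm ((e\<^sup>2 * (?r x) ^ 5) *\<^sub>R D i x) \<le> norm (1 / e * ((?r x)\<^sup>2 * norm (D i x)))"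
      by (simp add: abs_mult)
  qed measurable
  then show "integrable lborel (\<lambda>x. (e\<^sup>2 * (invr a e x) ^ 5) *\<^sub>R D i x)" .
  have "(LINT x|lborel. ?q x *\<^sub>R D i x) = 0"
  proof (rule harmonic_pairing_eq_0[OF D _ symD _ divD, where p="?p" and p'="?p'"])
    show "(?p j has_derivative ?p' j x) (at x)" for j x
      by (auto intro!: derivative_eq_intros has_derivative_invr[OF e] bounded_linear_imp_has_derivative bounded_linear_vec_nth ext simp: algebra_simps eval_nat_numeral)
    show "?p' i x (axis j 1) = ?p' j x (axis i 1)" for i j x
      by (auto simp: axis_def inner_axis[unfolded axis_def] algebra_simps)
    show "?q x = (\<Sum>j\<in>UNIV. ?p' j x (axis j 1))" for x
    proof -
      \<comment> \<open>Multiplying \<open>?r x ^ 3\<close> by this representation of 1 turns the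
        divergence -3 r^3 + 3 |x-a|^2 r^5 into -3 e^2 r^5.\<close>
      have "(norm (x - a))\<^sup>2 * (?r x)\<^sup>2 + e\<^sup>2 * (?r x)\<^sup>2 = 1"
        unfolding invr_sq[OF e] using e by (simp add: add_nonneg_eq_0_iff flip: distrib_right add_divide_distrib)
      then have "(?r x) ^ 3 = ((norm (x - a))\<^sup>2 * (?r x)\<^sup>2 + e\<^sup>2 * (?r x)\<^sup>2) * (?r x) ^ 3" by simp
      then have k: "(?r x) ^ 3 = (norm (x - a))\<^sup>2 * (?r x) ^ 5 + e\<^sup>2 * (?r x) ^ 5"
        by (simp add: algebra_simps eval_nat_numeral)
      have "(\<Sum>j\<in>UNIV. ?p' j x (axis j 1)) = - 3 * (?r x) ^ 3 + 3 * (\<Sum>j\<in>UNIV. (x $ j - a $ j)\<^sup>2) * (?r x) ^ 5"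
      proof -
        have "?p' j x (axis j 1) = - ((?r x) ^ 3) + 3 * (x $ j - a $ j)\<^sup>2 * (?r x) ^ 5" for j
          by (simp add: inner_axis power2_eq_square)
        then show ?thesis by (simp only: sum.distrib) (simp add: sum_distrib_left sum_distrib_right)
      qed
      also have "(\<Sum>j\<in>UNIV. (x $ j - a $ j)\<^sup>2) = (norm (x - a))\<^sup>2"
        unfolding power2_norm_eq_inner inner_vec_def by (simp add: power2_eq_square)
      finally show ?thesis using k by simp
    qed
    show "continuous_on UNIV ?q" by (intro continuous_intros continuous_invr e)
    show "integrable lborel (\<lambda>x. ?p j x *\<^sub>R D i x)" for i j
    proof (rule Bochner_Integration.integrable_bound)
      show "integrable lborel (\<lambda>x. (?r x)\<^sup>2 * norm (D i x))" by (intro I) measurable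
      have "\<bar>?p j x\<bar> \<le> (?r x)\<^sup>2" for x
      proof -
        have "\<bar>?p j x\<bar> = (\<bar>x $ j - a $ j\<bar> * ?r x) * (?r x)\<^sup>2"
          using r[of x] by (simp add: abs_mult eval_nat_numeral power2_eq_square)
        also have "\<dots> \<le> 1 * (?r x)\<^sup>2" by (intro mult_right_mono component_invr e) auto
        finally show ?thesis by simp
      qed
      then have "\<bar>?p j x\<bar> * norm (D i x) \<le> (?r x)\<^sup>2 * norm (D i x)" for x by (intro mult_right_mono) auto
      then show "AE x in lborel. norm (?p j x *\<^sub>R D i x) \<le> norm ((?r x)\<^sup>2 * norm (D i x))"
        by (simp add: abs_mult)
    qed measurable
    show "integrable lborel (\<lambda>x. ?q x *\<^sub>R D i x)" for i
      using integrable_scaleR_right[OF i5, of "-3" i] by simp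
  qed
  moreover have "(LINT x|lborel. ?q x *\<^sub>R D i x) = (LINT x|lborel. (-3) *\<^sub>R ((e\<^sup>2 * (?r x) ^ 5) *\<^sub>R D i x))"
    by (simp only: scaleR_scaleR)
  moreover have "\<dots> = (-3) *\<^sub>R (LINT x|lborel. (e\<^sup>2 * (?r x) ^ 5) *\<^sub>R D i x)"
    by (rule Bochner_Integration.integral_scaleR_right)
  ultimately show "(LINT x|lborel. (e\<^sup>2 * (invr a e x) ^ 5) *\<^sub>R D i x) = 0"
    by simp
qed

text \<open>The kernels e^2 \<open>invr\<close>^5 concentrate at a with mass independent of e, so
  their pairings with \<open>D i\<close>, all zero, should tend to a multiple of
  \<open>D i a\<close>. As \<open>D i\<close> is not known to be bounded, the unit ball around a is
  split off: inside, continuity and compactness permit dominated convergence after rescaling;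
  outside, square integrability makes the contribution O(e^2).\<close>

theorem div_curl_free_L2_eq_0:
  fixes D :: "3 \<Rightarrow> real^3 \<Rightarrow> 'b::{banach,second_countable_topology}"
  assumes D: "\<And>i x. (D i has_derivative D' i x) (at x)"
    and symD: "\<And>i j x. D' i x (axis j 1) = D' j x (axis i 1)"
    and divD: "\<And>x. (\<Sum>i\<in>UNIV. D' i x (axis i 1)) = 0"
    and L2: "\<And>i. integrable lborel (\<lambda>x. (norm (D i x))\<^sup>2)"
  shows "D i a = 0"
proof -
  let ?f = "D i" and ?e = "\<lambda>m::nat. 1 / real (Suc m)"
  let ?k = "\<lambda>m x. (?e m)\<^sup>2 * (invr a (?e m) x) ^ 5"
  let ?B = "cball a 1"
  have fc: "continuous_on UNIV ?f"
    using D by (intro continuous_at_imp_continuous_on ballI) (rule has_derivative_continuous)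
  have fm [measurable]: "?f \<in> borel_measurable borel" using fc by (rule borel_measurable_continuous_onI)
  have [measurable]: "invr b e \<in> borel_measurable borel" if "e > 0" for b e
    using continuous_invr[OF that] by (rule borel_measurable_continuous_onI)
  have e: "?e m > 0" for m by simp
  have int: "integrable lborel (\<lambda>x. ?k m x *\<^sub>R ?f x)" and zero: "(LINT x|lborel. ?k m x *\<^sub>R ?f x) = 0" for m
    using newton_pairing_eq_0[OF D symD divD L2 e] by blast+
  have int1: "integrable lborel (\<lambda>x. ?k m x *\<^sub>R indicator ?B x *\<^sub>R ?f x)" for m
    using integrable_mult_indicator[OF _ int, of ?B m] by (simp add: mult.commute)
  have int2: "integrable lborel (\<lambda>x. ?k m x *\<^sub>R indicator (- ?B) x *\<^sub>R ?f x)" for m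
    using integrable_mult_indicator[OF _ int, of "- ?B" m] by (simp add: mult.commute)
  have split: "(LINT x|lborel. ?k m x *\<^sub>R indicator ?B x *\<^sub>R ?f x) = - (LINT x|lborel. ?k m x *\<^sub>R indicator (- ?B) x *\<^sub>R ?f x)" for m
  proof -
    have "(LINT x|lborel. ?k m x *\<^sub>R indicator ?B x *\<^sub>R ?f x) + (LINT x|lborel. ?k m x *\<^sub>R indicator (- ?B) x *\<^sub>R ?f x)
      = (LINT x|lborel. ?k m x *\<^sub>R ?f x)"
      unfolding Bochner_Integration.integral_add[OF int1 int2, symmetric]
      by (intro Bochner_Integration.integral_cong) (auto split: split_indicator)
    then show ?thesis using zero[of m] by (simp add: add_eq_0_iff2)
  qed
  have far: "(\<lambda>m. LINT x|lborel. ?k m x *\<^sub>R indicator (- ?B) x *\<^sub>R ?f x) \<longlonglongrightarrow> 0"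
  proof (rule Lim_null_comparison)
    let ?C = "LINT x|lborel. (invr a 1 x)\<^sup>2 * norm (?f x)"
    have I: "integrable lborel (\<lambda>x. (invr a 1 x)\<^sup>2 * norm (?f x))" by (rule integrable_invr_mult[OF _ _ L2]) auto
    show "eventually (\<lambda>m. norm (LINT x|lborel. ?k m x *\<^sub>R indicator (- ?B) x *\<^sub>R ?f x) \<le> 2 * (?e m)\<^sup>2 * ?C) sequentially"
    proof (rule always_eventually, rule allI)
      fix m
      have "norm (LINT x|lborel. ?k m x *\<^sub>R indicator (- ?B) x *\<^sub>R ?f x) \<le> (LINT x|lborel. 2 * (?e m)\<^sup>2 * ((invr a 1 x)\<^sup>2 * norm (?f x)))"
      proof (rule Bochner_Integration.integral_norm_bound_integral[OF int2 integrable_mult_right[OF I]])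
        fix x
        show "norm (?k m x *\<^sub>R indicator (- ?B) x *\<^sub>R ?f x) \<le> 2 * (?e m)\<^sup>2 * ((invr a 1 x)\<^sup>2 * norm (?f x))"
        proof (cases "x \<in> ?B")
          case True then show ?thesis by simp
        next
          case False
          \<comment> \<open>Outside the unit ball 1 + |x-a|^2 \<le> 2 |x-a|^2, whence the factor 2,
            and \<open>?r\<close> is at most 1, so its fifth power may be replaced by its square;
            the prefactor e^2 remains.\<close>
          then have n: "norm (x - a) > 1" by (simp add: dist_norm norm_minus_commute)
          let ?r = "invr a (?e m) x"
          have r: "?r > 0" by (rule invr_pos) simp
          have n2: "(norm (x - a))\<^sup>2 > 1" using n by (simp add: power2_eq_square less_1_mult)
          have "?r\<^sup>2 \<le> 1 / (norm (x - a))\<^sup>2"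
            unfolding invr_sq[OF e] using n2 by (intro divide_left_mono) (auto intro!: mult_pos_pos add_pos_nonneg)
          also have "\<dots> \<le> 2 * (invr a 1 x)\<^sup>2"
          proof -
            have "(1 + (norm (x - a))\<^sup>2) \<le> 2 * (norm (x - a))\<^sup>2" using n2 by simp
            moreover have "(norm (x - a))\<^sup>2 > 0" "1 + (norm (x - a))\<^sup>2 > 0" using n2 by linarith+
            ultimately show ?thesis by (simp add: invr_sq divide_simps)
          qed
          finally have r2: "?r\<^sup>2 \<le> 2 * (invr a 1 x)\<^sup>2" .
          have "?r\<^sup>2 \<le> 1" using \<open>?r\<^sup>2 \<le> 1 / (norm (x - a))\<^sup>2\<close>
            by (rule order_trans) (use n2 in \<open>auto simp: divide_le_eq\<close>)
          then have "?r \<le> 1" using r by (simp add: power_le_one_iff)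
          then have "?r ^ 5 \<le> ?r ^ 2" using r by (intro power_decreasing) auto
          then have "?k m x \<le> 2 * (?e m)\<^sup>2 * (invr a 1 x)\<^sup>2"
            using r2 by (simp add: mult_left_mono mult.assoc divide_right_mono)
          then have "\<bar>?k m x\<bar> * norm (?f x) \<le> 2 * (?e m)\<^sup>2 * (invr a 1 x)\<^sup>2 * norm (?f x)"
            using r by (intro mult_right_mono) auto
          then show ?thesis using False by (simp add: mult_ac)
        qed
      qed
      then show "norm (LINT x|lborel. ?k m x *\<^sub>R indicator (- ?B) x *\<^sub>R ?f x) \<le> 2 * (?e m)\<^sup>2 * ?C"
        using I by simp
    qed
    have "(\<lambda>m. 2 * (?e m)\<^sup>2 * ?C) \<longlonglongrightarrow> 2 * 0\<^sup>2 * ?C" by (intro tendsto_intros LIMSEQ_Suc[OF lim_1_over_n])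
    then show "(\<lambda>m. 2 * (?e m)\<^sup>2 * ?C) \<longlonglongrightarrow> 0" by simp
  qed
  let ?\<psi> = "\<lambda>y. (invr 0 1 y) ^ 5"
  have \<psi>: "integrable lborel ?\<psi>"
  proof (rule Bochner_Integration.integrable_bound[OF integrable_japanese])
    have "?\<psi> y \<le> 1 / (1 + (norm y)\<^sup>2)\<^sup>2" for y
    proof -
      have "1 \<le> sqrt ((norm y)\<^sup>2 + 1)" by (rule real_le_rsqrt) simp
      then have "invr 0 1 y \<le> 1" unfolding invr_def by (subst divide_le_eq_1_pos) (auto intro!: add_nonneg_pos)
      then have "?\<psi> y \<le> (invr 0 1 y) ^ 4" using invr_pos[of 1 0 y] by (intro power_decreasing) auto
      also have "\<dots> = ((invr 0 1 y)\<^sup>2)\<^sup>2" by simp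
      also have "\<dots> = 1 / (1 + (norm y)\<^sup>2)\<^sup>2" by (subst invr_sq) (auto simp: power_divide add.commute)
      finally show ?thesis .
    qed
    then show "AE y in lborel. norm (?\<psi> y) \<le> norm (1 / (1 + (norm y)\<^sup>2)\<^sup>2)"
      using invr_pos[of 1 0] by (intro AE_I2) (simp add: less_imp_le)
  qed auto
  have subst: "(LINT x|lborel. ?k m x *\<^sub>R indicator ?B x *\<^sub>R ?f x)
     = (LINT y|lborel. ?\<psi> y *\<^sub>R indicator ?B (a + ?e m *\<^sub>R y) *\<^sub>R ?f (a + ?e m *\<^sub>R y))" for m
  proof -
    \<comment> \<open>The Jacobian e^3 of x = a + e y compensates e^2 * e^(-5), so the rescaled
      kernel is the fixed profile \<open>?\<psi>\<close>.\<close>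
    have k: "(?e m) ^ 3 * ?k m (a + ?e m *\<^sub>R y) = ?\<psi> y" for y
    proof -
      have "(norm (?e m *\<^sub>R y))\<^sup>2 + (?e m)\<^sup>2 = (?e m)\<^sup>2 * ((norm y)\<^sup>2 + 1)"
        by (simp add: power_mult_distrib power_divide field_simps)
      then have "invr a (?e m) (a + ?e m *\<^sub>R y) = invr 0 1 y / ?e m"
        by (simp only: invr_def add_diff_cancel_left' real_sqrt_mult real_sqrt_abs) simp
      moreover have "c ^ 3 * (c\<^sup>2 * (t / c) ^ 5) = t ^ 5" if "c > 0" for c t :: real
        using that by (simp add: power_divide eval_nat_numeral)
      ultimately show ?thesis using e[of m] by metis
    qed
    have "(LINT x|lborel. ?k m x *\<^sub>R indicator ?B x *\<^sub>R ?f x)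
      = (?e m) ^ 3 *\<^sub>R (LINT y|lborel. ?k m (a + ?e m *\<^sub>R y) *\<^sub>R indicator ?B (a + ?e m *\<^sub>R y) *\<^sub>R ?f (a + ?e m *\<^sub>R y))"
      using integral_affine_euclidean[OF e, of "\<lambda>x. ?k m x *\<^sub>R indicator ?B x *\<^sub>R ?f x" m a]
        borel_measurable_integrable[OF int1[of m]] by simp
    also have "\<dots> = (LINT y|lborel. (?e m) ^ 3 *\<^sub>R ?k m (a + ?e m *\<^sub>R y) *\<^sub>R indicator ?B (a + ?e m *\<^sub>R y) *\<^sub>R ?f (a + ?e m *\<^sub>R y))"
      by (rule Bochner_Integration.integral_scaleR_right[symmetric])
    also have "\<dots> = (LINT y|lborel. ?\<psi> y *\<^sub>R indicator ?B (a + ?e m *\<^sub>R y) *\<^sub>R ?f (a + ?e m *\<^sub>R y))"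
    proof (rule Bochner_Integration.integral_cong[OF refl])
      fix y
      show "(?e m) ^ 3 *\<^sub>R ?k m (a + ?e m *\<^sub>R y) *\<^sub>R indicator ?B (a + ?e m *\<^sub>R y) *\<^sub>R ?f (a + ?e m *\<^sub>R y)
        = ?\<psi> y *\<^sub>R indicator ?B (a + ?e m *\<^sub>R y) *\<^sub>R ?f (a + ?e m *\<^sub>R y)"
        unfolding k[of y, symmetric] by (simp only: scaleR_scaleR mult.assoc)
    qed
    finally show ?thesis .
  qed
  have near: "(\<lambda>m. LINT y|lborel. ?\<psi> y *\<^sub>R indicator ?B (a + ?e m *\<^sub>R y) *\<^sub>R ?f (a + ?e m *\<^sub>R y)) \<longlonglongrightarrow> (LINT y|lborel. ?\<psi> y *\<^sub>R ?f a)"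
  proof -
    have "compact (?f ` ?B)" by (intro compact_continuous_image continuous_on_subset[OF fc]) auto
    then obtain C where C: "\<And>x. x \<in> ?B \<Longrightarrow> norm (?f x) \<le> C"
      using compact_imp_bounded bounded_iff by (metis imageI)
    have C0: "C \<ge> 0" using C[of a] norm_ge_zero[of "?f a"] by (simp del: norm_ge_zero)
    show ?thesis
    proof (rule integral_dominated_convergence[where w="\<lambda>y. ?\<psi> y * C"])
      show "AE y in lborel. norm (?\<psi> y *\<^sub>R indicator ?B (a + ?e m *\<^sub>R y) *\<^sub>R ?f (a + ?e m *\<^sub>R y)) \<le> ?\<psi> y * C" for m
      proof (rule AE_I2)
        fix y
        have "norm (indicator ?B (a + ?e m *\<^sub>R y) *\<^sub>R ?f (a + ?e m *\<^sub>R y)) \<le> C"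
          using C C0 by (cases "a + ?e m *\<^sub>R y \<in> ?B") auto
        then show "norm (?\<psi> y *\<^sub>R indicator ?B (a + ?e m *\<^sub>R y) *\<^sub>R ?f (a + ?e m *\<^sub>R y)) \<le> ?\<psi> y * C"
          using invr_pos[of 1 0 y] by (subst norm_scaleR) (auto intro!: mult_mono)
      qed
      show "AE y in lborel. (\<lambda>m. ?\<psi> y *\<^sub>R indicator ?B (a + ?e m *\<^sub>R y) *\<^sub>R ?f (a + ?e m *\<^sub>R y)) \<longlonglongrightarrow> ?\<psi> y *\<^sub>R ?f a"
      proof (rule AE_I2)
        fix y
        have lim: "(\<lambda>m. a + ?e m *\<^sub>R y) \<longlonglongrightarrow> a"
          using tendsto_add[OF tendsto_const tendsto_scaleR[OF LIMSEQ_Suc[OF lim_1_over_n] tendsto_const], of a y] by simp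
        have "eventually (\<lambda>m. a + ?e m *\<^sub>R y \<in> ball a 1) sequentially"
          by (rule topological_tendstoD[OF lim]) auto
        then have ev: "eventually (\<lambda>m. ?\<psi> y *\<^sub>R ?f (a + ?e m *\<^sub>R y) = ?\<psi> y *\<^sub>R indicator ?B (a + ?e m *\<^sub>R y) *\<^sub>R ?f (a + ?e m *\<^sub>R y)) sequentially"
          by eventually_elim auto
        have "isCont ?f a" using fc by (simp add: continuous_on_eq_continuous_at)
        then have "(\<lambda>m. ?\<psi> y *\<^sub>R ?f (a + ?e m *\<^sub>R y)) \<longlonglongrightarrow> ?\<psi> y *\<^sub>R ?f a"
          by (intro tendsto_intros isCont_tendsto_compose[OF _ lim])
        then show "(\<lambda>m. ?\<psi> y *\<^sub>R indicator ?B (a + ?e m *\<^sub>R y) *\<^sub>R ?f (a + ?e m *\<^sub>R y)) \<longlonglongrightarrow> ?\<psi> y *\<^sub>R ?f a"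
          by (rule Lim_transform_eventually[OF _ ev])
      qed
      have [measurable]: "invr 0 1 \<in> borel_measurable borel" by simp
      show "(\<lambda>y. ?\<psi> y *\<^sub>R indicator ?B (a + ?e m *\<^sub>R y) *\<^sub>R ?f (a + ?e m *\<^sub>R y)) \<in> borel_measurable lborel" for m
      proof -
        have G: "(\<lambda>x. indicator ?B x *\<^sub>R ?f x) \<in> borel_measurable borel"
          by (intro borel_measurable_scaleR borel_measurable_indicator fm) simp
        have "(\<lambda>y. a + ?e m *\<^sub>R y) \<in> borel_measurable lborel" by simp
        from measurable_compose[OF this G] show ?thesis by (rule borel_measurable_scaleR[rotated]) simp
      qed
      show "(\<lambda>y. ?\<psi> y *\<^sub>R ?f a) \<in> borel_measurable lborel" by measurable
      show "integrable lborel (\<lambda>y. ?\<psi> y * C)" using \<psi> by simp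
    qed
  qed
  have "(LINT y|lborel. ?\<psi> y *\<^sub>R ?f a) = 0"
  proof -
    have "(\<lambda>m. - (LINT x|lborel. ?k m x *\<^sub>R indicator (- ?B) x *\<^sub>R ?f x)) \<longlonglongrightarrow> - 0" by (intro tendsto_intros far)
    then have "(\<lambda>m. LINT y|lborel. ?\<psi> y *\<^sub>R indicator ?B (a + ?e m *\<^sub>R y) *\<^sub>R ?f (a + ?e m *\<^sub>R y)) \<longlonglongrightarrow> 0"
      unfolding split[symmetric] subst by simp
    from LIMSEQ_unique[OF near this] show ?thesis .
  qed
  then have "(LINT y|lborel. ?\<psi> y) *\<^sub>R ?f a = 0" using \<psi> by simp
  \<comment> \<open>A nonnegative function with integral 0 vanishes almost everywhere, but
    \<open>?\<psi>\<close> is positive at every point.\<close>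
  moreover have "(LINT y|lborel. ?\<psi> y) \<noteq> 0"
  proof
    assume "(LINT y|lborel. ?\<psi> y) = 0"
    then have "AE y in lborel. ?\<psi> y = 0"
      using \<psi> invr_pos[of 1 0] by (subst (asm) integral_nonneg_eq_0_iff_AE) (auto simp: less_imp_le)
    then have "AE y in (lborel :: (real^3) measure). False"
      by (rule AE_mp) (use invr_pos[of 1 0] in \<open>auto intro!: AE_I2 simp: less_le\<close>)
    then show False by (simp add: ae_filter_eq_bot_iff eventually_False)
  qed
  ultimately show ?thesis by simp
qed

section \<open>Fourier transform\<close>

text \<open>The unnormalised inverse Fourier transform, with the sign of the exponent in
  \<open>rho\<close>; powers of 2 pi are carried outside.\<close>

definition ft :: "('a::euclidean_space \<Rightarrow> complex) \<Rightarrow> 'a \<Rightarrow> complex" where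
  "ft f x = (LINT k|lborel. f k * cis (k \<bullet> x))"

lemma measurable_cis [measurable]: "cis \<in> borel_measurable borel"
  by (intro borel_measurable_continuous_onI) (auto simp: cis_conv_exp intro!: continuous_intros)

lemma measurable_cnj [measurable]: "cnj \<in> borel_measurable borel"
  by (intro borel_measurable_continuous_onI continuous_intros)

lemma integrable_ft: "integrable lborel f \<Longrightarrow> integrable lborel (\<lambda>k. f k * cis (k \<bullet> x))"
  by (rule Bochner_Integration.integrable_bound[of _ f]) (auto simp: norm_mult)

lemma norm_ft_le: "norm (ft f x) \<le> (LINT k|lborel. norm (f k))"
  unfolding ft_def by (rule order_trans[OF integral_norm_bound]) (simp add: norm_mult)

lemma measurable_ft:
  assumes [measurable]: "f \<in> borel_measurable borel"
  shows "ft f \<in> borel_measurable borel"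
  unfolding ft_def[abs_def] by measurable

text \<open>Fubini for f(k) g(x) cis (k \<bullet> x), whose modulus is a product of integrable
  functions.\<close>

lemma ft_multiplication:
  fixes f g :: "'a::euclidean_space \<Rightarrow> complex"
  assumes f: "integrable lborel f" and g: "integrable lborel g"
  shows "(LINT x|lborel. ft f x * g x) = (LINT k|lborel. f k * ft g k)"
proof -
  have [measurable]: "f \<in> borel_measurable borel" "g \<in> borel_measurable borel"
    using borel_measurable_integrable[OF f] borel_measurable_integrable[OF g] by simp_all
  let ?h = "\<lambda>(x, k). f k * g x * cis (k \<bullet> x)"
  have "integrable (lborel \<Otimes>\<^sub>M lborel) ?h"
  proof (rule lborel_pair.Fubini_integrable)
    show "?h \<in> borel_measurable (lborel \<Otimes>\<^sub>M lborel)" by measurable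
    have "(LINT k|lborel. norm (?h (x, k))) = (LINT k|lborel. norm (f k)) * norm (g x)" for x
      by (simp add: norm_mult)
    then show "integrable lborel (\<lambda>x. LINT k|lborel. norm (?h (x, k)))" using g by simp
    show "AE x in lborel. integrable lborel (\<lambda>k. ?h (x, k))"
    proof (rule AE_I2)
      fix x
      have "integrable lborel (\<lambda>k. g x * (f k * cis (k \<bullet> x)))" by (intro integrable_mult_right integrable_ft f)
      then show "integrable lborel (\<lambda>k. ?h (x, k))" by (simp add: mult_ac)
    qed
  qed
  then have "(LINT k|lborel. LINT x|lborel. f k * g x * cis (k \<bullet> x)) = (LINT x|lborel. LINT k|lborel. f k * g x * cis (k \<bullet> x))"
    by (intro lborel_pair.Fubini_integral) simp
  moreover have "(LINT x|lborel. f k * g x * cis (k \<bullet> x)) = f k * ft g k" for k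
    by (simp add: ft_def inner_commute mult.assoc)
  moreover have "(LINT k|lborel. f k * g x * cis (k \<bullet> x)) = ft f x * g x" for x
  proof -
    have "f k * g x * cis (k \<bullet> x) = f k * cis (k \<bullet> x) * g x" for k by (simp add: mult_ac)
    then show ?thesis by (simp only: ft_def integral_mult_left_zero)
  qed
  ultimately show ?thesis by simp
qed

section \<open>Gaussians and their transforms\<close>

definition gauss :: "'a::real_inner \<Rightarrow> complex" where
  "gauss x = complex_of_real (exp (- (norm x)\<^sup>2 / 2))"

lemma continuous_gauss: "continuous_on UNIV gauss"
  unfolding gauss_def[abs_def] by (intro continuous_intros) auto

lemma measurable_gauss [measurable]: "(gauss :: 'a::euclidean_space \<Rightarrow> complex) \<in> borel_measurable borel"
  by (rule borel_measurable_continuous_onI[OF continuous_gauss])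

text \<open>Read off from the characteristic function of the standard normal distribution, whose
  density is this Gaussian divided by sqrt (2 pi).\<close>

lemma gauss_real:
  shows integrable_gauss_real: "integrable lborel (\<lambda>x. gauss (x::real) * cis (x * t))"
    and integral_gauss_real: "(LINT x|lborel. gauss (x::real) * cis (x * t)) = complex_of_real (sqrt (2 * pi)) * gauss t"
proof -
  have eq: "gauss x * cis (x * t) = complex_of_real (sqrt (2 * pi)) * (std_normal_density x *\<^sub>R cis (t * x))" for x :: real
    by (simp add: gauss_def std_normal_density_def scaleR_conv_of_real mult.commute)
  have "integrable lborel std_normal_density" by simp
  then have "integrable lborel (\<lambda>x. std_normal_density x *\<^sub>R cis (t * x))"
    by (rule Bochner_Integration.integrable_bound) auto
  then show "integrable lborel (\<lambda>x. gauss (x::real) * cis (x * t))"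
    unfolding eq by (rule integrable_mult_right)
  have "(LINT x|lborel. std_normal_density x *\<^sub>R cis (t * x)) = char std_normal_distribution t"
    unfolding char_def by (subst integral_density) (auto simp: cis_conv_exp)
  also have "\<dots> = gauss t" by (simp add: char_std_normal_distribution gauss_def)
  finally show "(LINT x|lborel. gauss (x::real) * cis (x * t)) = complex_of_real (sqrt (2 * pi)) * gauss t"
    unfolding eq by (simp only: integral_mult_right_zero)
qed

lemma gauss_vec: "gauss (x::real^'n::finite) = (\<Prod>i\<in>UNIV. gauss (x $ i))"
  by (simp add: gauss_def norm_vec_def L2_set_def sum_nonneg exp_sum[symmetric] sum_negf sum_divide_distrib
     flip: of_real_prod)

lemma cis_sum: "cis (sum f A) = (\<Prod>i\<in>A. cis (f i))"
  by (induction A rule: infinite_finite_induct) (auto simp: cis_mult[symmetric])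

lemma gauss_cis_vec: "gauss (x::real^'n::finite) * cis (x \<bullet> p) = (\<Prod>i\<in>UNIV. gauss (x $ i) * cis (x $ i * p $ i))"
  by (simp add: gauss_vec inner_vec_def cis_sum prod.distrib)

lemma integrable_gauss: "integrable lborel (gauss :: real^'n::finite \<Rightarrow> complex)"
proof -
  have "integrable lborel (\<lambda>x::real^'n. gauss x * cis (x \<bullet> 0))"
    unfolding gauss_cis_vec by (rule integrable_vec_prod) (rule integrable_gauss_real)
  then show ?thesis by simp
qed

lemma ft_gauss: "ft gauss (p::real^'n::finite) = complex_of_real (sqrt (2 * pi) ^ CARD('n)) * gauss p"
proof -
  have "ft gauss p = (\<Prod>i\<in>UNIV. complex_of_real (sqrt (2 * pi)) * gauss (p $ i))"
    unfolding ft_def gauss_cis_vec by (subst integral_vec_prod) (simp_all add: integrable_gauss_real integral_gauss_real)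
  then show ?thesis by (simp add: prod.distrib gauss_vec[symmetric])
qed

text \<open>One factor sqrt (2 pi)^n comes from transforming the Gaussian, the other from its
  integral, which is its transform at 0. The product becomes the constant in Plancherel's
  formula.\<close>

lemma integral_ft_gauss: "(LINT q|lborel. ft gauss (q::real^'n::finite)) = complex_of_real ((2 * pi) ^ CARD('n))"
proof -
  have "(LINT q|lborel. gauss (q::real^'n)) = ft gauss (0::real^'n)" by (simp add: ft_def)
  also have "\<dots> = complex_of_real (sqrt (2 * pi) ^ CARD('n))" by (simp only: ft_gauss) (simp add: gauss_def)
  finally have "(LINT q|lborel. ft gauss (q::real^'n)) = complex_of_real (sqrt (2 * pi) ^ CARD('n) * sqrt (2 * pi) ^ CARD('n))"
    by (simp add: ft_gauss)
  also have "sqrt (2 * pi) ^ CARD('n) * sqrt (2 * pi) ^ CARD('n) = (2 * pi) ^ CARD('n)"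
    by (simp only: power_mult_distrib[symmetric] real_sqrt_mult_self) simp
  finally show ?thesis .
qed

lemma integrable_ft_gauss: "integrable lborel (ft (gauss :: real^'n::finite \<Rightarrow> complex))"
  unfolding ft_gauss[abs_def] by (intro integrable_mult_right integrable_gauss)

lemma integrable_gauss_scaled: "e > 0 \<Longrightarrow> integrable lborel (\<lambda>x::real^'n::finite. gauss (e *\<^sub>R x))"
  using iffD1[OF integrable_affine_euclidean[of e gauss 0] integrable_gauss] by simp

lemma ft_gauss_scaled:
  fixes q :: "real^'n::finite"
  assumes "e > 0"
  shows "e ^ CARD('n) *\<^sub>R ft (\<lambda>x. gauss (e *\<^sub>R x)) (e *\<^sub>R q) = ft gauss q"
  unfolding ft_def
  using integral_affine_euclidean[OF assms, of "\<lambda>x. gauss x * cis (x \<bullet> q)" 0] by simp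

lemma ft_modulated: "ft (\<lambda>x. f x * cis (- (k \<bullet> x))) l = ft f (l - k)"
  unfolding ft_def
proof (intro Bochner_Integration.integral_cong refl)
  fix x
  have "x \<bullet> (l - k) = - (k \<bullet> x) + x \<bullet> l" by (simp add: inner_diff_right inner_commute[of k])
  then show "f x * cis (- (k \<bullet> x)) * cis (x \<bullet> l) = f x * cis (x \<bullet> (l - k))"
    by (simp only: cis_mult[symmetric] mult.assoc)
qed

text \<open>The Gaussian weight makes the energy integral converge before square integrability of
  \<open>ft b\<close> is known. The multiplication formula moves one transform onto the weighted
  conjugate; there the transformed Gaussian, after the substitution l = k + e q, averages b around k
  at scale e.\<close>

lemma gauss_smoothed_energy:
  fixes b :: "real^'n::finite \<Rightarrow> complex"
  assumes b: "integrable lborel b" and e: "e > 0"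
  shows "(LINT x|lborel. ft b x * (gauss (e *\<^sub>R x) * cnj (ft b x)))
    = (LINT k|lborel. b k * cnj (LINT q|lborel. b (k + e *\<^sub>R q) * ft gauss q))"
    and "integrable lborel (\<lambda>x. ft b x * (gauss (e *\<^sub>R x) * cnj (ft b x)))"
proof -
  have bm [measurable]: "b \<in> borel_measurable borel" using borel_measurable_integrable[OF b] by simp
  have um: "ft b \<in> borel_measurable borel" by (rule measurable_ft) measurable
  let ?w = "\<lambda>x::real^'n. gauss (e *\<^sub>R x)"
  let ?C = "LINT k|lborel. norm (b k)"
  have w: "integrable lborel ?w" using e by (rule integrable_gauss_scaled)
  have C: "?C \<ge> 0" by (intro Bochner_Integration.integral_nonneg) auto
  have wm: "?w \<in> borel_measurable borel" using borel_measurable_integrable[OF w] by simp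
  have cm: "(\<lambda>x. cnj (ft b x)) \<in> borel_measurable borel"
    by (rule measurable_compose[OF um measurable_cnj])
  have wum: "(\<lambda>x. ?w x * cnj (ft b x)) \<in> borel_measurable borel" by (rule borel_measurable_times[OF wm cm])
  have wu: "integrable lborel (\<lambda>x. ?w x * cnj (ft b x))"
    by (rule Bochner_Integration.integrable_bound[OF integrable_mult_right[OF w, of "complex_of_real ?C"]])
       (use norm_ft_le[of b] C wum in \<open>auto intro!: mult_right_mono simp: norm_mult mult.commute[of "norm (gauss _)"]\<close>)
  show "integrable lborel (\<lambda>x. ft b x * (?w x * cnj (ft b x)))"
    by (rule Bochner_Integration.integrable_bound[OF integrable_mult_right[OF wu, of "complex_of_real ?C"]])
       (use norm_ft_le[of b] C borel_measurable_times[OF um wum] in \<open>auto intro!: mult_right_mono simp: norm_mult\<close>)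
  have "(LINT x|lborel. ft b x * (?w x * cnj (ft b x))) = (LINT k|lborel. b k * ft (\<lambda>x. ?w x * cnj (ft b x)) k)"
    by (rule ft_multiplication[OF b wu])
  moreover have "ft (\<lambda>x. ?w x * cnj (ft b x)) k = cnj (LINT q|lborel. b (k + e *\<^sub>R q) * ft gauss q)" for k
  proof -
    have wc: "integrable lborel (\<lambda>x. ?w x * cis (- (k \<bullet> x)))"
      using integrable_ft[OF w, of "- k"] by (simp add: inner_commute)
    have "ft (\<lambda>x. ?w x * cnj (ft b x)) k = cnj (LINT x|lborel. ft b x * (?w x * cis (- (k \<bullet> x))))"
      unfolding ft_def[of "\<lambda>x. ?w x * cnj (ft b x)"]
      by (subst Bochner_Integration.integral_cnj[symmetric])
         (auto intro!: Bochner_Integration.integral_cong simp: gauss_def cis_cnj inner_commute mult_ac)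
    also have "(LINT x|lborel. ft b x * (?w x * cis (- (k \<bullet> x)))) = (LINT l|lborel. b l * ft ?w (l - k))"
      unfolding ft_multiplication[OF b wc] ft_modulated ..
    also have "\<dots> = e ^ CARD('n) *\<^sub>R (LINT q|lborel. b (k + e *\<^sub>R q) * ft ?w (e *\<^sub>R q))"
    proof (subst integral_affine_euclidean[OF e, of _ k])
      have m: "ft ?w \<in> borel_measurable borel" by (rule measurable_ft) measurable
      show "(\<lambda>l. b l * ft ?w (l - k)) \<in> borel_measurable borel"
        by (rule borel_measurable_times[OF bm measurable_compose[OF _ m]]) measurable
    qed simp
    also have "\<dots> = (LINT q|lborel. e ^ CARD('n) *\<^sub>R (b (k + e *\<^sub>R q) * ft ?w (e *\<^sub>R q)))"
      by (rule Bochner_Integration.integral_scaleR_right[symmetric])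
    also have "\<dots> = (LINT q|lborel. b (k + e *\<^sub>R q) * ft gauss q)"
      unfolding ft_gauss_scaled[OF e, symmetric] by simp
    finally show ?thesis .
  qed
  ultimately show "(LINT x|lborel. ft b x * (?w x * cnj (ft b x)))
    = (LINT k|lborel. b k * cnj (LINT q|lborel. b (k + e *\<^sub>R q) * ft gauss q))" by (simp only:)
qed

text \<open>As e tends to 0 the averages tend to (2 pi)^n b(k) at points of continuity and are
  dominated because b is bounded, so the right-hand side of \<open>gauss_smoothed_energy\<close>
  converges. On the left the weights increase to 1, and monotone convergence yields integrability
  and value at once. Continuity almost everywhere admits amplitudes that are singular at the
  origin.\<close>

theorem plancherel_ft:
  fixes b :: "real^'n::finite \<Rightarrow> complex"
  assumes b: "integrable lborel b" and C: "\<And>k. norm (b k) \<le> C" and cont: "AE k in lborel. isCont b k"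
  shows "integrable lborel (\<lambda>x. (norm (ft b x))\<^sup>2)"
    and "(LINT x|lborel. (norm (ft b x))\<^sup>2) = (2 * pi) ^ CARD('n) * (LINT k|lborel. (norm (b k))\<^sup>2)"
proof -
  have bm [measurable]: "b \<in> borel_measurable borel" using borel_measurable_integrable[OF b] by simp
  have um [measurable]: "ft b \<in> borel_measurable borel" by (rule measurable_ft) measurable
  let ?e = "\<lambda>m::nat. 1 / real (Suc m)" and ?G = "ft (gauss :: real^'n \<Rightarrow> complex)"
  have e: "?e m > 0" for m by simp
  have e0: "?e \<longlonglongrightarrow> 0" by (rule LIMSEQ_Suc[OF lim_1_over_n])
  define J where "J m k = (LINT q|lborel. b (k + ?e m *\<^sub>R q) * ?G q)" for m k
  define f where "f m x = (norm (ft b x))\<^sup>2 * exp (- (norm (?e m *\<^sub>R x))\<^sup>2 / 2)" for m x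
  have Gm [measurable]: "?G \<in> borel_measurable borel" by (rule measurable_ft) measurable
  have C0: "C \<ge> 0" using C[of 0] norm_ge_zero order_trans by blast
  have Jlim: "(\<lambda>m. J m k) \<longlonglongrightarrow> b k * complex_of_real ((2 * pi) ^ CARD('n))" if "isCont b k" for k
  proof -
    have "(\<lambda>m. J m k) \<longlonglongrightarrow> (LINT q|lborel. b k * ?G q)"
      unfolding J_def
    proof (rule integral_dominated_convergence[where w="\<lambda>q. C * norm (?G q)"])
      show "integrable lborel (\<lambda>q. C * norm (?G q))" using integrable_ft_gauss by auto
      show "AE q in lborel. norm (b (k + ?e m *\<^sub>R q) * ?G q) \<le> C * norm (?G q)" for m
        by (auto simp: norm_mult intro!: mult_right_mono C)
      show "AE q in lborel. (\<lambda>m. b (k + ?e m *\<^sub>R q) * ?G q) \<longlonglongrightarrow> b k * ?G q"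
      proof (rule AE_I2)
        fix q
        have "(\<lambda>m. k + ?e m *\<^sub>R q) \<longlonglongrightarrow> k + 0 *\<^sub>R q" by (intro tendsto_intros e0)
        then have "(\<lambda>m. k + ?e m *\<^sub>R q) \<longlonglongrightarrow> k" by simp
        then show "(\<lambda>m. b (k + ?e m *\<^sub>R q) * ?G q) \<longlonglongrightarrow> b k * ?G q"
          by (intro tendsto_intros isCont_tendsto_compose[OF that])
      qed
      show "(\<lambda>q. b (k + ?e m *\<^sub>R q) * ?G q) \<in> borel_measurable lborel" for m
        using borel_measurable_times[OF measurable_compose[OF _ bm] Gm, of "\<lambda>q. k + ?e m *\<^sub>R q"] by simp
    qed simp
    also have "(LINT q|lborel. b k * ?G q) = b k * complex_of_real ((2 * pi) ^ CARD('n))"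
      by (simp add: integral_ft_gauss)
    finally show ?thesis .
  qed
  have Jm: "J m \<in> borel_measurable borel" for m
    unfolding J_def[abs_def] by measurable
  have Jbound: "norm (J m k) \<le> C * (LINT q|lborel. norm (?G q))" for m k
  proof -
    have "norm (J m k) \<le> (LINT q|lborel. norm (b (k + ?e m *\<^sub>R q) * ?G q))"
      unfolding J_def by (rule integral_norm_bound)
    also have "\<dots> \<le> (LINT q|lborel. C * norm (?G q))"
      by (rule integral_mono') (use integrable_ft_gauss C C0 in \<open>auto simp: norm_mult intro!: mult_right_mono\<close>)
    finally show ?thesis by simp
  qed
  have "(\<lambda>m. LINT k|lborel. b k * cnj (J m k)) \<longlonglongrightarrow> (LINT k|lborel. b k * cnj (b k * complex_of_real ((2 * pi) ^ CARD('n))))"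
  proof (rule integral_dominated_convergence[where w="\<lambda>k. norm (b k) * (C * (LINT q|lborel. norm (?G q)))"])
    show "integrable lborel (\<lambda>k. norm (b k) * (C * (LINT q|lborel. norm (?G q))))" using b by auto
    show "AE k in lborel. norm (b k * cnj (J m k)) \<le> norm (b k) * (C * (LINT q|lborel. norm (?G q)))" for m
      by (auto simp: norm_mult intro!: mult_left_mono Jbound)
    show "AE k in lborel. (\<lambda>m. b k * cnj (J m k)) \<longlonglongrightarrow> b k * cnj (b k * complex_of_real ((2 * pi) ^ CARD('n)))"
      using cont by eventually_elim (intro tendsto_intros Jlim)
    show "(\<lambda>k. b k * cnj (J m k)) \<in> borel_measurable lborel" for m
      using borel_measurable_times[OF bm measurable_compose[OF Jm[of m] measurable_cnj]] by simp
  qed simp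
  also have "(LINT k|lborel. b k * cnj (b k * complex_of_real ((2 * pi) ^ CARD('n)))) = (LINT k|lborel. complex_of_real ((2 * pi) ^ CARD('n) * (norm (b k))\<^sup>2))"
    by (intro Bochner_Integration.integral_cong refl)
       (simp only: of_real_mult complex_norm_square complex_cnj_mult complex_cnj_complex_of_real mult_ac)
  finally have "(\<lambda>m. LINT k|lborel. b k * cnj (J m k)) \<longlonglongrightarrow> complex_of_real ((2 * pi) ^ CARD('n) * (LINT k|lborel. (norm (b k))\<^sup>2))"
    by (simp only: integral_complex_of_real integral_mult_right_zero)
  moreover have feq: "ft b x * (gauss (?e m *\<^sub>R x) * cnj (ft b x)) = complex_of_real (f m x)" for m x
    by (simp only: f_def gauss_def of_real_mult complex_norm_square) (simp add: mult_ac)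
  then have "(LINT k|lborel. b k * cnj (J m k)) = complex_of_real (LINT x|lborel. f m x)" for m
    using gauss_smoothed_energy(1)[OF b e, of m] unfolding J_def by (simp only: integral_complex_of_real)
  ultimately have lim: "(\<lambda>m. LINT x|lborel. f m x) \<longlonglongrightarrow> (2 * pi) ^ CARD('n) * (LINT k|lborel. (norm (b k))\<^sup>2)"
    by (simp only: tendsto_of_real_iff)
  have fi: "integrable lborel (f m)" for m
    using gauss_smoothed_energy(2)[OF b e, of m] unfolding feq by (simp only: complex_of_real_integrable_eq)
  have mono: "AE x in lborel. mono (\<lambda>m. f m x)"
  proof (intro AE_I2 monoI)
    fix x :: "real^'n" and m n :: nat assume "m \<le> n"
    then have "?e n * norm x \<le> ?e m * norm x" by (intro mult_right_mono divide_left_mono) auto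
    then have "(norm (?e n *\<^sub>R x))\<^sup>2 \<le> (norm (?e m *\<^sub>R x))\<^sup>2" by (intro power_mono) auto
    then show "f m x \<le> f n x" unfolding f_def by (intro mult_left_mono) auto
  qed
  have flim: "AE x in lborel. (\<lambda>m. f m x) \<longlonglongrightarrow> (norm (ft b x))\<^sup>2"
  proof (rule AE_I2)
    fix x :: "real^'n"
    have "(\<lambda>m. f m x) \<longlonglongrightarrow> (norm (ft b x))\<^sup>2 * exp (- (norm ((0::real) *\<^sub>R x))\<^sup>2 / 2)"
      unfolding f_def by (intro tendsto_intros e0) auto
    then show "(\<lambda>m. f m x) \<longlonglongrightarrow> (norm (ft b x))\<^sup>2" by simp
  qed
  have m: "(\<lambda>x. (norm (ft b x))\<^sup>2) \<in> borel_measurable lborel" by simp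
  show "integrable lborel (\<lambda>x. (norm (ft b x))\<^sup>2)"
    by (rule integrable_monotone_convergence[OF fi mono flim lim m])
  show "(LINT x|lborel. (norm (ft b x))\<^sup>2) = (2 * pi) ^ CARD('n) * (LINT k|lborel. (norm (b k))\<^sup>2)"
    by (rule integral_monotone_convergence[OF fi mono flim lim m])
qed

section \<open>Differentiation of Fourier integrals\<close>

lemma cis_remainder: "norm (cis t - 1 - \<i> * complex_of_real t) \<le> t\<^sup>2 / 2"
  using iexp_approx1[of t 1] by (simp add: cis_conv_exp power2_eq_square algebra_simps)

lemma integrable_ft_derivative:
  fixes f :: "'a::euclidean_space \<Rightarrow> complex"
  assumes f: "integrable lborel f" and f2: "integrable lborel (\<lambda>k. (norm k)\<^sup>2 * norm (f k))"
  shows "integrable lborel (\<lambda>k. norm k * norm (f k))"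
    and "integrable lborel (\<lambda>k. \<i> * complex_of_real (k \<bullet> h) * f k * cis (k \<bullet> x))"
proof -
  have [measurable]: "f \<in> borel_measurable borel" using borel_measurable_integrable[OF f] by simp
  show f1: "integrable lborel (\<lambda>k. norm k * norm (f k))"
  proof (rule Bochner_Integration.integrable_bound)
    show "integrable lborel (\<lambda>k. norm (f k) + (norm k)\<^sup>2 * norm (f k))" using f f2 by auto
    have "norm k \<le> 1 + (norm k)\<^sup>2" for k :: 'a
    proof -
      have "2 * norm k \<le> (norm k)\<^sup>2 + 1" using sum_squares_bound[of "norm k" 1] by simp
      then show ?thesis using norm_ge_zero[of k] by linarith
    qed
    then have "norm k * norm (f k) \<le> (1 + (norm k)\<^sup>2) * norm (f k)" for k by (intro mult_right_mono) auto
    then show "AE k in lborel. norm (norm k * norm (f k)) \<le> norm (norm (f k) + (norm k)\<^sup>2 * norm (f k))"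
      by (auto simp: distrib_right)
  qed measurable
  show "integrable lborel (\<lambda>k. \<i> * complex_of_real (k \<bullet> h) * f k * cis (k \<bullet> x))"
  proof (rule Bochner_Integration.integrable_bound)
    show "integrable lborel (\<lambda>k. norm h * (norm k * norm (f k)))" using f1 by auto
    have "\<bar>k \<bullet> h\<bar> * norm (f k) \<le> (norm h * norm k) * norm (f k)" for k
      using Cauchy_Schwarz_ineq2[of k h] by (intro mult_right_mono) (auto simp: mult.commute)
    then show "AE k in lborel. norm (\<i> * complex_of_real (k \<bullet> h) * f k * cis (k \<bullet> x)) \<le> norm (norm h * (norm k * norm (f k)))"
      by (auto simp: norm_mult mult.assoc)
  qed measurable
qed

text \<open>The bound \<open>cis_remainder\<close> with t = k \<bullet> (y - x) is integrated
  against |f|. The finite second moment makes the remainder at most a constant times |y - x|^2,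
  which gives the Frechet derivative directly.\<close>

theorem has_derivative_ft:
  fixes f :: "'a::euclidean_space \<Rightarrow> complex"
  assumes f: "integrable lborel f" and f2: "integrable lborel (\<lambda>k. (norm k)\<^sup>2 * norm (f k))"
  shows "(ft f has_derivative (\<lambda>h. LINT k|lborel. \<i> * complex_of_real (k \<bullet> h) * f k * cis (k \<bullet> x))) (at x)"
proof -
  have [measurable]: "f \<in> borel_measurable borel" using borel_measurable_integrable[OF f] by simp
  let ?K = "LINT k|lborel. (norm k)\<^sup>2 * norm (f k)"
  note f1 = integrable_ft_derivative(1)[OF f f2] and i1 = integrable_ft_derivative(2)[OF f f2, where x=x]
  let ?L = "\<lambda>h. LINT k|lborel. \<i> * complex_of_real (k \<bullet> h) * f k * cis (k \<bullet> x)"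
  have bl: "bounded_linear ?L"
  proof (rule bounded_linear_intro[where K="LINT k|lborel. norm k * norm (f k)"])
    show "?L (h + h') = ?L h + ?L h'" for h h'
      by (subst Bochner_Integration.integral_add[OF i1 i1, symmetric])
         (simp add: inner_add_right algebra_simps)
    show "?L (r *\<^sub>R h) = r *\<^sub>R ?L h" for r h
      by (subst Bochner_Integration.integral_scaleR_right[symmetric])
         (simp add: scaleR_conv_of_real mult_ac)
    fix h
    have "norm (?L h) \<le> (LINT k|lborel. norm h * (norm k * norm (f k)))"
    proof (rule Bochner_Integration.integral_norm_bound_integral[OF i1])
      show "integrable lborel (\<lambda>k. norm h * (norm k * norm (f k)))" using f1 by auto
      fix k
      have "\<bar>k \<bullet> h\<bar> * norm (f k) \<le> (norm h * norm k) * norm (f k)"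
        using Cauchy_Schwarz_ineq2[of k h] by (intro mult_right_mono) (auto simp: mult.commute)
      then show "norm (\<i> * complex_of_real (k \<bullet> h) * f k * cis (k \<bullet> x)) \<le> norm h * (norm k * norm (f k))"
        by (simp add: norm_mult mult.assoc)
    qed
    then show "norm (?L h) \<le> norm h * (LINT k|lborel. norm k * norm (f k))" by simp
  qed
  have rem: "norm (ft f y - ft f x - ?L (y - x)) \<le> ?K * (norm (y - x))\<^sup>2" for y
  proof -
    note iy = integrable_ft[OF f, of y] and ix = integrable_ft[OF f, of x] and il = i1[of "y - x"]
    have "ft f y - ft f x - ?L (y - x) = (LINT k|lborel. f k * cis (k \<bullet> y) - f k * cis (k \<bullet> x) - \<i> * complex_of_real (k \<bullet> (y - x)) * f k * cis (k \<bullet> x))"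
      unfolding ft_def using iy ix il by simp
    also have "norm \<dots> \<le> (LINT k|lborel. (norm (y - x))\<^sup>2 * ((norm k)\<^sup>2 * norm (f k)))"
    proof (rule Bochner_Integration.integral_norm_bound_integral)
      show "integrable lborel (\<lambda>k. f k * cis (k \<bullet> y) - f k * cis (k \<bullet> x) - \<i> * complex_of_real (k \<bullet> (y - x)) * f k * cis (k \<bullet> x))"
        using iy ix il by auto
      show "integrable lborel (\<lambda>k. (norm (y - x))\<^sup>2 * ((norm k)\<^sup>2 * norm (f k)))" using f2 by auto
      fix k
      let ?t = "k \<bullet> (y - x)"
      have "cis (k \<bullet> y) = cis ?t * cis (k \<bullet> x)" by (simp add: cis_mult inner_diff_right)
      then have "f k * cis (k \<bullet> y) - f k * cis (k \<bullet> x) - \<i> * complex_of_real ?t * f k * cis (k \<bullet> x)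
        = f k * cis (k \<bullet> x) * (cis ?t - 1 - \<i> * complex_of_real ?t)" by (simp add: algebra_simps)
      then have "norm (f k * cis (k \<bullet> y) - f k * cis (k \<bullet> x) - \<i> * complex_of_real ?t * f k * cis (k \<bullet> x))
        \<le> norm (f k) * (?t\<^sup>2 / 2)"
        by (simp only: norm_mult norm_cis mult_1_right) (intro mult_left_mono cis_remainder norm_ge_zero)
      also have "\<dots> \<le> norm (f k) * (norm k * norm (y - x))\<^sup>2"
      proof (rule mult_left_mono)
        have "?t\<^sup>2 \<le> (norm k * norm (y - x))\<^sup>2"
          using Cauchy_Schwarz_ineq2[of k "y - x"] power_mono[of "\<bar>?t\<bar>" "norm k * norm (y - x)" 2] by simp
        then show "?t\<^sup>2 / 2 \<le> (norm k * norm (y - x))\<^sup>2" using zero_le_power2[of ?t] by linarith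
      qed simp
      finally show "norm (f k * cis (k \<bullet> y) - f k * cis (k \<bullet> x) - \<i> * complex_of_real ?t * f k * cis (k \<bullet> x))
        \<le> (norm (y - x))\<^sup>2 * ((norm k)\<^sup>2 * norm (f k))" by (simp add: power_mult_distrib mult_ac)
    qed
    finally show ?thesis using f2 by (simp add: mult.commute)
  qed
  show ?thesis unfolding has_derivative_iff_norm
  proof (intro conjI bl)
    show "((\<lambda>y. norm (ft f y - ft f x - ?L (y - x)) / norm (y - x)) \<longlongrightarrow> 0) (at x)"
    proof (rule Lim_null_comparison)
      show "eventually (\<lambda>y. norm (norm (ft f y - ft f x - ?L (y - x)) / norm (y - x)) \<le> ?K * norm (y - x)) (at x)"
      proof (rule always_eventually, rule allI)
        fix y show "norm (norm (ft f y - ft f x - ?L (y - x)) / norm (y - x)) \<le> ?K * norm (y - x)"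
          using rem[of y] by (cases "y = x") (auto simp: divide_le_eq power2_eq_square mult_ac)
      qed
      have "((\<lambda>y. ?K * norm (y - x)) \<longlongrightarrow> ?K * norm (x - x)) (at x)" by (intro tendsto_intros)
      then show "((\<lambda>y. ?K * norm (y - x)) \<longlongrightarrow> 0) (at x)" by simp
    qed
  qed
qed

section \<open>The magnetic field and its energy\<close>

text \<open>Of the three powers of 1 + x^2, two make a function of |k| integrable on three-space and
  one pays for the second moment. Expanding leaves the even monomials 1, x^2, x^4, x^6, for which
  |x^a f| = x^a |f|.\<close>

lemma schwartz_real_decay:
  assumes "schwartz_real f"
  shows "continuous_on UNIV f" and "\<exists>K. \<forall>x. \<bar>f x\<bar> * (1 + x\<^sup>2) ^ 3 \<le> K"
proof -
  have "f differentiable (at x)" for x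
    using assms unfolding schwartz_real_def by (metis funpow_0)
  then show "continuous_on UNIV f"
    by (intro continuous_at_imp_continuous_on ballI differentiable_imp_continuous_within)
  have "bounded (range (\<lambda>x. x ^ a * f x))" for a
    using assms unfolding schwartz_real_def by (metis funpow_0)
  then have "\<exists>C. \<forall>x. \<bar>x ^ a * f x\<bar> \<le> C" for a
    unfolding bounded_iff by auto
  then obtain C where C: "\<And>a x. \<bar>x ^ a * f x\<bar> \<le> C a" by metis
  have "\<bar>f x\<bar> * (1 + x\<^sup>2) ^ 3 \<le> C 0 + 3 * C 2 + 3 * C 4 + C 6" for x
  proof -
    have "(1 + x\<^sup>2) ^ 3 = 1 + 3 * x ^ 2 + 3 * x ^ 4 + x ^ 6"
      by (simp add: eval_nat_numeral algebra_simps)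
    moreover have "\<bar>x ^ a * f x\<bar> = x ^ a * \<bar>f x\<bar>" if "even a" for a
      using that by (simp add: abs_mult zero_le_even_power)
    ultimately have "\<bar>f x\<bar> * (1 + x\<^sup>2) ^ 3 = \<bar>x ^ 0 * f x\<bar> + 3 * \<bar>x ^ 2 * f x\<bar> + 3 * \<bar>x ^ 4 * f x\<bar> + \<bar>x ^ 6 * f x\<bar>"
      by (simp add: algebra_simps)
    then show ?thesis using C[of x 0] C[of x 2] C[of x 4] C[of x 6] by linarith
  qed
  then show "\<exists>K. \<forall>x. \<bar>f x\<bar> * (1 + x\<^sup>2) ^ 3 \<le> K" by blast
qed

lemma schwartz_decay:
  assumes "schwartz \<phi>"
  shows "continuous_on UNIV \<phi>" and "\<exists>K. \<forall>x. norm (\<phi> x) * (1 + x\<^sup>2) ^ 3 \<le> K"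
proof -
  have R: "schwartz_real (\<lambda>x. Re (\<phi> x))" and I: "schwartz_real (\<lambda>x. Im (\<phi> x))" using assms by (auto simp: schwartz_def)
  have "continuous_on UNIV (\<lambda>x. Complex (Re (\<phi> x)) (Im (\<phi> x)))"
    using schwartz_real_decay(1)[OF R] schwartz_real_decay(1)[OF I] by (simp add: Complex_eq continuous_intros)
  then show "continuous_on UNIV \<phi>" by simp
  obtain K1 where K1: "\<And>x. \<bar>Re (\<phi> x)\<bar> * (1 + x\<^sup>2) ^ 3 \<le> K1" using schwartz_real_decay(2)[OF R] by blast
  obtain K2 where K2: "\<And>x. \<bar>Im (\<phi> x)\<bar> * (1 + x\<^sup>2) ^ 3 \<le> K2" using schwartz_real_decay(2)[OF I] by blast
  have "norm (\<phi> x) * (1 + x\<^sup>2) ^ 3 \<le> K1 + K2" for x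
  proof -
    have "norm (\<phi> x) * (1 + x\<^sup>2) ^ 3 \<le> (\<bar>Re (\<phi> x)\<bar> + \<bar>Im (\<phi> x)\<bar>) * (1 + x\<^sup>2) ^ 3"
      by (intro mult_right_mono cmod_le) simp
    then show ?thesis using K1[of x] K2[of x] by (simp add: distrib_right)
  qed
  then show "\<exists>K. \<forall>x. norm (\<phi> x) * (1 + x\<^sup>2) ^ 3 \<le> K" by blast
qed

lemma schwartz_bounded:
  assumes "schwartz \<phi>"
  shows "\<exists>K. \<forall>x. norm (\<phi> x) \<le> K"
proof -
  obtain K where K: "\<And>x. norm (\<phi> x) * (1 + x\<^sup>2) ^ 3 \<le> K" using schwartz_decay(2)[OF assms] by blast
  have "norm (\<phi> x) \<le> K" for x
  proof -
    have "norm (\<phi> x) * 1 \<le> norm (\<phi> x) * (1 + x\<^sup>2) ^ 3" by (intro mult_left_mono one_le_power) auto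
    then show ?thesis using K[of x] by simp
  qed
  then show ?thesis by blast
qed

text \<open>The amplitudes to be transformed are bounded multiples of \<phi>(|k|); the two
  conclusions are the hypotheses of \<open>has_derivative_ft\<close>.\<close>

lemma schwartz_dominated:
  fixes h :: "real^3 \<Rightarrow> complex"
  assumes \<phi>: "schwartz \<phi>" and hm [measurable]: "h \<in> borel_measurable borel" and h: "\<And>k. norm (h k) \<le> C * norm (\<phi> (norm k))"
  shows "integrable lborel h" and "integrable lborel (\<lambda>k. (norm k)\<^sup>2 * norm (h k))"
proof -
  obtain K where K: "\<And>x. norm (\<phi> x) * (1 + x\<^sup>2) ^ 3 \<le> K" using schwartz_decay(2)[OF \<phi>] by blast
  define W where "W k = (\<bar>C\<bar> * K) * (1 / (1 + (norm k)\<^sup>2)\<^sup>2)" for k :: "real^3"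
  have W: "integrable lborel W" unfolding W_def by (intro integrable_mult_right integrable_japanese)
  have b: "(1 + (norm k)\<^sup>2) * norm (h k) \<le> W k" for k
  proof -
    let ?q = "1 + (norm k)\<^sup>2"
    have q: "?q > 0" by (auto intro!: add_pos_nonneg)
    have "norm (h k) \<le> \<bar>C\<bar> * norm (\<phi> (norm k))"
      by (rule order_trans[OF h]) (auto intro: mult_right_mono)
    then have "?q ^ 3 * norm (h k) \<le> ?q ^ 3 * (\<bar>C\<bar> * norm (\<phi> (norm k)))" using q by (intro mult_left_mono) auto
    also have "\<dots> = \<bar>C\<bar> * (norm (\<phi> (norm k)) * ?q ^ 3)" by (simp only: mult_ac)
    also have "\<dots> \<le> \<bar>C\<bar> * K" by (intro mult_left_mono K) auto
    finally have "(?q * norm (h k)) * ?q\<^sup>2 \<le> \<bar>C\<bar> * K" by (simp only: power3_eq_cube power2_eq_square mult_ac)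
    then show ?thesis using q by (simp add: W_def pos_le_divide_eq)
  qed
  show "integrable lborel h"
  proof (rule Bochner_Integration.integrable_bound[OF W])
    have "norm (h k) \<le> W k" for k
      using b[of k] mult_right_mono[of 1 "1 + (norm k)\<^sup>2" "norm (h k)"] by simp
    then show "AE k in lborel. norm (h k) \<le> norm (W k)"
      by (intro AE_I2) (simp add: order_trans[OF _ abs_ge_self])
  qed measurable
  show "integrable lborel (\<lambda>k. (norm k)\<^sup>2 * norm (h k))"
  proof (rule Bochner_Integration.integrable_bound[OF W])
    have "(norm k)\<^sup>2 * norm (h k) \<le> W k" for k
      using b[of k] norm_ge_zero[of "h k"] unfolding distrib_right mult_1 by linarith
    then show "AE k in lborel. norm ((norm k)\<^sup>2 * norm (h k)) \<le> norm (W k)"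
      by (intro AE_I2) (simp add: order_trans[OF _ abs_ge_self])
  qed measurable
qed

section \<open>Pauli operators\<close>

lemma pauli_hermitian: "cnj (pauli m a b) = pauli m b a"
  by (simp add: pauli_def)

text \<open>The involution exchanging the summed index b with entry l of s swaps the row and column
  index of the Pauli matrix, and Hermiticity accounts for the conjugate. \<open>l < P\<close>
  ensures that \<open>s[l := b]\<close> really stores b.\<close>

lemma pauli_on_selfadjoint:
  assumes l: "l < P"
  shows "(\<Sum>s\<in>cfg P. pauli_on m l Y s * cnj (X s)) = (\<Sum>s\<in>cfg P. Y s * cnj (pauli_on m l X s))"
proof -
  let ?f = "\<lambda>(s, b). (s[l := b], s ! l) :: bool list \<times> bool"
  have "(\<Sum>s\<in>cfg P. pauli_on m l Y s * cnj (X s)) = (\<Sum>(s, b)\<in>cfg P \<times> UNIV. pauli m (s ! l) b * Y (s[l := b]) * cnj (X s))"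
    unfolding pauli_on_def by (simp add: sum_distrib_right sum.cartesian_product)
  also have "\<dots> = (\<Sum>(s, b)\<in>cfg P \<times> UNIV. Y s * cnj (pauli m (s ! l) b * X (s[l := b])))"
    by (rule sum.reindex_bij_witness[where i="?f" and j="?f"])
       (use l in \<open>auto simp: cfg_def pauli_hermitian list_update_beyond mult_ac\<close>)
  also have "\<dots> = (\<Sum>s\<in>cfg P. Y s * cnj (pauli_on m l X s))"
    unfolding pauli_on_def by (simp add: sum_distrib_left sum.cartesian_product)
  finally show ?thesis .
qed

text \<open>The sum S(k) of the overview for one spin configuration s, with
  \<open>v l = pauli_vec l X s\<close>. Spin enters the field only through these constant vectors,
  so they are kept arbitrary.\<close>

definition spin_source :: "(nat \<Rightarrow> real^3) \<Rightarrow> (nat \<Rightarrow> real) \<Rightarrow> nat \<Rightarrow> (nat \<Rightarrow> complex^3) \<Rightarrow> real^3 \<Rightarrow> complex^3" where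
  "spin_source xs M P v k = (\<Sum>l<P. (complex_of_real (M l) * cis (- (k \<bullet> xs l))) *s v l)"

definition cvec :: "real^3 \<Rightarrow> complex^3" where
  "cvec k = (\<chi> i. complex_of_real (k $ i))"

text \<open>Equals \<open>-\<phi>(|k|) k \<times> (k \<times> S(k)) / |k|\<^sup>2\<close> except at the origin, where the division by zero
  leaves \<open>\<phi>(0) S(0)\<close>.\<close>

definition ft_field :: "(real \<Rightarrow> complex) \<Rightarrow> (real^3 \<Rightarrow> complex^3) \<Rightarrow> 3 \<Rightarrow> real^3 \<Rightarrow> complex" where
  "ft_field \<phi> S i k = \<phi> (norm k) * (S k $ i - complex_of_real (k $ i) * (\<Sum>j\<in>UNIV. complex_of_real (k $ j) * S k $ j) / complex_of_real ((norm k)\<^sup>2))"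

section \<open>Size, algebra and continuity of the transverse amplitude\<close>

lemma power2_norm_vec3: "(norm (x::real^3))\<^sup>2 = (x $ 1)\<^sup>2 + (x $ 2)\<^sup>2 + (x $ 3)\<^sup>2"
  unfolding power2_norm_eq_inner inner_vec_def by (simp add: sum_3 power2_eq_square)

lemma power2_norm_cvec: "(norm (x::complex^'n::finite))\<^sup>2 = (\<Sum>i\<in>UNIV. (norm (x $ i))\<^sup>2)"
  by (simp add: norm_vec_def L2_set_def sum_nonneg)

lemma continuous_spin_source: "continuous_on UNIV (\<lambda>k. spin_source xs M P v k $ i)"
  unfolding spin_source_def cis_conv_exp by (simp add: continuous_intros)

lemma norm_spin_source_le: "norm (spin_source xs M P v k $ i) \<le> (\<Sum>l<P. \<bar>M l\<bar> * norm (v l))"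
  unfolding spin_source_def sum_component
proof (rule sum_norm_le)
  fix l
  have "norm (v l $ i) \<le> norm (v l)" by (rule Finite_Cartesian_Product.norm_nth_le)
  then show "norm (((complex_of_real (M l) * cis (- (k \<bullet> xs l))) *s v l) $ i) \<le> \<bar>M l\<bar> * norm (v l)"
    by (simp add: norm_mult mult_left_mono)
qed

text \<open>C bounds S_i itself and 3 C its projection along k, since |k_i| \<le> |k| and |k
  \<bullet> S| \<le> 3 |k| C. At k = 0 the quotient is 0 by division by zero.\<close>

lemma norm_ft_field_le:
  assumes S: "\<And>j. norm (S k $ j) \<le> C"
  shows "norm (ft_field \<phi> S i k) \<le> (4 * C) * norm (\<phi> (norm k))"
proof -
  have "norm (complex_of_real (k $ i) * (\<Sum>j\<in>UNIV. complex_of_real (k $ j) * S k $ j) / complex_of_real ((norm k)\<^sup>2)) \<le> 3 * C"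
  proof (cases "k = 0")
    case True
    then show ?thesis using order_trans[OF norm_ge_zero S[of i]] by simp
  next
    case False
    have "norm (\<Sum>j\<in>UNIV. complex_of_real (k $ j) * S k $ j) \<le> (\<Sum>j\<in>(UNIV::3 set). norm k * C)"
    proof (rule sum_norm_le)
      fix j show "norm (complex_of_real (k $ j) * S k $ j) \<le> norm k * C"
        unfolding norm_mult norm_of_real using component_le_norm_cart[of k j] by (intro mult_mono S) auto
    qed
    then have "norm (complex_of_real (k $ i)) * norm (\<Sum>j\<in>UNIV. complex_of_real (k $ j) * S k $ j) \<le> norm k * (3 * (norm k * C))"
      using component_le_norm_cart[of k i] by (intro mult_mono) auto
    then have "norm (complex_of_real (k $ i)) * norm (\<Sum>j\<in>UNIV. complex_of_real (k $ j) * S k $ j) \<le> (3 * C) * (norm k)\<^sup>2"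
      by (simp only: power2_eq_square mult_ac)
    then show ?thesis using False by (simp add: norm_divide norm_mult norm_power pos_divide_le_eq)
  qed
  then have "norm (S k $ i - complex_of_real (k $ i) * (\<Sum>j\<in>UNIV. complex_of_real (k $ j) * S k $ j) / complex_of_real ((norm k)\<^sup>2)) \<le> 4 * C"
    using S[of i] norm_triangle_ineq4[of "S k $ i" "complex_of_real (k $ i) * (\<Sum>j\<in>UNIV. complex_of_real (k $ j) * S k $ j) / complex_of_real ((norm k)\<^sup>2)"]
    by linarith
  then show ?thesis unfolding ft_field_def norm_mult
    by (simp only: mult.commute[of "norm (\<phi> (norm k))"]) (rule mult_right_mono, auto)
qed

text \<open>Orthogonality to k is what makes the transformed field divergence-free. At k = 0 it
  holds because the coefficients k_j vanish.\<close>

lemma ft_field_transverse: "(\<Sum>j\<in>UNIV. complex_of_real (k $ j) * ft_field \<phi> S j k) = 0"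
proof (cases "k = 0")
  case False
  let ?T = "\<Sum>j\<in>UNIV. complex_of_real (k $ j) * S k $ j"
  have n: "complex_of_real ((norm k)\<^sup>2) = (\<Sum>j\<in>UNIV. complex_of_real (k $ j) * complex_of_real (k $ j))"
    unfolding power2_norm_vec3 by (simp add: sum_3 power2_eq_square)
  define t where "t = ?T / complex_of_real ((norm k)\<^sup>2)"
  have "ft_field \<phi> S j k = \<phi> (norm k) * (S k $ j - complex_of_real (k $ j) * t)" for j
    by (simp only: ft_field_def t_def times_divide_eq_right)
  note F = this
  have "(\<Sum>j\<in>UNIV. complex_of_real (k $ j) * ft_field \<phi> S j k)
    = \<phi> (norm k) * (?T - (\<Sum>j\<in>UNIV. complex_of_real (k $ j) * complex_of_real (k $ j)) * t)"
    unfolding sum_3 F by (simp add: algebra_simps)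
  also have "\<dots> = 0" unfolding n[symmetric] t_def using False by simp
  finally show ?thesis .
qed simp

text \<open>The subtracted part is parallel to k and drops out of the antisymmetrised product, so
  the curl of the transformed field sees only \<phi> S.\<close>

lemma ft_field_curl: "complex_of_real (k $ a) * ft_field \<phi> S b k - complex_of_real (k $ b) * ft_field \<phi> S a k
  = \<phi> (norm k) * (complex_of_real (k $ a) * S k $ b - complex_of_real (k $ b) * S k $ a)"
  unfolding ft_field_def by (simp add: algebra_simps)

text \<open>Removing the component along k leaves |S|^2 - |k \<bullet> S|^2 / |k|^2, and Lagrange's
  identity turns |k|^2 |S|^2 - |k \<bullet> S|^2 into |k \<times> S|^2. As k is real, the real and
  imaginary parts of S separate, so the identity is proved for a real vector u.\<close>

lemma lagrange_identity:
  fixes S :: "complex^3"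
  assumes "k \<noteq> 0"
  shows "(\<Sum>i\<in>UNIV. (norm (S $ i - complex_of_real (k $ i) * (\<Sum>j\<in>UNIV. complex_of_real (k $ j) * S $ j) / complex_of_real ((norm k)\<^sup>2)))\<^sup>2)
    = (norm (ccross (cvec k) S))\<^sup>2 / (norm k)\<^sup>2"
proof -
  have re: "(\<Sum>i\<in>UNIV. (u i - k $ i * (\<Sum>j\<in>UNIV. k $ j * u j) / q)\<^sup>2)
     = ((k $ 2 * u 3 - k $ 3 * u 2)\<^sup>2 + (k $ 3 * u 1 - k $ 1 * u 3)\<^sup>2 + (k $ 1 * u 2 - k $ 2 * u 1)\<^sup>2) / q"
    if q: "q = (norm k)\<^sup>2" for q and u :: "3 \<Rightarrow> real"
  proof -
    have q0: "q \<noteq> 0" using assms q by simp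
    have q3: "q = (k $ 1)\<^sup>2 + (k $ 2)\<^sup>2 + (k $ 3)\<^sup>2" unfolding q by (rule power2_norm_vec3)
    define T where "T = k $ 1 * u 1 + k $ 2 * u 2 + k $ 3 * u 3"
    define t where "t = T / q"
    have qt: "q * t = T" using q0 by (simp add: t_def)
    have "(\<Sum>i\<in>UNIV. (u i - k $ i * (\<Sum>j\<in>UNIV. k $ j * u j) / q)\<^sup>2) = (\<Sum>i\<in>UNIV. (u i - k $ i * t)\<^sup>2)"
      by (simp add: t_def T_def sum_3)
    also have "\<dots> = (u 1)\<^sup>2 + (u 2)\<^sup>2 + (u 3)\<^sup>2 - 2 * T * t + ((k $ 1)\<^sup>2 + (k $ 2)\<^sup>2 + (k $ 3)\<^sup>2) * t * t"
      unfolding sum_3 T_def by (simp add: power2_eq_square algebra_simps)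
    also have "\<dots> = ((u 1)\<^sup>2 + (u 2)\<^sup>2 + (u 3)\<^sup>2) - T * t"
      unfolding q3[symmetric] qt by simp
    also have "\<dots> = (q * ((u 1)\<^sup>2 + (u 2)\<^sup>2 + (u 3)\<^sup>2) - T\<^sup>2) / q"
      using q0 by (simp add: diff_divide_distrib t_def power2_eq_square)
    also have "q * ((u 1)\<^sup>2 + (u 2)\<^sup>2 + (u 3)\<^sup>2) - T\<^sup>2 = (k $ 2 * u 3 - k $ 3 * u 2)\<^sup>2 + (k $ 3 * u 1 - k $ 1 * u 3)\<^sup>2 + (k $ 1 * u 2 - k $ 2 * u 1)\<^sup>2"
      unfolding q3 T_def by (simp add: power2_eq_square algebra_simps)
    finally show ?thesis .
  qed
  have "(norm (S $ i - complex_of_real (k $ i) * (\<Sum>j\<in>UNIV. complex_of_real (k $ j) * S $ j) / complex_of_real ((norm k)\<^sup>2)))\<^sup>2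
    = (Re (S $ i) - k $ i * (\<Sum>j\<in>UNIV. k $ j * Re (S $ j)) / (norm k)\<^sup>2)\<^sup>2 + (Im (S $ i) - k $ i * (\<Sum>j\<in>UNIV. k $ j * Im (S $ j)) / (norm k)\<^sup>2)\<^sup>2" for i
    unfolding cmod_power2 by (simp flip: of_real_power)
  then have "(\<Sum>i\<in>UNIV. (norm (S $ i - complex_of_real (k $ i) * (\<Sum>j\<in>UNIV. complex_of_real (k $ j) * S $ j) / complex_of_real ((norm k)\<^sup>2)))\<^sup>2)
    = (\<Sum>i\<in>UNIV. (Re (S $ i) - k $ i * (\<Sum>j\<in>UNIV. k $ j * Re (S $ j)) / (norm k)\<^sup>2)\<^sup>2)
      + (\<Sum>i\<in>UNIV. (Im (S $ i) - k $ i * (\<Sum>j\<in>UNIV. k $ j * Im (S $ j)) / (norm k)\<^sup>2)\<^sup>2)"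
    by (simp add: sum.distrib)
  also have "\<dots> = (norm (ccross (cvec k) S))\<^sup>2 / (norm k)\<^sup>2"
    unfolding re[OF refl, of "\<lambda>j. Re (S $ j)"] re[OF refl, of "\<lambda>j. Im (S $ j)"]
    unfolding power2_norm_cvec sum_3 cmod_power2
    by (simp add: ccross_def cvec_def add_divide_distrib)
  finally show ?thesis .
qed

lemma power2_norm_ft_field:
  assumes "k \<noteq> 0"
  shows "(\<Sum>i\<in>UNIV. (norm (ft_field \<phi> S i k))\<^sup>2) = (norm (\<phi> (norm k)))\<^sup>2 * (norm (ccross (cvec k) (S k)))\<^sup>2 / (norm k)\<^sup>2"
  using lagrange_identity[OF assms, of "S k"]
  by (simp only: ft_field_def norm_mult power_mult_distrib sum_distrib_left[symmetric] times_divide_eq_right)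

lemma continuous_radial: "continuous_on UNIV \<phi> \<Longrightarrow> continuous_on UNIV (\<lambda>k::real^3. \<phi> (norm k))"
  by (rule continuous_on_compose2[of UNIV \<phi>]) (auto intro!: continuous_intros)

lemma isCont_ft_field:
  assumes \<phi>: "continuous_on UNIV \<phi>" and S: "\<And>j. continuous_on UNIV (\<lambda>k. S k $ j)" and "k \<noteq> 0"
  shows "isCont (ft_field \<phi> S i) k"
proof -
  have "isCont (\<lambda>k. S k $ j) k" for j using S by (simp add: continuous_on_eq_continuous_at)
  then have "isCont S k" unfolding isCont_def by (intro vec_tendstoI)
  moreover have "isCont (\<lambda>k::real^3. \<phi> (norm k)) k" using continuous_radial[OF \<phi>] by (simp add: continuous_on_eq_continuous_at)
  ultimately show ?thesis using assms(3) unfolding ft_field_def[abs_def] by (intro continuous_intros) auto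
qed

lemma measurable_ft_field:
  assumes \<phi>: "continuous_on UNIV \<phi>" and S: "\<And>j. continuous_on UNIV (\<lambda>k. S k $ j)"
  shows "ft_field \<phi> S i \<in> borel_measurable borel"
proof -
  have [measurable]: "(\<lambda>k. S k $ j) \<in> borel_measurable borel" for j using S by (rule borel_measurable_continuous_onI)
  have [measurable]: "(\<lambda>k::real^3. \<phi> (norm k)) \<in> borel_measurable borel" using continuous_radial[OF \<phi>] by (rule borel_measurable_continuous_onI)
  have [measurable]: "(\<lambda>k::real^3. complex_of_real (k $ j)) \<in> borel_measurable borel" for j
    by (intro borel_measurable_continuous_onI continuous_intros)
  have [measurable]: "(\<lambda>k::real^3. complex_of_real ((norm k)\<^sup>2)) \<in> borel_measurable borel"
    by (intro borel_measurable_continuous_onI continuous_intros)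
  show ?thesis unfolding ft_field_def[abs_def] by measurable
qed

lemma ft_field_L2:
  fixes xs :: "nat \<Rightarrow> real^3" and M :: "nat \<Rightarrow> real" and P :: nat and v :: "nat \<Rightarrow> complex^3"
  assumes \<phi>: "schwartz \<phi>"
  defines "b \<equiv> ft_field \<phi> (spin_source xs M P v)"
  shows "integrable lborel (\<lambda>x. (norm (ft (b i) x))\<^sup>2)"
    and "(LINT x|lborel. (norm (ft (b i) x))\<^sup>2) = (2 * pi) ^ 3 * (LINT k|lborel. (norm (b i k))\<^sup>2)"
    and "integrable lborel (\<lambda>k. (norm (b i k))\<^sup>2)"
proof -
  note c = schwartz_decay(1)[OF \<phi>]
  let ?C = "4 * (\<Sum>l<P. \<bar>M l\<bar> * norm (v l))"
  obtain K where K: "\<And>x. norm (\<phi> x) \<le> K" using schwartz_bounded[OF \<phi>] by blast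
  have C0: "?C \<ge> 0" by (intro mult_nonneg_nonneg sum_nonneg) auto
  have mb: "b i \<in> borel_measurable borel" unfolding b_def by (rule measurable_ft_field[OF c continuous_spin_source])
  have bb: "norm (b i k) \<le> ?C * norm (\<phi> (norm k))" for k
    unfolding b_def by (rule norm_ft_field_le) (rule norm_spin_source_le)
  have ib: "integrable lborel (b i)" by (rule schwartz_dominated(1)[OF \<phi> mb bb])
  define Q where "Q = ?C * K"
  have bK: "norm (b i k) \<le> Q" for k
    unfolding Q_def by (rule order_trans[OF bb]) (intro mult_left_mono K C0)
  \<comment> \<open>In general the amplitude is discontinuous at the origin, which is a null
    set.\<close>
  have "AE k in lborel. k \<noteq> (0 :: real^3)" by (rule AE_lborel_singleton)
  then have cont: "AE k in lborel. isCont (b i) k"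
    by eventually_elim (auto simp: b_def intro: isCont_ft_field[OF c continuous_spin_source])
  show "integrable lborel (\<lambda>x. (norm (ft (b i) x))\<^sup>2)"
    by (rule plancherel_ft(1)[OF ib bK cont])
  show "(LINT x|lborel. (norm (ft (b i) x))\<^sup>2) = (2 * pi) ^ 3 * (LINT k|lborel. (norm (b i k))\<^sup>2)"
    using plancherel_ft(2)[OF ib bK cont] by simp
  show "integrable lborel (\<lambda>k. (norm (b i k))\<^sup>2)"
  proof (rule Bochner_Integration.integrable_bound)
    show "integrable lborel (\<lambda>k. Q * norm (b i k))" using ib by auto
    show "(\<lambda>k. (norm (b i k))\<^sup>2) \<in> borel_measurable lborel" using mb by simp
    have "norm (b i k) * norm (b i k) \<le> Q * norm (b i k)" for k by (intro mult_right_mono bK) auto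
    then show "AE k in lborel. norm ((norm (b i k))\<^sup>2) \<le> norm (Q * norm (b i k))"
      by (intro AE_I2) (simp add: power2_eq_square order_trans[OF _ abs_ge_self])
  qed
qed

section \<open>The one-photon state and its energy\<close>

lemma cross3_axis:
  fixes w :: "complex^3"
  shows "(\<Sum>m\<in>UNIV. w $ m * complex_of_real (cross3 k (axis m 1) $ j)) = ccross (cvec k) w $ j"
  using exhaust_3[of j] by (auto simp: sum_3 cross3_def ccross_def cvec_def axis_def)

lemma abs_cross3_axis_le: "\<bar>cross3 k (axis m 1) $ j\<bar> \<le> norm k"
  using exhaust_3[of j] exhaust_3[of m] component_le_norm_cart[of k 1] component_le_norm_cart[of k 2] component_le_norm_cart[of k 3]
  by (auto simp: cross3_def axis_def)

lemma ccross_sum: "ccross a (\<Sum>l\<in>A. c l *s v l) $ j = (\<Sum>l\<in>A. c l * ccross a (v l) $ j)"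
  using exhaust_3[of j] by (auto simp: ccross_def sum_distrib_left sum_subtractf[symmetric] algebra_simps)

lemma Bcoup_component:
  "Bcoup \<phi> m y k $ j = (\<i> * \<phi> (norm k) * complex_of_real (sqrt (norm k) / ((2 * pi) powr (3/2)))) * cis (- (k \<bullet> y))
     * complex_of_real (cross3 k (axis m 1) $ j) / complex_of_real (norm k)"
  unfolding Bcoup_def by simp

text \<open>By linearity of the cross product the sum over m of (k \<times> e_m) \<sigma>_m is k
  \<times> \<sigma>, and the phases and moments of the sites combine to \<open>spin_source\<close>.
  The state is thus a scalar multiple of k \<times> S(k).\<close>

lemma HintE_component:
  "HintE \<phi> xs M P X k s $ j = (complex_of_real (1 / sqrt 2) * (\<i> * \<phi> (norm k) * complex_of_real (sqrt (norm k) / ((2 * pi) powr (3/2)))) / complex_of_real (norm k))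
     * ccross (cvec k) (spin_source xs M P (\<lambda>l. pauli_vec l X s) k) $ j"
proof -
  define q where "q = \<i> * \<phi> (norm k) * complex_of_real (sqrt (norm k) / ((2 * pi) powr (3/2)))"
  define n where "n = complex_of_real (norm k)"
  have "HintE \<phi> xs M P X k s $ j = (\<Sum>l<P. \<Sum>m\<in>UNIV. (complex_of_real (M l / sqrt 2) * pauli_on m l X s) * Bcoup \<phi> m (xs l) k $ j)"
    unfolding HintE_def by simp
  also have "\<dots> = (\<Sum>l<P. (complex_of_real (1 / sqrt 2) * q / n) * ((complex_of_real (M l) * cis (- (k \<bullet> xs l))) * (\<Sum>m\<in>UNIV. pauli_vec l X s $ m * complex_of_real (cross3 k (axis m 1) $ j))))"
    unfolding sum_distrib_left Bcoup_component q_def[symmetric] n_def[symmetric]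
    by (intro sum.cong refl) (simp add: pauli_vec_def)
  also have "\<dots> = (complex_of_real (1 / sqrt 2) * q / n) * ccross (cvec k) (spin_source xs M P (\<lambda>l. pauli_vec l X s) k) $ j"
    unfolding cross3_axis spin_source_def ccross_sum sum_distrib_left by (simp add: mult_ac)
  finally show ?thesis unfolding q_def n_def .
qed

text \<open>The square of sqrt |k| cancels the 1/|k| of the inverse photon energy, the denominator
  of (k \<times> e_m)/|k| leaves |k|^(-2), the 1/2 is due to the Segal field and (2 pi)^(-3) to the
  coupling. At k = 0 both sides are 0 by division by zero.\<close>

lemma HintE_energy:
  "(norm (HintE \<phi> xs M P X k s))\<^sup>2 / norm k
    = 1/2 * (2 * pi) powr (-3) * ((norm (\<phi> (norm k)))\<^sup>2 * (norm (ccross (cvec k) (spin_source xs M P (\<lambda>l. pauli_vec l X s) k)))\<^sup>2 / (norm k)\<^sup>2)"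
proof -
  let ?c = "ccross (cvec k) (spin_source xs M P (\<lambda>l. pauli_vec l X s) k)"
  have p: "((2 * pi) powr (3/2))\<^sup>2 = 1 / (2 * pi) powr (-3)"
  proof -
    have "((2 * pi) powr (3/2))\<^sup>2 = (2 * pi) powr (3/2 + 3/2)" by (simp only: power2_eq_square powr_add)
    then show ?thesis using powr_minus_divide[of "2 * pi" 3] by simp
  qed
  have "(norm (HintE \<phi> xs M P X k s $ j))\<^sup>2 = 1/2 * (norm (\<phi> (norm k)))\<^sup>2 * (norm k * (2 * pi) powr (-3)) / (norm k)\<^sup>2 * (norm (?c $ j))\<^sup>2" for j
    unfolding HintE_component norm_mult norm_divide norm_of_real power_mult_distrib power_divide abs_divide power2_abs p
    by (simp add: p)
  then have "(norm (HintE \<phi> xs M P X k s))\<^sup>2 = 1/2 * (norm (\<phi> (norm k)))\<^sup>2 * (norm k * (2 * pi) powr (-3)) / (norm k)\<^sup>2 * (norm ?c)\<^sup>2"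
    unfolding power2_norm_cvec by (simp only: sum_distrib_left)
  then show ?thesis by (cases "k = 0") (simp_all add: power2_eq_square mult_ac)
qed

lemma norm_Bcoup_le: "norm (Bcoup \<phi> m y k $ j) \<le> norm (\<phi> (norm k)) * (sqrt (norm k) / ((2 * pi) powr (3/2)))"
proof -
  have "\<bar>cross3 k (axis m 1) $ j\<bar> / norm k \<le> 1"
    using abs_cross3_axis_le[of k m j] by (cases "k = 0") (auto simp: divide_le_eq)
  then have "norm (\<phi> (norm k)) * (sqrt (norm k) / ((2 * pi) powr (3/2))) * (\<bar>cross3 k (axis m 1) $ j\<bar> / norm k)
    \<le> norm (\<phi> (norm k)) * (sqrt (norm k) / ((2 * pi) powr (3/2))) * 1"
    by (intro mult_left_mono) auto
  then show ?thesis unfolding Bcoup_component by (simp add: norm_mult norm_divide)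
qed

lemma measurable_Bcoup:
  assumes "continuous_on UNIV \<phi>"
  shows "(\<lambda>k. Bcoup \<phi> m y k $ j) \<in> borel_measurable borel"
proof -
  have [measurable]: "(\<lambda>k::real^3. \<phi> (norm k)) \<in> borel_measurable borel" using continuous_radial[OF assms] by (rule borel_measurable_continuous_onI)
  have [measurable]: "(\<lambda>k::real^3. complex_of_real (sqrt (norm k) / (2 * pi) powr (3/2))) \<in> borel_measurable borel"
    by (intro borel_measurable_continuous_onI continuous_intros) auto
  have [measurable]: "(\<lambda>k::real^3. complex_of_real (norm k)) \<in> borel_measurable borel"
    by (intro borel_measurable_continuous_onI continuous_intros)
  have "continuous_on UNIV (\<lambda>k::real^3. complex_of_real (cross3 k (axis m 1) $ j))"
    using exhaust_3[of j] by (elim disjE) (simp_all add: cross3_def, (intro continuous_intros)+)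
  then have [measurable]: "(\<lambda>k::real^3. complex_of_real (cross3 k (axis m 1) $ j)) \<in> borel_measurable borel"
    by (rule borel_measurable_continuous_onI)
  show ?thesis unfolding Bcoup_component by measurable
qed

text \<open>The inverse photon energy 1/|k| is absorbed by the two factors sqrt |k| of the
  couplings. No infrared singularity remains: the product is at most a constant times |\<phi>|^2,
  hence a constant times |\<phi>|.\<close>

lemma integrable_Bcoup_product:
  assumes \<phi>: "schwartz \<phi>"
  shows "integrable lborel (\<lambda>k. cnj (Bcoup \<phi> m y k $ j) * (complex_of_real (1 / norm k) * Bcoup \<phi> m' y' k $ j))"
proof -
  let ?\<kappa> = "(2 * pi) powr (3/2)"
  note c = schwartz_decay(1)[OF \<phi>]
  obtain K where K: "\<And>x. norm (\<phi> x) \<le> K" using schwartz_bounded[OF \<phi>] by blast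
  have m: "(\<lambda>k::real^3. complex_of_real (1 / norm k)) \<in> borel_measurable borel" by measurable
  show ?thesis
  proof (rule schwartz_dominated(1)[OF \<phi>, where C="(1 / ?\<kappa>)\<^sup>2 * K"])
    show "(\<lambda>k. cnj (Bcoup \<phi> m y k $ j) * (complex_of_real (1 / norm k) * Bcoup \<phi> m' y' k $ j)) \<in> borel_measurable borel"
      by (intro borel_measurable_times measurable_compose[OF measurable_Bcoup[OF c] measurable_cnj] measurable_Bcoup[OF c] m)
    fix k :: "real^3"
    let ?N = "norm (\<phi> (norm k)) * (sqrt (norm k) / ?\<kappa>)"
    have "norm (cnj (Bcoup \<phi> m y k $ j) * (complex_of_real (1 / norm k) * Bcoup \<phi> m' y' k $ j))
      = norm (Bcoup \<phi> m y k $ j) * ((1 / norm k) * norm (Bcoup \<phi> m' y' k $ j))"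
      by (simp add: norm_mult norm_divide)
    also have "\<dots> \<le> ?N * ((1 / norm k) * ?N)"
      by (intro mult_mono mult_left_mono norm_Bcoup_le) auto
    also have "\<dots> = (norm (\<phi> (norm k)))\<^sup>2 * ((sqrt (norm k))\<^sup>2 / norm k) * (1 / ?\<kappa>)\<^sup>2"
    proof -
      have "f * (r / c) * ((1 / n) * (f * (r / c))) = f\<^sup>2 * (r\<^sup>2 / n) * (1 / c)\<^sup>2" for f r c n :: real
        by (simp add: power2_eq_square mult_ac)
      then show ?thesis .
    qed
    \<comment> \<open>The quotient (sqrt |k|)^2 / |k| is 1 off the origin and 0 at it.\<close>
    also have "\<dots> \<le> (norm (\<phi> (norm k)))\<^sup>2 * 1 * (1 / ?\<kappa>)\<^sup>2"
      by (intro mult_right_mono mult_left_mono) (auto simp: divide_le_eq)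
    also have "\<dots> = (1 / ?\<kappa>)\<^sup>2 * (norm (\<phi> (norm k)) * norm (\<phi> (norm k)))" by (simp add: power2_eq_square)
    also have "\<dots> \<le> (1 / ?\<kappa>)\<^sup>2 * (K * norm (\<phi> (norm k)))"
      by (intro mult_left_mono mult_right_mono K) auto
    finally show "norm (cnj (Bcoup \<phi> m y k $ j) * (complex_of_real (1 / norm k) * Bcoup \<phi> m' y' k $ j)) \<le> (1 / ?\<kappa>)\<^sup>2 * K * norm (\<phi> (norm k))"
      by (simp only: mult.assoc)
  qed
qed

text \<open>Self-adjointness moves the Pauli operators of the annihilation part onto X; together
  with the conjugate couplings they reassemble the conjugate of \<open>HintE\<close>, so the
  integrand becomes |HintE|^2 / |k|. Integrability of every single term permits pulling the finite
  sums under the integral.\<close>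

lemma spin_inner_A_op:
  assumes \<phi>: "schwartz \<phi>"
  shows "spin_inner P (A_op \<phi> xs M P X) X = - complex_of_real (\<Sum>s\<in>cfg P. LINT k|lborel. (norm (HintE \<phi> xs M P X k s))\<^sup>2 / norm k)"
proof -
  define \<psi> where "\<psi> = Hph_inv1 (HintE \<phi> xs M P X)"
  define G where "G l m s k = (\<Sum>j\<in>UNIV. cnj (Bcoup \<phi> m (xs l) k $ j) * \<psi> k s $ j)" for l m s k
  \<comment> \<open>The conjugate of the coefficient of \<open>Bcoup \<phi> m (xs l)\<close> in
    \<open>HintE\<close>, as \<open>M l\<close> is real.\<close>
  define a where "a l m s = complex_of_real (M l / sqrt 2) * cnj (pauli_on m l X s)" for l m s
  have \<psi>: "\<psi> k s $ j = complex_of_real (1 / norm k) * HintE \<phi> xs M P X k s $ j" for k s j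
    by (simp add: \<psi>_def Hph_inv1_def)
  have Hj: "HintE \<phi> xs M P X k s $ j = (\<Sum>l<P. \<Sum>m\<in>UNIV. (complex_of_real (M l / sqrt 2) * pauli_on m l X s) * Bcoup \<phi> m (xs l) k $ j)" for k s j
    unfolding HintE_def by simp
  have G: "integrable lborel (G l m s)" for l m s
  proof -
    have "G l m s k = (\<Sum>j\<in>UNIV. \<Sum>l'<P. \<Sum>m'\<in>UNIV. (complex_of_real (M l' / sqrt 2) * pauli_on m' l' X s) *
       (cnj (Bcoup \<phi> m (xs l) k $ j) * (complex_of_real (1 / norm k) * Bcoup \<phi> m' (xs l') k $ j)))" for k
      unfolding G_def \<psi> Hj sum_distrib_left by (intro sum.cong refl) (simp only: mult_ac)
    then have "G l m s = (\<lambda>k. (\<Sum>j\<in>UNIV. \<Sum>l'<P. \<Sum>m'\<in>UNIV. (complex_of_real (M l' / sqrt 2) * pauli_on m' l' X s) *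
       (cnj (Bcoup \<phi> m (xs l) k $ j) * (complex_of_real (1 / norm k) * Bcoup \<phi> m' (xs l') k $ j))))" by blast
    then show ?thesis
      by (simp only:) (intro Bochner_Integration.integrable_sum integrable_mult_right integrable_Bcoup_product \<phi>)
  qed
  have "spin_inner P (A_op \<phi> xs M P X) X
    = - (\<Sum>s\<in>cfg P. \<Sum>l<P. \<Sum>m\<in>UNIV. complex_of_real (M l / sqrt 2) * (pauli_on m l (\<lambda>s. LINT k|lborel. G l m s k) s * cnj (X s)))"
    unfolding spin_inner_def A_op_def EstarHint_def \<psi>_def[symmetric] G_def
    by (simp add: sum_distrib_right sum_negf mult.assoc)
  also have "(\<Sum>s\<in>cfg P. \<Sum>l<P. \<Sum>m\<in>UNIV. complex_of_real (M l / sqrt 2) * (pauli_on m l (\<lambda>s. LINT k|lborel. G l m s k) s * cnj (X s)))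
    = (\<Sum>l<P. \<Sum>m\<in>UNIV. complex_of_real (M l / sqrt 2) * (\<Sum>s\<in>cfg P. pauli_on m l (\<lambda>s. LINT k|lborel. G l m s k) s * cnj (X s)))"
    unfolding sum_distrib_left by (subst sum.swap) (intro sum.cong refl sum.swap)
  also have "\<dots> = (\<Sum>l<P. \<Sum>m\<in>UNIV. complex_of_real (M l / sqrt 2) * (\<Sum>s\<in>cfg P. (LINT k|lborel. G l m s k) * cnj (pauli_on m l X s)))"
    by (intro sum.cong refl arg_cong2[where f="(*)"] pauli_on_selfadjoint) simp
  also have "\<dots> = (\<Sum>l<P. \<Sum>m\<in>UNIV. \<Sum>s\<in>cfg P. a l m s * (LINT k|lborel. G l m s k))"
    unfolding sum_distrib_left a_def by (intro sum.cong refl) (simp only: mult_ac)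
  also have "\<dots> = (\<Sum>s\<in>cfg P. \<Sum>l<P. \<Sum>m\<in>UNIV. a l m s * (LINT k|lborel. G l m s k))"
    by (subst (2) sum.swap) (intro sum.cong refl sum.swap)
  also have "\<dots> = (\<Sum>s\<in>cfg P. LINT k|lborel. (\<Sum>l<P. \<Sum>m\<in>UNIV. a l m s * G l m s k))"
    using G by (simp add: Bochner_Integration.integral_sum)
  also have "\<dots> = (\<Sum>s\<in>cfg P. LINT k|lborel. complex_of_real ((norm (HintE \<phi> xs M P X k s))\<^sup>2 / norm k))"
  proof (intro sum.cong refl Bochner_Integration.integral_cong)
    fix s k
    have "(\<Sum>l<P. \<Sum>m\<in>UNIV. a l m s * G l m s k) = (\<Sum>j\<in>UNIV. cnj (HintE \<phi> xs M P X k s $ j) * \<psi> k s $ j)"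
    proof -
      have "(\<Sum>l<P. \<Sum>m\<in>UNIV. a l m s * G l m s k) = (\<Sum>l<P. \<Sum>m\<in>UNIV. \<Sum>j\<in>UNIV. a l m s * cnj (Bcoup \<phi> m (xs l) k $ j) * \<psi> k s $ j)"
        unfolding G_def sum_distrib_left by (simp only: mult.assoc)
      also have "\<dots> = (\<Sum>j\<in>UNIV. \<Sum>l<P. \<Sum>m\<in>UNIV. a l m s * cnj (Bcoup \<phi> m (xs l) k $ j) * \<psi> k s $ j)"
      proof -
        have "(\<Sum>l<P. \<Sum>m\<in>UNIV. \<Sum>j\<in>UNIV. f l m j) = (\<Sum>j\<in>UNIV. \<Sum>l<P. \<Sum>m\<in>UNIV. f l m j)"
          for f :: "nat \<Rightarrow> 3 \<Rightarrow> 3 \<Rightarrow> complex"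
        proof -
          have "(\<Sum>l<P. \<Sum>m\<in>UNIV. \<Sum>j\<in>UNIV. f l m j) = (\<Sum>l<P. \<Sum>j\<in>UNIV. \<Sum>m\<in>UNIV. f l m j)"
            by (intro sum.cong refl sum.swap)
          also have "\<dots> = (\<Sum>j\<in>UNIV. \<Sum>l<P. \<Sum>m\<in>UNIV. f l m j)" by (rule sum.swap)
          finally show ?thesis .
        qed
        then show ?thesis .
      qed
      also have "\<dots> = (\<Sum>j\<in>UNIV. cnj (HintE \<phi> xs M P X k s $ j) * \<psi> k s $ j)"
        unfolding Hj a_def by (simp add: sum_distrib_right)
      finally show ?thesis .
    qed
    also have "\<dots> = complex_of_real (\<Sum>j\<in>UNIV. (norm (HintE \<phi> xs M P X k s $ j))\<^sup>2) * complex_of_real (1 / norm k)"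
      unfolding \<psi> of_real_sum sum_distrib_right complex_norm_square by (intro sum.cong refl) (simp only: mult_ac)
    finally show "(\<Sum>l<P. \<Sum>m\<in>UNIV. a l m s * G l m s k) = complex_of_real ((norm (HintE \<phi> xs M P X k s))\<^sup>2 / norm k)"
      unfolding power2_norm_cvec by simp
  qed
  finally show ?thesis by (simp only: integral_complex_of_real of_real_sum)
qed

section \<open>The magnetic field in position space\<close>

lemma rho_derivative:
  assumes \<phi>: "schwartz \<phi>"
  shows "grad_c (rho \<phi>) x $ a = complex_of_real ((2 * pi) powr (-3)) * (LINT k|lborel. \<i> * complex_of_real (k $ a) * \<phi> (norm k) * cis (k \<bullet> x))"
proof -
  have m: "(\<lambda>k::real^3. \<phi> (norm k)) \<in> borel_measurable borel"
    by (intro borel_measurable_continuous_onI continuous_radial schwartz_decay(1)[OF \<phi>])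
  note d = schwartz_dominated[OF \<phi> m, of 1]
  have "rho \<phi> = (\<lambda>x. complex_of_real ((2 * pi) powr (-3)) * ft (\<lambda>k. \<phi> (norm k)) x)"
    by (simp add: rho_def ft_def fun_eq_iff)
  then have "(rho \<phi> has_derivative (\<lambda>h. complex_of_real ((2 * pi) powr (-3)) *
      (LINT k|lborel. \<i> * complex_of_real (k \<bullet> h) * \<phi> (norm k) * cis (k \<bullet> x)))) (at x)"
    by (simp only:) (intro has_derivative_mult_right has_derivative_ft, use d in auto)
  from frechet_derivative_at[OF this, symmetric] show ?thesis
    by (simp add: grad_c_def pd_def inner_axis)
qed

text \<open>Differentiation brings down a factor i k, so transversality gives zero divergence, and
  by \<open>ft_field_curl\<close> the antisymmetrised derivatives involve \<phi> S only. The phases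
  in S shift x to \<open>x - xs l\<close>, which produces the gradients of \<open>rho\<close> at
  these points; the factor (2 pi)^(-3) is the one in \<open>rho\<close>.\<close>

lemma ft_field_derivative_curl:
  fixes xs :: "nat \<Rightarrow> real^3" and M :: "nat \<Rightarrow> real" and P :: nat and v :: "nat \<Rightarrow> complex^3" and x :: "real^3"
  assumes \<phi>: "schwartz \<phi>"
  defines "b \<equiv> ft_field \<phi> (spin_source xs M P v)"
  defines "L \<equiv> \<lambda>i h. LINT k|lborel. \<i> * complex_of_real (k \<bullet> h) * b i k * cis (k \<bullet> x)"
  shows "(ft (b i) has_derivative L i) (at x)"
    and "(\<Sum>i\<in>UNIV. L i (axis i 1)) = 0"
    and "complex_of_real ((2 * pi) powr (-3)) * (L i (axis j 1) - L j (axis i 1)) =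
      (\<Sum>l<P. complex_of_real (M l) * (grad_c (rho \<phi>) (x - xs l) $ j * v l $ i - grad_c (rho \<phi>) (x - xs l) $ i * v l $ j))"
proof -
  let ?S = "spin_source xs M P v" and ?c = "complex_of_real ((2 * pi) powr (-3))"
  note c = schwartz_decay(1)[OF \<phi>]
  have mb: "b i \<in> borel_measurable borel" for i unfolding b_def by (rule measurable_ft_field[OF c continuous_spin_source])
  have bb: "norm (b i k) \<le> (4 * (\<Sum>l<P. \<bar>M l\<bar> * norm (v l))) * norm (\<phi> (norm k))" for i k
    unfolding b_def by (rule norm_ft_field_le) (rule norm_spin_source_le)
  note db = schwartz_dominated[OF \<phi> mb bb]
  show "(ft (b i) has_derivative L i) (at x)" for i
    unfolding L_def by (rule has_derivative_ft[OF db])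
  have iL: "integrable lborel (\<lambda>k. \<i> * complex_of_real (k \<bullet> h) * b i k * cis (k \<bullet> x))" for i h
    by (rule integrable_ft_derivative(2)[OF db])
  show "(\<Sum>i\<in>UNIV. L i (axis i 1)) = 0"
  proof -
    have "(\<Sum>i\<in>UNIV. L i (axis i 1)) = (LINT k|lborel. (\<Sum>i\<in>UNIV. \<i> * complex_of_real (k \<bullet> axis i 1) * b i k * cis (k \<bullet> x)))"
      unfolding L_def by (rule Bochner_Integration.integral_sum[symmetric]) (rule iL)
    also have "(\<lambda>k. \<Sum>i\<in>UNIV. \<i> * complex_of_real (k \<bullet> axis i 1) * b i k * cis (k \<bullet> x)) = (\<lambda>k. \<i> * cis (k \<bullet> x) * (\<Sum>i\<in>UNIV. complex_of_real (k $ i) * b i k))"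
      by (simp add: sum_distrib_left inner_axis mult_ac)
    also have "\<dots> = (\<lambda>k. 0)" unfolding b_def ft_field_transverse by simp
    finally show ?thesis by simp
  qed
  have m: "(\<lambda>k::real^3. \<phi> (norm k)) \<in> borel_measurable borel"
    by (intro borel_measurable_continuous_onI continuous_radial c)
  have i\<phi>: "integrable lborel (\<lambda>k. \<i> * complex_of_real (k $ a) * \<phi> (norm k) * cis (k \<bullet> y))" for a and y :: "real^3"
    using integrable_ft_derivative(2)[OF schwartz_dominated[OF \<phi> m, of 1], of "axis a 1" y] by (simp add: inner_axis)
  define g where "g a y = (LINT k|lborel. \<i> * complex_of_real (k $ a) * \<phi> (norm k) * cis (k \<bullet> y))" for a and y :: "real^3"
  have "L i (axis j 1) - L j (axis i 1) = (LINT k|lborel. \<i> * cis (k \<bullet> x) * (complex_of_real (k $ j) * b i k - complex_of_real (k $ i) * b j k))"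
    unfolding L_def using iL[of "axis j 1" i] iL[of "axis i 1" j]
    by (subst Bochner_Integration.integral_diff[symmetric]) (auto simp: inner_axis algebra_simps)
  also have "\<dots> = (LINT k|lborel. (\<Sum>l<P. complex_of_real (M l) * ((\<i> * complex_of_real (k $ j) * \<phi> (norm k) * cis (k \<bullet> (x - xs l))) * v l $ i
      - (\<i> * complex_of_real (k $ i) * \<phi> (norm k) * cis (k \<bullet> (x - xs l))) * v l $ j)))"
  proof (intro Bochner_Integration.integral_cong refl)
    fix k
    have cis: "cis (k \<bullet> (x - xs l)) = cis (k \<bullet> x) * cis (- (k \<bullet> xs l))" for l
      by (simp only: cis_mult inner_diff_right) simp
    have S: "?S k $ i = (\<Sum>l<P. complex_of_real (M l) * cis (- (k \<bullet> xs l)) * v l $ i)" for i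
      by (simp add: spin_source_def)
    show "\<i> * cis (k \<bullet> x) * (complex_of_real (k $ j) * b i k - complex_of_real (k $ i) * b j k) =
      (\<Sum>l<P. complex_of_real (M l) * ((\<i> * complex_of_real (k $ j) * \<phi> (norm k) * cis (k \<bullet> (x - xs l))) * v l $ i
      - (\<i> * complex_of_real (k $ i) * \<phi> (norm k) * cis (k \<bullet> (x - xs l))) * v l $ j))"
      unfolding b_def ft_field_curl S cis right_diff_distrib sum_distrib_left sum_subtractf
      by (intro arg_cong2[where f="(-)"] sum.cong refl) (simp_all only: mult_ac)
  qed
  also have "\<dots> = (\<Sum>l<P. complex_of_real (M l) * (g j (x - xs l) * v l $ i - g i (x - xs l) * v l $ j))"
    unfolding g_def using i\<phi> by (simp add: Bochner_Integration.integral_sum)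
  finally show "?c * (L i (axis j 1) - L j (axis i 1)) =
      (\<Sum>l<P. complex_of_real (M l) * (grad_c (rho \<phi>) (x - xs l) $ j * v l $ i - grad_c (rho \<phi>) (x - xs l) $ i * v l $ j))"
    unfolding rho_derivative[OF \<phi>] g_def[symmetric] by (simp add: sum_distrib_left algebra_simps)
qed

lemma jvect_component:
  "jvect \<phi> xs M P X x s $ 1 = (\<Sum>l<P. complex_of_real (M l) * (grad_c (rho \<phi>) (x - xs l) $ 2 * pauli_vec l X s $ 3 - grad_c (rho \<phi>) (x - xs l) $ 3 * pauli_vec l X s $ 2))"
  "jvect \<phi> xs M P X x s $ 2 = (\<Sum>l<P. complex_of_real (M l) * (grad_c (rho \<phi>) (x - xs l) $ 3 * pauli_vec l X s $ 1 - grad_c (rho \<phi>) (x - xs l) $ 1 * pauli_vec l X s $ 3))"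
  "jvect \<phi> xs M P X x s $ 3 = (\<Sum>l<P. complex_of_real (M l) * (grad_c (rho \<phi>) (x - xs l) $ 1 * pauli_vec l X s $ 2 - grad_c (rho \<phi>) (x - xs l) $ 2 * pauli_vec l X s $ 1))"
  by (simp_all add: jvect_def ccross_def)

text \<open>The curl lists only the cyclic index pairs; antisymmetry extends the equality to all
  pairs, which is the form matching the symmetry hypothesis of
  \<open>div_curl_free_L2_eq_0\<close>.\<close>

lemma antisymmetric3_eqI:
  fixes f g :: "3 \<Rightarrow> 3 \<Rightarrow> 'a::ab_group_add"
  assumes "\<And>a b. f b a = - f a b" "\<And>a b. g b a = - g a b" "\<And>a. f a a = 0" "\<And>a. g a a = 0"
    and "f 2 3 = g 2 3" "f 3 1 = g 3 1" "f 1 2 = g 1 2"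
  shows "f a b = g a b"
  using exhaust_3[of a] exhaust_3[of b] assms by metis

text \<open>Equal divergences make the derivative of the difference trace-free, equal curls make it
  symmetric. These are the pointwise hypotheses of \<open>div_curl_free_L2_eq_0\<close>, which takes
  the Frechet derivative of B as it is given.\<close>

lemma magnetic_field_eq:
  assumes \<phi>: "schwartz \<phi>"
    and diff: "\<And>x. B differentiable (at x)"
    and L2: "integrable lborel (\<lambda>x. (norm (B x))\<^sup>2)"
    and div: "\<And>x. divergence B x = 0"
    and curl: "\<And>x. curl B x = jvect \<phi> xs M P X x s"
  shows "B x $ i = complex_of_real ((2 * pi) powr (-3)) * ft (ft_field \<phi> (spin_source xs M P (\<lambda>l. pauli_vec l X s)) i) x"
proof -
  let ?c = "complex_of_real ((2 * pi) powr (-3))" and ?v = "\<lambda>l. pauli_vec l X s"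
  let ?S = "spin_source xs M P ?v"
  define b where "b = ft_field \<phi> ?S"
  define L where "L i x h = (LINT k|lborel. \<i> * complex_of_real (k \<bullet> h) * b i k * cis (k \<bullet> x))" for i x h
  note F = ft_field_derivative_curl[OF \<phi>, where xs=xs and M=M and P=P and v="?v", folded b_def, folded L_def]
  define J where "J x a e = (\<Sum>l<P. complex_of_real (M l) * (grad_c (rho \<phi>) (x - xs l) $ a * ?v l $ e - grad_c (rho \<phi>) (x - xs l) $ e * ?v l $ a))" for x a e
  have Jflip: "J x e a = - J x a e" for x a e unfolding J_def sum_negf[symmetric] by (simp add: algebra_simps)
  define p where "p x a e = pd B x a $ e" for x a e
  have rot: "p x a e - p x e a = J x a e" for x a e
  proof (rule antisymmetric3_eqI[where f="\<lambda>a e. p x a e - p x e a" and g="J x"])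
    have "curl B x $ 1 = J x 2 3" "curl B x $ 2 = J x 3 1" "curl B x $ 3 = J x 1 2"
      unfolding curl jvect_component J_def by simp_all
    then show "p x 2 3 - p x 3 2 = J x 2 3" "p x 3 1 - p x 1 3 = J x 3 1" "p x 1 2 - p x 2 1 = J x 1 2"
      unfolding p_def by (simp_all add: curl_def)
    show "J x a a = 0" for a by (simp add: J_def)
  qed (simp, rule Jflip, simp)
  have dB: "((\<lambda>y. B y $ i) has_derivative (\<lambda>h. frechet_derivative B (at x) h $ i)) (at x)" for i x
    by (rule bounded_linear.has_derivative[OF bounded_linear_vec_nth frechet_derivative_works[THEN iffD1, OF diff]])
  let ?D = "\<lambda>i x. B x $ i - ?c * ft (b i) x"
  let ?D' = "\<lambda>i x h. frechet_derivative B (at x) h $ i - ?c * L i x h"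
  have "?D i x = 0"
  proof (rule div_curl_free_L2_eq_0)
    show "(?D i has_derivative ?D' i x) (at x)" for i x
      by (intro has_derivative_diff dB has_derivative_mult_right F(1))
    show "?D' i x (axis j 1) = ?D' j x (axis i 1)" for i j x
    proof -
      have "p x j i - p x i j = ?c * (L i x (axis j 1) - L j x (axis i 1))"
        unfolding rot J_def F(3) ..
      then show ?thesis by (simp add: p_def pd_def algebra_simps)
    qed
    show "(\<Sum>i\<in>UNIV. ?D' i x (axis i 1)) = 0" for x
    proof -
      have "(\<Sum>i\<in>UNIV. ?D' i x (axis i 1)) = divergence B x - ?c * (\<Sum>i\<in>UNIV. L i x (axis i 1))"
        by (simp add: divergence_def pd_def sum_subtractf sum_distrib_left)
      then show ?thesis by (simp add: div F(2))
    qed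
    show "integrable lborel (\<lambda>x. (norm (?D i x))\<^sup>2)" for i
    proof (rule Bochner_Integration.integrable_bound)
      note c = schwartz_decay(1)[OF \<phi>]
      have mb: "b i \<in> borel_measurable borel" unfolding b_def by (rule measurable_ft_field[OF c continuous_spin_source])
      have "integrable lborel (\<lambda>x. (norm (ft (b i) x))\<^sup>2)" unfolding b_def by (rule ft_field_L2(1)[OF \<phi>])
      then show "integrable lborel (\<lambda>x. 2 * (norm (B x))\<^sup>2 + 2 * (norm ?c)\<^sup>2 * (norm (ft (b i) x))\<^sup>2)" using L2 by auto
      have "continuous_on UNIV (\<lambda>x. B x $ i)"
        using dB by (intro continuous_at_imp_continuous_on ballI) (rule has_derivative_continuous)
      then have "(\<lambda>x. B x $ i) \<in> borel_measurable borel" by (rule borel_measurable_continuous_onI)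
      moreover have "ft (b i) \<in> borel_measurable borel" by (rule measurable_ft[OF mb])
      ultimately have "?D i \<in> borel_measurable borel" by (intro borel_measurable_diff borel_measurable_times) auto
      then show "(\<lambda>x. (norm (?D i x))\<^sup>2) \<in> borel_measurable lborel" by simp
      have "(norm (?D i x))\<^sup>2 \<le> 2 * (norm (B x))\<^sup>2 + 2 * (norm ?c)\<^sup>2 * (norm (ft (b i) x))\<^sup>2" for x
      proof -
        have "norm (?D i x) \<le> norm (B x) + norm ?c * norm (ft (b i) x)"
          using norm_triangle_ineq4[of "B x $ i" "?c * ft (b i) x"] Finite_Cartesian_Product.norm_nth_le[of "B x" i]
          by (simp only: norm_mult)
        then have "(norm (?D i x))\<^sup>2 \<le> (norm (B x) + norm ?c * norm (ft (b i) x))\<^sup>2" by (intro power_mono) auto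
        also have "\<dots> \<le> 2 * (norm (B x))\<^sup>2 + 2 * (norm ?c * norm (ft (b i) x))\<^sup>2"
          using sum_squares_bound[of "norm (B x)" "norm ?c * norm (ft (b i) x)"] unfolding power2_sum by linarith
        finally show ?thesis by (simp only: power_mult_distrib mult.assoc)
      qed
      then show "AE x in lborel. norm ((norm (?D i x))\<^sup>2) \<le> norm (2 * (norm (B x))\<^sup>2 + 2 * (norm ?c)\<^sup>2 * (norm (ft (b i) x))\<^sup>2)"
        by (intro AE_I2) (simp only: real_norm_def abs_of_nonneg[OF zero_le_power2], rule order_trans[OF _ abs_ge_self], simp only:)
    qed
  qed
  then show ?thesis by (simp add: b_def)
qed

text \<open>The field carries c = (2 pi)^(-3), hence c^2 in the energy; Plancherel's (2 pi)^3
  reduces this to c, and the c/2 of \<open>HintE_energy\<close> leaves the factor 2. The integrands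
  are compared almost everywhere because at k = 0 \<open>ft_field\<close> keeps \<phi>(0) S(0) while
  \<open>HintE\<close> vanishes.\<close>

lemma magnetic_energy:
  assumes \<phi>: "schwartz \<phi>"
    and diff: "\<And>x. B differentiable (at x)"
    and L2: "integrable lborel (\<lambda>x. (norm (B x))\<^sup>2)"
    and div: "\<And>x. divergence B x = 0"
    and curl: "\<And>x. curl B x = jvect \<phi> xs M P X x s"
  shows "(LINT x|lborel. (norm (B x))\<^sup>2) = 2 * (LINT k|lborel. (norm (HintE \<phi> xs M P X k s))\<^sup>2 / norm k)"
proof -
  let ?c = "(2 * pi) powr (-3)" and ?S = "spin_source xs M P (\<lambda>l. pauli_vec l X s)"
  have c3: "?c * (2 * pi) ^ 3 = 1"
    using powr_minus_divide[of "2 * pi" 3] by simp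
  note F = ft_field_L2[OF \<phi>, where xs=xs and M=M and P=P and v="\<lambda>l. pauli_vec l X s"]
  have "(norm (B x))\<^sup>2 = (\<Sum>i\<in>UNIV. ?c\<^sup>2 * (norm (ft (ft_field \<phi> ?S i) x))\<^sup>2)" for x
    unfolding power2_norm_cvec magnetic_field_eq[OF assms]
    by (simp only: norm_mult power_mult_distrib norm_of_real power2_abs)
  then have "(LINT x|lborel. (norm (B x))\<^sup>2) = (\<Sum>i\<in>UNIV. ?c\<^sup>2 * (LINT x|lborel. (norm (ft (ft_field \<phi> ?S i) x))\<^sup>2))"
    using F(1) by (simp add: Bochner_Integration.integral_sum)
  also have "\<dots> = (\<Sum>i\<in>UNIV. ?c * (?c * (2 * pi) ^ 3) * (LINT k|lborel. (norm (ft_field \<phi> ?S i k))\<^sup>2))"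
    unfolding F(2) by (simp only: power2_eq_square mult.assoc)
  also have "\<dots> = ?c * (LINT k|lborel. (\<Sum>i\<in>UNIV. (norm (ft_field \<phi> ?S i k))\<^sup>2))"
    unfolding c3 using F(3) by (simp add: Bochner_Integration.integral_sum sum_distrib_left)
  also have "(LINT k|lborel. (\<Sum>i\<in>UNIV. (norm (ft_field \<phi> ?S i k))\<^sup>2))
    = (LINT k|lborel. 2 / ?c * ((norm (HintE \<phi> xs M P X k s))\<^sup>2 / norm k))"
  proof (rule integral_cong_AE)
    have "AE k in lborel. k \<noteq> (0 :: real^3)" by (rule AE_lborel_singleton)
    then show "AE k in lborel. (\<Sum>i\<in>UNIV. (norm (ft_field \<phi> ?S i k))\<^sup>2) = 2 / ?c * ((norm (HintE \<phi> xs M P X k s))\<^sup>2 / norm k)"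
      by eventually_elim (simp add: power2_norm_ft_field HintE_energy)
    have "integrable lborel (\<lambda>k. \<Sum>i\<in>UNIV. (norm (ft_field \<phi> ?S i k))\<^sup>2)" using F(3) by auto
    then show "(\<lambda>k. \<Sum>i\<in>UNIV. (norm (ft_field \<phi> ?S i k))\<^sup>2) \<in> borel_measurable lborel" by (rule borel_measurable_integrable)
    have "(\<lambda>k. HintE \<phi> xs M P X k s $ j) \<in> borel_measurable borel" for j
      unfolding HintE_def sum_component vector_smult_component
      by (intro borel_measurable_sum borel_measurable_times measurable_Bcoup schwartz_decay(1)[OF \<phi>]) auto
    then show "(\<lambda>k. 2 / ?c * ((norm (HintE \<phi> xs M P X k s))\<^sup>2 / norm k)) \<in> borel_measurable lborel"
      unfolding power2_norm_cvec by simp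
  qed
  finally show ?thesis by (simp only: integral_mult_right_zero) simp
qed

theorem theorem2p2:
  fixes \<phi> :: "real \<Rightarrow> complex" and P :: nat
    and xs :: "nat \<Rightarrow> real^3" and M :: "nat \<Rightarrow> real"
    and X :: "bool list \<Rightarrow> complex"
    and Bv :: "real^3 \<Rightarrow> bool list \<Rightarrow> complex^3"
  assumes "P \<ge> 1"
    and "schwartz \<phi>"
    and "\<forall>s\<in>cfg P. \<forall>x. (\<lambda>y. Bv y s) differentiable (at x)"
    and "\<forall>s\<in>cfg P. integrable lborel (\<lambda>x. (norm (Bv x s))\<^sup>2)"
    and "\<forall>s\<in>cfg P. \<forall>x. divergence (\<lambda>y. Bv y s) x = 0"
    and "\<forall>s\<in>cfg P. \<forall>x. curl (\<lambda>y. Bv y s) x = jvect \<phi> xs M P X x s"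
  shows "spin_inner P (A_op \<phi> xs M P X) X
           = complex_of_real (- (1/2) * (LINT x|lborel. (\<Sum>s\<in>cfg P. (norm (Bv x s))\<^sup>2)))"
proof -
  \<comment> \<open>The squared norm of the field splits over configurations, each a separate
    div-curl problem with source \<open>jvect\<close> at s.\<close>
  have "(LINT x|lborel. (\<Sum>s\<in>cfg P. (norm (Bv x s))\<^sup>2)) = (\<Sum>s\<in>cfg P. LINT x|lborel. (norm (Bv x s))\<^sup>2)"
    using assms(4) by (intro Bochner_Integration.integral_sum) auto
  also have "\<dots> = (\<Sum>s\<in>cfg P. 2 * (LINT k|lborel. (norm (HintE \<phi> xs M P X k s))\<^sup>2 / norm k))"
    using assms(2-6) by (intro sum.cong refl magnetic_energy) auto
  finally show ?thesis
    unfolding spin_inner_A_op[OF assms(2)] by (simp add: sum_distrib_left[symmetric])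
qed

end
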